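(* Let $K$ be a commutative ring, $\delta\in K$, $r\ge1$. The assignment $t_{ij}\mapsto\mathbb H_{i-1,j-1}(r)$ for $1\le i<j\le r+1$ extends to a unique algebra homomorphism $\Phi_r:T_{r+1}\to AB_r(\delta)$, which is surjective if $\delta-2$ is a unit in $K$.
   Context: Let $\mathcal B(\delta)$ be the Brauer category over $K$ (objects $\mathbb N$, morphisms spanned by Brauer diagrams, composition by stacking with closed loops replaced by $\delta$, $\otimes$ juxtaposition), with identity $I$, crossing $X$, cap $\cap:2\to0$, cup $\cup:0\to2$, $I_r=I^{\otimes r}$, $H=X-\cup\circ\cap$. The polar Brauer category $\mathcal{AB}(\delta)$ is the $K$-linear category with objects $\mathbb N$ generated, under composition and the right action $\mathbb D\mapsto\mathbb D\otimes B$ of Brauer morphisms $B$ (juxtaposed on the right), by $\mathbb I_0$ (a vertical pole, identity of $0$) and $\mathbb H:1\to1$ (pole joined by a horizontal connector to one thin strand), subject to: $(\mathbb I_0\otimes B)(\mathbb I_0\otimes A)=\mathbb I_0\otimes BA$, $(\mathbb H\otimes B)(\mathbb I_1\otimes A)=(\mathbb I_1\otimes B)(\mathbb H\otimes A)=\mathbb H\otimes BA$ ($\mathbb I_r=\mathbb I_0\otimes I_r$); the four-term relation $[\mathbb H\otimes I,\mathbb X_0(\mathbb H\otimes I)\mathbb X_0+\mathbb I_0\otimes H]=0$ with $\mathbb X_0=\mathbb I_0\otimes X$; and skew symmetry $(\mathbb I_0\otimes\cap\otimes I)(\mathbb H\otimes X)(\mathbb I_0\otimes\cup\otimes I)=-\mathbb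 H$; all imposed in every composite and right tensor product. The chord algebra $T_{r+1}$ is generated by $t_{ij}$ ($1\le i<j\le r+1$, with $t_{ji}=t_{ij}$) subject to $[t_{ij},t_{k\ell}]=0$, $[t_{ik}+t_{i\ell},t_{k\ell}]=0$, $[t_{ij},t_{ik}+t_{jk}]=0$ for pairwise distinct indices. In $\mathrm{End}_{\mathcal{AB}(\delta)}(r)$: for $1\le i\le r$, let $\sigma$ be the permutation Brauer diagram moving strand $i$ to position $1$ and strands $1,\dots,i-1$ to positions $2,\dots,i$, and $\mathbb H_{0i}(r)=(\mathbb I_0\otimes\sigma^{-1})(\mathbb H\otimes I_{r-1})(\mathbb I_0\otimes\sigma)$ (the connector attached to strand $i$). For $1\le i<j\le r$, $\mathbb H_{ij}(r)=\mathbb I_0\otimes H_{ij}$ where $H_{ij}=(i\,j)-e_{ij}$, $(i\,j)$ the transposition diagram and $e_{ij}$ the diagram joining bottom $i$ to bottom $j$ and top $i$ to top $j$, other strands vertical. $AB_r(\delta)$ is the subalgebra of $\mathrm{End}_{\mathcal{AB}(\delta)}(r)$ generated by the $\mathbb H_{0j}(r)$, $1\le j\le r$, and $\iota(s_k)=\mathbb I_0\otimes s_k$, $\iota(e_k)=\mathbb I_0\otimes e_k$, $1\le k\le r-1$, where $s_k=(k\,k+1)$, $e_k=e_{k,k+1}$. *)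

theory Defs
  imports Main
begin

text \<open>A point of a Brauer diagram m -> n: (False,i) is the i-th bottom (source) point,
  i < m; (True,j) is the j-th top (target) point, j < n (0-indexed).
  A diagram is a perfect matching of these points, stored as a symmetric irreflexive
  relation in which every point has exactly one partner.\<close>

type_synonym pt = "bool \<times> nat"
type_synonym diag = "(pt \<times> pt) set"

definition pts :: "nat \<Rightarrow> nat \<Rightarrow> pt set" where
  "pts m n = {(False,i) | i. i < m} \<union> {(True,j) | j. j < n}"

definition is_diag :: "nat \<Rightarrow> nat \<Rightarrow> diag \<Rightarrow> bool" where
  "is_diag m n D \<longleftrightarrow> D \<subseteq> pts m n \<times> pts m n \<and> sym D \<and> (\<forall>x. (x,x) \<notin> D)
     \<and> (\<forall>x\<in>pts m n. \<exists>!y. (x,y) \<in> D)"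

text \<open>Stacking B on top of A (composite B o A): levels 0 (source of A), 1 (middle),
  2 (target of B).\<close>

definition lowerL :: "pt \<Rightarrow> nat \<times> nat" where
  "lowerL p = (if fst p then (1, snd p) else (0, snd p))"
definition upperL :: "pt \<Rightarrow> nat \<times> nat" where
  "upperL p = (if fst p then (2, snd p) else (1, snd p))"
definition outerL :: "pt \<Rightarrow> nat \<times> nat" where
  "outerL p = (if fst p then (2, snd p) else (0, snd p))"

definition stack_graph :: "diag \<Rightarrow> diag \<Rightarrow> ((nat \<times> nat) \<times> (nat \<times> nat)) set" where
  "stack_graph B A = map_prod lowerL lowerL ` A \<union> map_prod upperL upperL ` B"

definition dcomp :: "diag \<Rightarrow> diag \<Rightarrow> diag" where
  "dcomp B A = {(x,y). x \<noteq> y \<and> (outerL x, outerL y) \<in> (stack_graph B A)\<^sup>*}"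

definition dloops :: "diag \<Rightarrow> diag \<Rightarrow> nat" where
  "dloops B A = card {(stack_graph B A)\<^sup>* `` {v} | v. v \<in> Domain (stack_graph B A)
        \<and> (\<forall>w \<in> (stack_graph B A)\<^sup>* `` {v}. fst w = 1)}"

definition shift_pt :: "nat \<Rightarrow> nat \<Rightarrow> pt \<Rightarrow> pt" where
  "shift_pt a b p = (if fst p then (True, snd p + b) else (False, snd p + a))"

definition dtens :: "nat \<Rightarrow> nat \<Rightarrow> diag \<Rightarrow> diag \<Rightarrow> diag" where
  "dtens m n D D' = D \<union> map_prod (shift_pt m n) (shift_pt m n) ` D'"

definition symc :: "diag \<Rightarrow> diag" where
  "symc S = S \<union> converse S"

definition perm_diag :: "nat \<Rightarrow> (nat \<Rightarrow> nat) \<Rightarrow> diag" where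
  "perm_diag n p = symc {((False,a),(True, p a)) | a. a < n}"

definition idd :: "nat \<Rightarrow> diag" where "idd n = perm_diag n id"
definition Xd :: diag where "Xd = perm_diag 2 (\<lambda>a. 1 - a)"
definition capd :: diag where "capd = symc {((False,0),(False,1))}"
definition cupd :: diag where "cupd = symc {((True,0),(True,1))}"

definition swp :: "nat \<Rightarrow> nat \<Rightarrow> nat \<Rightarrow> nat" where
  "swp i j a = (if a = i then j else if a = j then i else a)"

text \<open>1-indexed (i j) and e_ij on r strands\<close>
definition transd :: "nat \<Rightarrow> nat \<Rightarrow> nat \<Rightarrow> diag" where
  "transd n i j = perm_diag n (swp (i - 1) (j - 1))"

definition ed :: "nat \<Rightarrow> nat \<Rightarrow> nat \<Rightarrow> diag" where
  "ed n i j = symc ({((False, i - 1), (False, j - 1)), ((True, i - 1), (True, j - 1))}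
       \<union> {((False,a),(True,a)) | a. a < n \<and> a \<noteq> i - 1 \<and> a \<noteq> j - 1})"

text \<open>sigma moving strand i (1-indexed) to position 1 and strands 1..i-1 to 2..i, and its inverse\<close>
definition sigd :: "nat \<Rightarrow> nat \<Rightarrow> diag" where
  "sigd n i = perm_diag n (\<lambda>a. if a < i - 1 then a + 1 else if a = i - 1 then 0 else a)"
definition siginvd :: "nat \<Rightarrow> nat \<Rightarrow> diag" where
  "siginvd n i = perm_diag n (\<lambda>a. if a = 0 then i - 1 else if a \<le> i - 1 then a - 1 else a)"

section \<open>The polar Brauer category, by generators and relations\<close>

text \<open>Formal expressions: PTens e m' n' D is e (x) D with D a Brauer diagram m' -> n'.\<close>
datatype 'k pexp = PZero nat nat | PAdd "'k pexp" "'k pexp" | PSmul 'k "'k pexp"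
  | PI0 | PH | PComp "'k pexp" "'k pexp" | PTens "'k pexp" nat nat diag

inductive pwt :: "'k pexp \<Rightarrow> nat \<Rightarrow> nat \<Rightarrow> bool" where
  "pwt (PZero m n) m n"
| "pwt a m n \<Longrightarrow> pwt b m n \<Longrightarrow> pwt (PAdd a b) m n"
| "pwt a m n \<Longrightarrow> pwt (PSmul c a) m n"
| "pwt PI0 0 0"
| "pwt PH 1 1"
| "pwt a k n \<Longrightarrow> pwt b m k \<Longrightarrow> pwt (PComp a b) m n"
| "pwt a m n \<Longrightarrow> is_diag m' n' D \<Longrightarrow> pwt (PTens a m' n' D) (m + m') (n + n')"

definition pid :: "nat \<Rightarrow> 'k pexp" where "pid n = PTens PI0 n n (idd n)"

definition pneg :: "'k::comm_ring_1 pexp \<Rightarrow> 'k pexp" where "pneg a = PSmul (-1) a"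

definition H1e :: "'k pexp" where "H1e = PTens PH 1 1 (idd 1)"
definition X0e :: "'k pexp" where "X0e = PTens PI0 2 2 Xd"
definition HBe :: "'k::comm_ring_1 pexp" where        \<comment> \<open>I_0 (x) H, H = X - cup o cap\<close>
  "HBe = PAdd (PTens PI0 2 2 Xd) (pneg (PTens PI0 2 2 (dcomp cupd capd)))"
definition fourterm_lhs :: "'k::comm_ring_1 pexp" where
  "fourterm_lhs = (let Y = PAdd (PComp X0e (PComp H1e X0e)) HBe
                   in PAdd (PComp H1e Y) (pneg (PComp Y H1e)))"
definition skew_lhs :: "'k pexp" where
  "skew_lhs = PComp (PTens PI0 3 1 (dtens 2 0 capd (idd 1)))
                (PComp (PTens PH 2 2 Xd) (PTens PI0 1 3 (dtens 0 2 cupd (idd 1))))"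

text \<open>The congruence generated by: K-linear category axioms, the (functorial, associative,
  unital, linear) right action of Brauer diagrams, and the defining relations.\<close>
inductive peq :: "'k::comm_ring_1 \<Rightarrow> nat \<Rightarrow> nat \<Rightarrow> 'k pexp \<Rightarrow> 'k pexp \<Rightarrow> bool" for \<delta> :: 'k where
  refl: "pwt a m n \<Longrightarrow> peq \<delta> m n a a"
| sym: "peq \<delta> m n a b \<Longrightarrow> peq \<delta> m n b a"
| trans: "peq \<delta> m n a b \<Longrightarrow> peq \<delta> m n b c \<Longrightarrow> peq \<delta> m n a c"
| add_cong: "peq \<delta> m n a a' \<Longrightarrow> peq \<delta> m n b b' \<Longrightarrow> peq \<delta> m n (PAdd a b) (PAdd a' b')"
| smul_cong: "peq \<delta> m n a a' \<Longrightarrow> peq \<delta> m n (PSmul c a) (PSmul c a')"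
| comp_cong: "peq \<delta> k n a a' \<Longrightarrow> peq \<delta> m k b b' \<Longrightarrow> peq \<delta> m n (PComp a b) (PComp a' b')"
| tens_cong: "peq \<delta> m n a a' \<Longrightarrow> is_diag m' n' D \<Longrightarrow>
     peq \<delta> (m + m') (n + n') (PTens a m' n' D) (PTens a' m' n' D)"
| add_assoc: "pwt a m n \<Longrightarrow> pwt b m n \<Longrightarrow> pwt c m n \<Longrightarrow>
     peq \<delta> m n (PAdd (PAdd a b) c) (PAdd a (PAdd b c))"
| add_comm: "pwt a m n \<Longrightarrow> pwt b m n \<Longrightarrow> peq \<delta> m n (PAdd a b) (PAdd b a)"
| add_zero: "pwt a m n \<Longrightarrow> peq \<delta> m n (PAdd a (PZero m n)) a"
| add_neg: "pwt a m n \<Longrightarrow> peq \<delta> m n (PAdd a (PSmul (-1) a)) (PZero m n)"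
| smul_add: "pwt a m n \<Longrightarrow> pwt b m n \<Longrightarrow>
     peq \<delta> m n (PSmul c (PAdd a b)) (PAdd (PSmul c a) (PSmul c b))"
| add_smul: "pwt a m n \<Longrightarrow> peq \<delta> m n (PSmul (c + d) a) (PAdd (PSmul c a) (PSmul d a))"
| smul_smul: "pwt a m n \<Longrightarrow> peq \<delta> m n (PSmul (c * d) a) (PSmul c (PSmul d a))"
| smul_one: "pwt a m n \<Longrightarrow> peq \<delta> m n (PSmul 1 a) a"
| comp_assoc: "pwt a k n \<Longrightarrow> pwt b l k \<Longrightarrow> pwt c m l \<Longrightarrow>
     peq \<delta> m n (PComp (PComp a b) c) (PComp a (PComp b c))"
| comp_id_left: "pwt a m n \<Longrightarrow> peq \<delta> m n (PComp (pid n) a) a"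
| comp_id_right: "pwt a m n \<Longrightarrow> peq \<delta> m n (PComp a (pid m)) a"
| comp_add_left: "pwt a k n \<Longrightarrow> pwt a' k n \<Longrightarrow> pwt b m k \<Longrightarrow>
     peq \<delta> m n (PComp (PAdd a a') b) (PAdd (PComp a b) (PComp a' b))"
| comp_add_right: "pwt a k n \<Longrightarrow> pwt b m k \<Longrightarrow> pwt b' m k \<Longrightarrow>
     peq \<delta> m n (PComp a (PAdd b b')) (PAdd (PComp a b) (PComp a b'))"
| comp_smul_left: "pwt a k n \<Longrightarrow> pwt b m k \<Longrightarrow>
     peq \<delta> m n (PComp (PSmul c a) b) (PSmul c (PComp a b))"
| comp_smul_right: "pwt a k n \<Longrightarrow> pwt b m k \<Longrightarrow>
     peq \<delta> m n (PComp a (PSmul c b)) (PSmul c (PComp a b))"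
| tens_add: "pwt a m n \<Longrightarrow> pwt b m n \<Longrightarrow> is_diag m' n' D \<Longrightarrow>
     peq \<delta> (m + m') (n + n') (PTens (PAdd a b) m' n' D) (PAdd (PTens a m' n' D) (PTens b m' n' D))"
| tens_smul: "pwt a m n \<Longrightarrow> is_diag m' n' D \<Longrightarrow>
     peq \<delta> (m + m') (n + n') (PTens (PSmul c a) m' n' D) (PSmul c (PTens a m' n' D))"
| tens_tens: "pwt a m n \<Longrightarrow> is_diag m' n' D \<Longrightarrow> is_diag m'' n'' D' \<Longrightarrow>
     peq \<delta> (m + m' + m'') (n + n' + n'')
        (PTens (PTens a m' n' D) m'' n'' D') (PTens a (m' + m'') (n' + n'') (dtens m' n' D D'))"
| tens_unit: "pwt a m n \<Longrightarrow> peq \<delta> m n (PTens a 0 0 {}) a"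
| interchange: "pwt a k n \<Longrightarrow> pwt b m k \<Longrightarrow> is_diag k' n' B \<Longrightarrow> is_diag m' k' A \<Longrightarrow>
     peq \<delta> (m + m') (n + n') (PComp (PTens a k' n' B) (PTens b m' k' A))
        (PSmul (\<delta> ^ dloops B A) (PTens (PComp a b) m' n' (dcomp B A)))"
| rel_I0: "is_diag k n B \<Longrightarrow> is_diag m k A \<Longrightarrow>
     peq \<delta> m n (PComp (PTens PI0 k n B) (PTens PI0 m k A))
        (PSmul (\<delta> ^ dloops B A) (PTens PI0 m n (dcomp B A)))"
| rel_H1: "is_diag k n B \<Longrightarrow> is_diag m k A \<Longrightarrow>
     peq \<delta> (1 + m) (1 + n) (PComp (PTens PH k n B) (PTens (pid 1) m k A))
        (PSmul (\<delta> ^ dloops B A) (PTens PH m n (dcomp B A)))"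
| rel_H2: "is_diag k n B \<Longrightarrow> is_diag m k A \<Longrightarrow>
     peq \<delta> (1 + m) (1 + n) (PComp (PTens (pid 1) k n B) (PTens PH m k A))
        (PSmul (\<delta> ^ dloops B A) (PTens PH m n (dcomp B A)))"
| rel_fourterm: "peq \<delta> 2 2 fourterm_lhs (PZero 2 2)"
| rel_skew: "peq \<delta> 1 1 skew_lhs (pneg PH)"

definition pcls :: "'k::comm_ring_1 \<Rightarrow> nat \<Rightarrow> 'k pexp \<Rightarrow> 'k pexp set" where
  "pcls \<delta> r a = {b. peq \<delta> r r a b}"

definition padd :: "'k::comm_ring_1 \<Rightarrow> nat \<Rightarrow> 'k pexp set \<Rightarrow> 'k pexp set \<Rightarrow> 'k pexp set" where
  "padd \<delta> r X Y = {c. \<exists>a\<in>X. \<exists>b\<in>Y. peq \<delta> r r (PAdd a b) c}"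
definition pmul :: "'k::comm_ring_1 \<Rightarrow> nat \<Rightarrow> 'k pexp set \<Rightarrow> 'k pexp set \<Rightarrow> 'k pexp set" where
  "pmul \<delta> r X Y = {c. \<exists>a\<in>X. \<exists>b\<in>Y. peq \<delta> r r (PComp a b) c}"
definition psm :: "'k::comm_ring_1 \<Rightarrow> nat \<Rightarrow> 'k \<Rightarrow> 'k pexp set \<Rightarrow> 'k pexp set" where
  "psm \<delta> r c X = {d. \<exists>a\<in>X. peq \<delta> r r (PSmul c a) d}"
definition pone :: "'k::comm_ring_1 \<Rightarrow> nat \<Rightarrow> 'k pexp set" where
  "pone \<delta> r = pcls \<delta> r (pid r)"

definition H0e :: "nat \<Rightarrow> nat \<Rightarrow> 'k pexp" where
  "H0e r i = PComp (PTens PI0 r r (siginvd r i))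
               (PComp (PTens PH (r - 1) (r - 1) (idd (r - 1))) (PTens PI0 r r (sigd r i)))"

definition Hmat :: "nat \<Rightarrow> nat \<Rightarrow> nat \<Rightarrow> 'k::comm_ring_1 pexp" where
  "Hmat r i j = (if i = 0 then H0e r j
                 else PAdd (PTens PI0 r r (transd r i j)) (pneg (PTens PI0 r r (ed r i j))))"

inductive_set ABgen :: "nat \<Rightarrow> 'k::comm_ring_1 pexp set" for r :: nat where
  gen_H0: "1 \<le> j \<Longrightarrow> j \<le> r \<Longrightarrow> H0e r j \<in> ABgen r"
| gen_s: "1 \<le> k \<Longrightarrow> k < r \<Longrightarrow> PTens PI0 r r (transd r k (k + 1)) \<in> ABgen r"
| gen_e: "1 \<le> k \<Longrightarrow> k < r \<Longrightarrow> PTens PI0 r r (ed r k (k + 1)) \<in> ABgen r"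
| gen_one: "pid r \<in> ABgen r"
| gen_zero: "PZero r r \<in> ABgen r"
| gen_add: "a \<in> ABgen r \<Longrightarrow> b \<in> ABgen r \<Longrightarrow> PAdd a b \<in> ABgen r"
| gen_smul: "a \<in> ABgen r \<Longrightarrow> PSmul c a \<in> ABgen r"
| gen_comp: "a \<in> ABgen r \<Longrightarrow> b \<in> ABgen r \<Longrightarrow> PComp a b \<in> ABgen r"

definition ABr :: "'k::comm_ring_1 \<Rightarrow> nat \<Rightarrow> 'k pexp set set" where
  "ABr \<delta> r = pcls \<delta> r ` ABgen r"

datatype 'k texp = TVar nat nat | TZero | TOne | TAdd "'k texp" "'k texp"
  | TSmul 'k "'k texp" | TMul "'k texp" "'k texp"

inductive twf :: "nat \<Rightarrow> 'k texp \<Rightarrow> bool" for n :: nat where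
  "1 \<le> i \<Longrightarrow> i < j \<Longrightarrow> j \<le> n \<Longrightarrow> twf n (TVar i j)"
| "twf n TZero"
| "twf n TOne"
| "twf n a \<Longrightarrow> twf n b \<Longrightarrow> twf n (TAdd a b)"
| "twf n a \<Longrightarrow> twf n (TSmul c a)"
| "twf n a \<Longrightarrow> twf n b \<Longrightarrow> twf n (TMul a b)"

definition tv :: "nat \<Rightarrow> nat \<Rightarrow> 'k texp" where "tv i j = TVar (min i j) (max i j)"

definition tcomm :: "'k::comm_ring_1 texp \<Rightarrow> 'k texp \<Rightarrow> 'k texp" where
  "tcomm a b = TAdd (TMul a b) (TSmul (-1) (TMul b a))"

inductive teq :: "nat \<Rightarrow> 'k::comm_ring_1 texp \<Rightarrow> 'k texp \<Rightarrow> bool" for n :: nat where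
  refl: "twf n a \<Longrightarrow> teq n a a"
| sym: "teq n a b \<Longrightarrow> teq n b a"
| trans: "teq n a b \<Longrightarrow> teq n b c \<Longrightarrow> teq n a c"
| add_cong: "teq n a a' \<Longrightarrow> teq n b b' \<Longrightarrow> teq n (TAdd a b) (TAdd a' b')"
| smul_cong: "teq n a a' \<Longrightarrow> teq n (TSmul c a) (TSmul c a')"
| mul_cong: "teq n a a' \<Longrightarrow> teq n b b' \<Longrightarrow> teq n (TMul a b) (TMul a' b')"
| add_assoc: "twf n a \<Longrightarrow> twf n b \<Longrightarrow> twf n c \<Longrightarrow> teq n (TAdd (TAdd a b) c) (TAdd a (TAdd b c))"
| add_comm: "twf n a \<Longrightarrow> twf n b \<Longrightarrow> teq n (TAdd a b) (TAdd b a)"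
| add_zero: "twf n a \<Longrightarrow> teq n (TAdd a TZero) a"
| add_neg: "twf n a \<Longrightarrow> teq n (TAdd a (TSmul (-1) a)) TZero"
| smul_add: "twf n a \<Longrightarrow> twf n b \<Longrightarrow> teq n (TSmul c (TAdd a b)) (TAdd (TSmul c a) (TSmul c b))"
| add_smul: "twf n a \<Longrightarrow> teq n (TSmul (c + d) a) (TAdd (TSmul c a) (TSmul d a))"
| smul_smul: "twf n a \<Longrightarrow> teq n (TSmul (c * d) a) (TSmul c (TSmul d a))"
| smul_one: "twf n a \<Longrightarrow> teq n (TSmul 1 a) a"
| mul_assoc: "twf n a \<Longrightarrow> twf n b \<Longrightarrow> twf n c \<Longrightarrow> teq n (TMul (TMul a b) c) (TMul a (TMul b c))"
| mul_one_left: "twf n a \<Longrightarrow> teq n (TMul TOne a) a"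
| mul_one_right: "twf n a \<Longrightarrow> teq n (TMul a TOne) a"
| mul_add_left: "twf n a \<Longrightarrow> twf n a' \<Longrightarrow> twf n b \<Longrightarrow> teq n (TMul (TAdd a a') b) (TAdd (TMul a b) (TMul a' b))"
| mul_add_right: "twf n a \<Longrightarrow> twf n b \<Longrightarrow> twf n b' \<Longrightarrow> teq n (TMul a (TAdd b b')) (TAdd (TMul a b) (TMul a b'))"
| mul_smul_left: "twf n a \<Longrightarrow> twf n b \<Longrightarrow> teq n (TMul (TSmul c a) b) (TSmul c (TMul a b))"
| mul_smul_right: "twf n a \<Longrightarrow> twf n b \<Longrightarrow> teq n (TMul a (TSmul c b)) (TSmul c (TMul a b))"
| rel1: "distinct [i, j, k, l] \<Longrightarrow> set [i, j, k, l] \<subseteq> {1..n} \<Longrightarrow>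
     teq n (tcomm (tv i j) (tv k l)) TZero"
| rel2: "distinct [i, k, l] \<Longrightarrow> set [i, k, l] \<subseteq> {1..n} \<Longrightarrow>
     teq n (tcomm (TAdd (tv i k) (tv i l)) (tv k l)) TZero"
| rel3: "distinct [i, j, k] \<Longrightarrow> set [i, j, k] \<subseteq> {1..n} \<Longrightarrow>
     teq n (tcomm (tv i j) (TAdd (tv i k) (tv j k))) TZero"

definition tcls :: "nat \<Rightarrow> 'k::comm_ring_1 texp \<Rightarrow> 'k texp set" where
  "tcls n a = {b. teq n a b}"
definition Tcar :: "nat \<Rightarrow> 'k::comm_ring_1 texp set set" where
  "Tcar n = tcls n ` {a. twf n a}"
definition tadd :: "nat \<Rightarrow> 'k::comm_ring_1 texp set \<Rightarrow> 'k texp set \<Rightarrow> 'k texp set" where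
  "tadd n X Y = {c. \<exists>a\<in>X. \<exists>b\<in>Y. teq n (TAdd a b) c}"
definition tmul :: "nat \<Rightarrow> 'k::comm_ring_1 texp set \<Rightarrow> 'k texp set \<Rightarrow> 'k texp set" where
  "tmul n X Y = {c. \<exists>a\<in>X. \<exists>b\<in>Y. teq n (TMul a b) c}"
definition tsm :: "nat \<Rightarrow> 'k::comm_ring_1 \<Rightarrow> 'k texp set \<Rightarrow> 'k texp set" where
  "tsm n c X = {d. \<exists>a\<in>X. teq n (TSmul c a) d}"
definition tone :: "nat \<Rightarrow> 'k::comm_ring_1 texp set" where
  "tone n = tcls n TOne"

definition chord_alg_hom :: "'k::comm_ring_1 \<Rightarrow> nat \<Rightarrow> ('k texp set \<Rightarrow> 'k pexp set) \<Rightarrow> bool" where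
  "chord_alg_hom \<delta> r \<Phi> \<longleftrightarrow>
     (\<forall>X\<in>Tcar (r + 1). \<Phi> X \<in> ABr \<delta> r)
   \<and> (\<forall>X\<in>Tcar (r + 1). \<forall>Y\<in>Tcar (r + 1). \<Phi> (tadd (r + 1) X Y) = padd \<delta> r (\<Phi> X) (\<Phi> Y))
   \<and> (\<forall>X\<in>Tcar (r + 1). \<forall>Y\<in>Tcar (r + 1). \<Phi> (tmul (r + 1) X Y) = pmul \<delta> r (\<Phi> X) (\<Phi> Y))
   \<and> (\<forall>c. \<forall>X\<in>Tcar (r + 1). \<Phi> (tsm (r + 1) c X) = psm \<delta> r c (\<Phi> X))
   \<and> \<Phi> (tone (r + 1)) = pone \<delta> r"

definition sends_generators :: "'k::comm_ring_1 \<Rightarrow> nat \<Rightarrow> ('k texp set \<Rightarrow> 'k pexp set) \<Rightarrow> bool" where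
  "sends_generators \<delta> r \<Phi> \<longleftrightarrow>
     (\<forall>i j. 1 \<le> i \<and> i < j \<and> j \<le> r + 1 \<longrightarrow>
        \<Phi> (tcls (r + 1) (TVar i j)) = pcls \<delta> r (Hmat r (i - 1) (j - 1)))"

end

theory Submission
  imports Defs "HOL-Combinatorics.Permutations"
begin

text \<open>
  Conjugation by permutation diagrams reduces the chord relations that involve the pole to
  strands 1 and 2, where [H_01, H_02 + H_12] = 0 is the four-term relation. For the relation
  [T, H_ij] = 0 with T = H_ki + H_kj (k = 0 allowed), note that T is invariant under (i j) and that
  T e_ij = 0 = e_ij T, by skew symmetry if k = 0 and by e_ki e_ij = (k j) e_ij otherwise; hence T
  commutes with H_ij = (i j) - e_ij. Surjectivity: H_ij^2 = 1 + (\<delta> - 2) e_ij, so e_ij and then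
  (i j) are in the image once \<delta> - 2 is invertible.

  Composites of diagrams are identified without tracing components: a component of the stacked
  graph contains at most two outer points, so a perfect matching all of whose pairs are joined in
  that graph must be the composite.
\<close>

section \<open>Stacking of Brauer diagrams\<close>

text \<open>Conjugation is available because the connector on strand i does not depend on which
  permutation carries strand 1 to i: a permutation fixing strand 1 commutes with \<open>PH\<close>
  tensored with identity strands. The obstacle is skew symmetry, which is imposed on a single
  strand, with a cup and a cap on the strand that carries the connector, whereas T e_ij = 0 concerns
  two strands joined by an arc. It has to be brought into the form X K cup = - K cup, with its
  mirror image for the cap, where K is the connector on the first of two strands. Both algebras are
  classes of formal expressions modulo a generated congruence, so the homomorphism is evaluation of
  expressions; the algebra rules of \<open>teq\<close> are matched by rules of \<open>peq\<close>,
  and only the three chord relations need work.\<close>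

lemma alternating_walk_end_unique:
  fixes A B :: "('v \<times> 'v) set"
  assumes sA: "sym A" and sB: "sym B" and vA: "single_valued A" and vB: "single_valued B"
    and x: "x \<notin> Domain B"
    and y: "(x, y) \<in> (A \<union> B)\<^sup>*" "y \<noteq> x" "y \<notin> Domain A \<or> y \<notin> Domain B"
    and z: "(x, z) \<in> (A \<union> B)\<^sup>*" "z \<noteq> x" "z \<notin> Domain A \<or> z \<notin> Domain B"
  shows "y = z"
proof -
  \<comment> \<open>The state \<open>(v, False)\<close> means that the next edge must come from A,
    \<open>(v, True)\<close> that it must come from B. As A and B are single-valued, the alternating
    walk is deterministic; from x it starts with A because x has no B-edge.\<close>
  define S where "S = {((v, False), (w, True)) | v w. (v, w) \<in> A} \<union>
    {((v, True), (w, False)) | v w. (v, w) \<in> B}"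
  have S: "single_valued S"
    using vA vB by (auto simp: S_def single_valued_def)
  \<comment> \<open>An arbitrary walk may turn back, but an edge of the same matching as the one
    just used leads, by symmetry and single-valuedness, to the previous vertex \<open>u\<close>,
    which is already reached.\<close>
  have reach: "\<exists>f. ((x, False), (v, f)) \<in> S\<^sup>*" if "(x, v) \<in> (A \<union> B)\<^sup>*" for v
    using that
  proof (induction rule: rtrancl_induct)
    case base
    show ?case by blast
  next
    case (step v w)
    then obtain f where f: "((x, False), (v, f)) \<in> S\<^sup>*" by blast
    have "(v, f) = (x, False) \<or> (\<exists>u g. ((x, False), (u, g)) \<in> S\<^sup>* \<and> ((u, g), (v, f)) \<in> S)"
      using f by (metis rtranclE surj_pair)
    then show ?case
    proof (elim disjE exE conjE)
      assume "(v, f) = (x, False)"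
      then have "((v, f), (w, True)) \<in> S" using step.hyps(2) x by (auto simp: S_def)
      then show ?thesis using f by (meson rtrancl.rtrancl_into_rtrancl)
    next
      fix u g assume u: "((x, False), (u, g)) \<in> S\<^sup>*" "((u, g), (v, f)) \<in> S"
      consider "((v, f), (w, \<not> f)) \<in> S" | "(v, w) \<in> A" f | "(v, w) \<in> B" "\<not> f"
        using step.hyps(2) by (cases f) (auto simp: S_def)
      then show ?thesis
      proof cases
        case 1
        then show ?thesis using f by (meson rtrancl.rtrancl_into_rtrancl)
      next
        case 2
        then have "(u, v) \<in> A" using u by (auto simp: S_def)
        then have "u = w" using 2 sA vA by (meson symD single_valuedD)
        then show ?thesis using u by blast
      next
        case 3
        then have "(u, v) \<in> B" using u by (auto simp: S_def)
        then have "u = w" using 3 sB vB by (meson symD single_valuedD)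
        then show ?thesis using u by blast
      qed
    qed
  qed
  \<comment> \<open>A state \<open>(v, f)\<close> other than the start is entered by an edge of A if
    \<open>f\<close> holds and of B otherwise, so v lies in that domain; being an end, it misses the
    other one, from which the next edge would come. Two dead ends of one deterministic walk
    coincide.\<close>
  have fin: "\<exists>f. ((x, False), (v, f)) \<in> S\<^sup>* \<and> (v, f) \<notin> Domain S"
    if v: "(x, v) \<in> (A \<union> B)\<^sup>*" "v \<noteq> x" "v \<notin> Domain A \<or> v \<notin> Domain B" for v
  proof -
    obtain f where f: "((x, False), (v, f)) \<in> S\<^sup>*" using reach v by blast
    then obtain s where "(s, (v, f)) \<in> S" using v(2) by (metis rtranclE Pair_inject)
    then have "if f then v \<in> Domain A else v \<in> Domain B"
      using sA sB by (cases f) (auto simp: S_def sym_def, blast+)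
    then have "(v, f) \<notin> Domain S"
      using v(3) by (auto simp: S_def split: if_splits)
    then show ?thesis using f by blast
  qed
  obtain f g where fg: "((x, False), (y, f)) \<in> S\<^sup>*" "(y, f) \<notin> Domain S"
    "((x, False), (z, g)) \<in> S\<^sup>*" "(z, g) \<notin> Domain S"
    using fin y z by metis
  then have "((y, f), (z, g)) \<in> S\<^sup>* \<or> ((z, g), (y, f)) \<in> S\<^sup>*"
    using single_valued_confluent[OF S] by blast
  then have "(y, f) = (z, g)"
    using fg by (metis DomainI converse_rtranclE)
  then show ?thesis by simp
qed

lemma is_diagI:
  assumes "\<And>x y. (x, y) \<in> D \<Longrightarrow> x \<in> pts m n" "sym D" "\<And>x. (x, x) \<notin> D"
    "\<And>x. x \<in> pts m n \<Longrightarrow> x \<in> Domain D" "single_valued D"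
  shows "is_diag m n D"
  unfolding is_diag_def
proof (intro conjI allI ballI)
  show "D \<subseteq> pts m n \<times> pts m n" using assms(1,2) by (meson SigmaI subrelI symD)
  show "\<exists>!y. (x, y) \<in> D" if "x \<in> pts m n" for x
    using assms(4)[OF that] single_valuedD[OF assms(5)] by blast
qed (use assms in auto)

lemma is_diagD:
  assumes "is_diag m n D"
  shows "sym D" "single_valued D" "Domain D = pts m n" "(x, x) \<notin> D"
    "(x, y) \<in> D \<Longrightarrow> x \<in> pts m n" "(x, y) \<in> D \<Longrightarrow> y \<in> pts m n"
    "(x, y) \<in> D \<Longrightarrow> (x, z) \<in> D \<Longrightarrow> y = z"
  using assms unfolding is_diag_def single_valued_def by blast+

lemma lowerL_inj: "lowerL x = lowerL y \<longleftrightarrow> x = y"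
  by (cases x; cases y) (auto simp: lowerL_def)

lemma upperL_inj: "upperL x = upperL y \<longleftrightarrow> x = y"
  by (cases x; cases y) (auto simp: upperL_def)

lemma outerL_inj: "outerL x = outerL y \<longleftrightarrow> x = y"
  by (cases x; cases y) (auto simp: outerL_def)

lemma sym_map_prod_image: "sym R \<Longrightarrow> sym (map_prod f f ` R)"
  unfolding sym_def by (clarsimp simp: image_iff) (metis map_prod_simp)

lemma single_valued_map_prod_image:
  "inj f \<Longrightarrow> single_valued R \<Longrightarrow> single_valued (map_prod f f ` R)"
  by (auto simp: single_valued_def inj_eq)

lemma sym_stack_graph: "sym A \<Longrightarrow> sym B \<Longrightarrow> sym (stack_graph B A)"
  unfolding stack_graph_def by (intro sym_Un sym_map_prod_image)

lemma stack_graph_Domain: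
  assumes "is_diag k n B" "is_diag m k A" "u \<in> Domain (stack_graph B A)"
  shows "u \<in> lowerL ` pts m k \<union> upperL ` pts k n"
  using assms(3) is_diagD(5)[OF assms(1)] is_diagD(5)[OF assms(2)]
  unfolding stack_graph_def by blast

lemma dcomp_unique:
  assumes B: "is_diag k n B" and A: "is_diag m k A"
    and y: "(x, y) \<in> dcomp B A" and z: "(x, z) \<in> dcomp B A"
  shows "y = z"
proof -
  let ?A = "map_prod lowerL lowerL ` A" and ?B = "map_prod upperL upperL ` B"
  have props: "sym ?A" "sym ?B" "single_valued ?A" "single_valued ?B"
    using is_diagD[OF A] is_diagD[OF B]
    by (auto intro!: sym_map_prod_image single_valued_map_prod_image simp: inj_def lowerL_inj upperL_inj)
  \<comment> \<open>Level 0 is met only by the image of A and level 2 only by that of B. So every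
    outer point is an end of its component, and \<open>alternating_walk_end_unique\<close> applies
    with the two layers in one order or the other.\<close>
  have dom: "outerL p \<notin> Domain ?A \<or> outerL p \<notin> Domain ?B" for p
    by (auto simp: outerL_def lowerL_def upperL_def split: if_splits)
  have reach: "(outerL x, outerL y) \<in> (?A \<union> ?B)\<^sup>*" "outerL y \<noteq> outerL x"
     "(outerL x, outerL z) \<in> (?A \<union> ?B)\<^sup>*" "outerL z \<noteq> outerL x"
    using y z by (auto simp: dcomp_def stack_graph_def outerL_inj)
  have "outerL y = outerL z"
  proof (cases "outerL x \<in> Domain ?B")
    case False
    show ?thesis
      using alternating_walk_end_unique[OF props False reach(1,2) dom reach(3,4) dom] .
  next
    case True
    then have "outerL x \<notin> Domain ?A" using dom[of x] by metis
    from alternating_walk_end_unique[OF props(2,1,4,3) this, of "outerL y" "outerL z"]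
    show ?thesis
      using reach dom[of y] dom[of z] by (simp add: Un_commute disj_commute)
  qed
  then show ?thesis by (simp add: outerL_inj)
qed

lemma dcomp_eqI:
  assumes B: "is_diag k n B" and A: "is_diag m k A" and D: "is_diag m n D"
    and path: "\<And>x y. (x, y) \<in> D \<Longrightarrow> (outerL x, outerL y) \<in> (stack_graph B A)\<^sup>*"
  shows "dcomp B A = D"
proof
  show sub: "D \<subseteq> dcomp B A"
    using path is_diagD(4)[OF D] by (auto simp: dcomp_def)
  show "dcomp B A \<subseteq> D"
  proof clarify
    fix b i b' j assume xy: "((b, i), (b', j)) \<in> dcomp B A"
    then have "(outerL (b, i), outerL (b', j)) \<in> (stack_graph B A)\<^sup>*" "outerL (b, i) \<noteq> outerL (b', j)"
      by (auto simp: dcomp_def outerL_inj)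
    then have "outerL (b, i) \<in> Domain (stack_graph B A)"
      by (metis DomainI converse_rtranclE)
    then have "(b, i) \<in> pts m n"
      using stack_graph_Domain[OF B A]
      by (fastforce simp: outerL_def lowerL_def upperL_def pts_def split: if_splits)
    then obtain z where z: "((b, i), z) \<in> D"
      using is_diagD(3)[OF D] by blast
    then show "((b, i), (b', j)) \<in> D"
      using dcomp_unique[OF B A xy] sub by blast
  qed
qed

text \<open>Absence of loops is part of the notion, so that the scalar
  \<open>\<delta> ^ dloops B A\<close> of \<open>rel_I0\<close>, \<open>rel_H1\<close>,
  \<open>rel_H2\<close> and \<open>interchange\<close> is 1.\<close>

definition stacks :: "nat \<Rightarrow> nat \<Rightarrow> nat \<Rightarrow> diag \<Rightarrow> diag \<Rightarrow> diag \<Rightarrow> bool" where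
  "stacks m k n B A C \<longleftrightarrow> is_diag k n B \<and> is_diag m k A \<and> is_diag m n C \<and>
     dcomp B A = C \<and> dloops B A = 0"

text \<open>A closed loop is a component inside level 1; \<open>exit\<close> rules it out by leading
  every middle point to another level.\<close>

lemma stacksI:
  assumes B: "is_diag k n B" and A: "is_diag m k A" and C: "is_diag m n C"
    and path: "\<And>x y. (x, y) \<in> C \<Longrightarrow> (outerL x, outerL y) \<in> (stack_graph B A)\<^sup>*"
    and exit: "\<And>i. i < k \<Longrightarrow> \<exists>v. ((1, i), v) \<in> (stack_graph B A)\<^sup>* \<and> fst v \<noteq> 1"
  shows "stacks m k n B A C"
proof -
  have empty: False if dom: "(l, i) \<in> Domain (stack_graph B A)"
      and all: "\<forall>w\<in>(stack_graph B A)\<^sup>* `` {(l, i)}. fst w = 1" for l i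
  proof -
    from all have "l = 1" by (metis Image_singleton_iff fst_conv rtrancl.rtrancl_refl)
    then have "i < k"
      using stack_graph_Domain[OF B A dom]
      by (auto simp: lowerL_def upperL_def pts_def split: if_splits)
    then show False
      using all exit \<open>l = 1\<close> by blast
  qed
  have "{(stack_graph B A)\<^sup>* `` {v} | v. v \<in> Domain (stack_graph B A)
        \<and> (\<forall>w \<in> (stack_graph B A)\<^sup>* `` {v}. fst w = 1)} = {}"
    (is "{_ | v. ?P v} = {}")
  proof -
    have "\<not> ?P v" for v using empty by (metis prod.collapse)
    then show ?thesis by blast
  qed
  then have "dloops B A = 0" by (simp only: dloops_def card.empty)
  then show ?thesis
    using assms dcomp_eqI[OF B A C path] by (simp add: stacks_def)
qed

lemma stack_lower: "(x, y) \<in> A \<Longrightarrow> (lowerL x, lowerL y) \<in> (stack_graph B A)\<^sup>*"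
  by (rule r_into_rtrancl) (force simp: stack_graph_def)

lemma stack_upper: "(x, y) \<in> B \<Longrightarrow> (upperL x, upperL y) \<in> (stack_graph B A)\<^sup>*"
  by (rule r_into_rtrancl) (force simp: stack_graph_def)

lemma symc_sym: "sym (symc S)"
  by (auto simp: symc_def sym_def)

lemma symc_iff: "(x, y) \<in> symc S \<longleftrightarrow> (x, y) \<in> S \<or> (y, x) \<in> S"
  by (auto simp: symc_def)

subsection \<open>Permutation diagrams and relabelling\<close>

lemma perm_diag_iff:
  "((b, i), (b', j)) \<in> perm_diag n p \<longleftrightarrow>
     \<not> b \<and> b' \<and> i < n \<and> j = p i \<or> b \<and> \<not> b' \<and> j < n \<and> i = p j"
  by (auto simp: perm_diag_def symc_iff)

lemma is_diag_perm:
  assumes "p permutes {..<n}"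
  shows "is_diag n n (perm_diag n p)"
proof (rule is_diagI)
  have lt: "p i < n \<longleftrightarrow> i < n" for i
    using permutes_in_image[OF assms] by auto
  have inj: "p i = p j \<longleftrightarrow> i = j" for i j
    using permutes_inj[OF assms] by (auto simp: inj_def)
  show "x \<in> pts n n" if "(x, y) \<in> perm_diag n p" for x y
    using that by (cases x; cases y) (auto simp: perm_diag_iff pts_def lt)
  show "sym (perm_diag n p)" by (simp add: perm_diag_def symc_sym)
  show "(x, x) \<notin> perm_diag n p" for x by (cases x) (auto simp: perm_diag_iff)
  show "x \<in> Domain (perm_diag n p)" if x: "x \<in> pts n n" for x
  proof (cases x)
    case (Pair b i)
    then have i: "i < n" using x by (auto simp: pts_def)
    have "((b, i), (\<not> b, if b then inv p i else p i)) \<in> perm_diag n p"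
      using i permutes_inverses[OF assms] lt[of "inv p i"] by (auto simp: perm_diag_iff)
    then show ?thesis using Pair by blast
  qed
  show "single_valued (perm_diag n p)"
    by (auto simp: single_valued_def perm_diag_iff inj)
qed

lemma is_diag_idd: "is_diag n n (idd n)"
  unfolding idd_def by (rule is_diag_perm[OF permutes_id])

definition relabel :: "(nat \<Rightarrow> nat) \<Rightarrow> (nat \<Rightarrow> nat) \<Rightarrow> pt \<Rightarrow> pt" where
  "relabel p q x = (fst x, if fst x then q (snd x) else p (snd x))"

text \<open>Composing with a permutation diagram only renames end points; writing such composites as
  \<open>rdiag\<close> turns identities between them into computations with indices.\<close>

definition rdiag :: "(nat \<Rightarrow> nat) \<Rightarrow> (nat \<Rightarrow> nat) \<Rightarrow> diag \<Rightarrow> diag" where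
  "rdiag p q D = map_prod (relabel p q) (relabel p q) ` D"

lemma is_diag_rdiag:
  assumes D: "is_diag m n D" and p: "p permutes {..<m}" and q: "q permutes {..<n}"
  shows "is_diag m n (rdiag p q D)"
proof (rule is_diagI)
  have mem: "relabel p q x \<in> pts m n \<longleftrightarrow> x \<in> pts m n" for x
    using permutes_in_image[OF p, of "snd x"] permutes_in_image[OF q, of "snd x"]
    by (cases x) (auto simp: relabel_def pts_def)
  have inj: "inj (relabel p q)"
    by (intro injI prod_eqI) (auto simp: relabel_def inj_eq[OF permutes_inj[OF p]]
        inj_eq[OF permutes_inj[OF q]] split: if_splits)
  show "x \<in> pts m n" if "(x, y) \<in> rdiag p q D" for x y
    using that is_diagD(5)[OF D] mem unfolding rdiag_def by force
  show "sym (rdiag p q D)" unfolding rdiag_def by (rule sym_map_prod_image[OF is_diagD(1)[OF D]])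
  show "single_valued (rdiag p q D)"
    unfolding rdiag_def by (rule single_valued_map_prod_image[OF inj is_diagD(2)[OF D]])
  show "(x, x) \<notin> rdiag p q D" for x
    using is_diagD(4)[OF D] injD[OF inj] by (fastforce simp: rdiag_def)
  show "x \<in> Domain (rdiag p q D)" if "x \<in> pts m n" for x
  proof -
    have "relabel p q (relabel (inv p) (inv q) x) = x"
      using permutes_inverses[OF p] permutes_inverses[OF q] by (cases x) (auto simp: relabel_def)
    then obtain y where y: "x = relabel p q y" by metis
    then have "y \<in> Domain D" using that is_diagD(3)[OF D] mem[of y] by simp
    then obtain z where "(y, z) \<in> D" by blast
    then show ?thesis using y by (force simp: rdiag_def)
  qed
qed

lemma stacks_perm_left:
  assumes D: "is_diag m n D" and p: "p permutes {..<n}"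
  shows "stacks m n n (perm_diag n p) D (rdiag id p D)"
proof (rule stacksI)
  let ?G = "(stack_graph (perm_diag n p) D)\<^sup>*"
  have s: "sym ?G"
    by (intro sym_rtrancl sym_stack_graph is_diagD(1)[OF D] is_diagD(1)[OF is_diag_perm[OF p]])
  have up: "((1, i), (2, p i)) \<in> ?G" if "i < n" for i
    using stack_upper[of "(False, i)" "(True, p i)" "perm_diag n p" D] that
    by (simp add: perm_diag_iff upperL_def)
  show "\<exists>v. ((1, i), v) \<in> ?G \<and> fst v \<noteq> 1" if "i < n" for i
    using up[OF that] by fastforce
  have out: "(lowerL x, outerL (relabel id p x)) \<in> ?G" if "x \<in> pts m n" for x
    using that up by (auto simp: pts_def lowerL_def outerL_def relabel_def)
  show "(outerL x', outerL y') \<in> ?G" if xy: "(x', y') \<in> rdiag id p D" for x' y'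
  proof -
    obtain x y where *: "(x, y) \<in> D" "x' = relabel id p x" "y' = relabel id p y"
      using xy by (auto simp: rdiag_def)
    have "(outerL x', lowerL x) \<in> ?G" using out * is_diagD(5)[OF D] s by (metis symD)
    also have "(lowerL x, lowerL y) \<in> ?G" using stack_lower * by blast
    also have "(lowerL y, outerL y') \<in> ?G" using out * is_diagD(6)[OF D] by metis
    finally (rtrancl_trans) show ?thesis .
  qed
qed (use assms is_diag_perm is_diag_rdiag permutes_id in auto)

text \<open>The inverse appears because \<open>perm_diag m p\<close> joins bottom \<open>a\<close>
  to top \<open>p a\<close>: a bottom point \<open>i\<close> of \<open>D\<close> is continued
  downwards to \<open>inv p i\<close>.\<close>

lemma stacks_perm_right:
  assumes D: "is_diag m n D" and p: "p permutes {..<m}"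
  shows "stacks m m n D (perm_diag m p) (rdiag (inv p) id D)"
proof (rule stacksI)
  let ?G = "(stack_graph D (perm_diag m p))\<^sup>*"
  have s: "sym ?G"
    by (intro sym_rtrancl sym_stack_graph is_diagD(1)[OF D] is_diagD(1)[OF is_diag_perm[OF p]])
  have down: "((1, i), (0, inv p i)) \<in> ?G" if "i < m" for i
    using stack_lower[of "(True, i)" "(False, inv p i)" "perm_diag m p" D] that
     permutes_in_image[OF permutes_inv[OF p], of i] permutes_inverses[OF p]
    by (simp add: perm_diag_iff lowerL_def)
  show "\<exists>v. ((1, i), v) \<in> ?G \<and> fst v \<noteq> 1" if "i < m" for i
    using down[OF that] by fastforce
  have out: "(upperL x, outerL (relabel (inv p) id x)) \<in> ?G" if "x \<in> pts m n" for x
    using that down by (auto simp: pts_def upperL_def outerL_def relabel_def)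
  show "(outerL x', outerL y') \<in> ?G" if xy: "(x', y') \<in> rdiag (inv p) id D" for x' y'
  proof -
    obtain x y where *: "(x, y) \<in> D" "x' = relabel (inv p) id x" "y' = relabel (inv p) id y"
      using xy by (auto simp: rdiag_def)
    have "(outerL x', upperL x) \<in> ?G" using out * is_diagD(5)[OF D] s by (metis symD)
    also have "(upperL x, upperL y) \<in> ?G" using stack_upper * by blast
    also have "(upperL y, outerL y') \<in> ?G" using out * is_diagD(6)[OF D] by metis
    finally (rtrancl_trans) show ?thesis .
  qed
qed (intro assms is_diag_perm is_diag_rdiag permutes_id permutes_inv)+

lemma rdiag_iff:
  assumes "p permutes {..<m}" "q permutes {..<n}"
  shows "(x, y) \<in> rdiag p q D \<longleftrightarrow> (relabel (inv p) (inv q) x, relabel (inv p) (inv q) y) \<in> D"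
proof -
  have 1: "relabel p q (relabel (inv p) (inv q) x) = x" for x
    using permutes_inverses[OF assms(1)] permutes_inverses[OF assms(2)]
    by (cases x) (auto simp: relabel_def)
  have 2: "relabel (inv p) (inv q) (relabel p q x) = x" for x
    using permutes_inverses[OF assms(1)] permutes_inverses[OF assms(2)]
    by (cases x) (auto simp: relabel_def)
  show ?thesis
  proof
    assume "(x, y) \<in> rdiag p q D"
    then show "(relabel (inv p) (inv q) x, relabel (inv p) (inv q) y) \<in> D"
      by (auto simp: rdiag_def 2)
  next
    assume "(relabel (inv p) (inv q) x, relabel (inv p) (inv q) y) \<in> D"
    then show "(x, y) \<in> rdiag p q D"
      unfolding rdiag_def by (rule image_eqI[rotated]) (simp add: 1)
  qed
qed

lemma rdiag_rdiag: "rdiag p q (rdiag p' q' D) = rdiag (p \<circ> p') (q \<circ> q') D"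
proof -
  have "relabel p q \<circ> relabel p' q' = relabel (p \<circ> p') (q \<circ> q')"
    by (auto simp: fun_eq_iff relabel_def)
  then show ?thesis by (simp add: rdiag_def image_comp map_prod.comp)
qed

lemma rdiag_perm_left:
  "p permutes {..<n} \<Longrightarrow> q permutes {..<n} \<Longrightarrow> rdiag id p (perm_diag n q) = perm_diag n (p \<circ> q)"
  by (auto simp: rdiag_iff[OF permutes_id] relabel_def perm_diag_iff permutes_inv_eq split: if_splits)

lemma rdiag_perm_right:
  assumes p: "p permutes {..<n}" and q: "q permutes {..<n}"
  shows "rdiag (inv p) id (perm_diag n q) = perm_diag n (q \<circ> p)"
proof -
  have "inv (inv p) = p" by (rule inv_inv_eq[OF permutes_bij[OF p]])
  moreover have "p x < n \<longleftrightarrow> x < n" for x using permutes_in_image[OF p] by auto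
  ultimately have "(x, y) \<in> rdiag (inv p) id (perm_diag n q) \<longleftrightarrow> (x, y) \<in> perm_diag n (q \<circ> p)" for x y
    by (cases x; cases y; cases "fst x"; cases "fst y")
      (simp_all add: rdiag_iff[OF permutes_inv[OF p] permutes_id] relabel_def perm_diag_iff)
  then show ?thesis by auto
qed

lemma stacks_perm_perm:
  "p permutes {..<n} \<Longrightarrow> q permutes {..<n} \<Longrightarrow>
    stacks n n n (perm_diag n p) (perm_diag n q) (perm_diag n (p \<circ> q))"
  using stacks_perm_left[OF is_diag_perm[of q n], of p] by (simp add: rdiag_perm_left)

lemma rdiag_id: "rdiag id id D = D"
  by (force simp: rdiag_def relabel_def)

lemma stacks_idd_left: "is_diag m n D \<Longrightarrow> stacks m n n (idd n) D D"
  unfolding idd_def using stacks_perm_left[OF _ permutes_id, of m n D] by (simp add: rdiag_id)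

lemma stacks_idd_right: "is_diag m n D \<Longrightarrow> stacks m m n D (idd m) D"
  unfolding idd_def using stacks_perm_right[OF _ permutes_id, of m n D] by (simp add: rdiag_id)

lemma swp_eq_transpose: "swp = transpose"
  by (auto simp: fun_eq_iff swp_def transpose_def)

lemma swp_permutes: "i < n \<Longrightarrow> j < n \<Longrightarrow> swp i j permutes {..<n}"
  by (simp add: swp_eq_transpose permutes_swap_id)

lemma inv_swp: "inv (swp i j) = swp i j"
  by (simp add: swp_eq_transpose)

lemma swp_swp: "swp i j (swp i j a) = a"
  by (simp add: swp_def)

lemma swp_comp_swp: "swp i j \<circ> swp i j = id"
  by (simp add: fun_eq_iff swp_swp)

lemma swp_commute: "swp i j = swp j i"
  by (auto simp: fun_eq_iff swp_def)

subsection \<open>The diagrams e_ij\<close>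

text \<open>\<open>ed\<close> numbers strands from 1 while points are numbered from 0; the
  successors make \<open>i\<close> and \<open>j\<close> the positions of the points.\<close>

abbreviation arc :: "nat \<Rightarrow> nat \<Rightarrow> nat \<Rightarrow> diag" where
  "arc n i j \<equiv> ed n (Suc i) (Suc j)"

lemma arc_iff:
  "((b, x), (b', y)) \<in> arc n i j \<longleftrightarrow>
     (b = b' \<and> (x = i \<and> y = j \<or> x = j \<and> y = i)) \<or>
     (b \<noteq> b' \<and> x = y \<and> x < n \<and> x \<noteq> i \<and> x \<noteq> j)"
  by (auto simp: ed_def symc_iff)

lemma arc_commute: "arc n i j = arc n j i"
  by (auto simp: arc_iff)

lemma is_diag_arc:
  assumes "i < n" "j < n" "i \<noteq> j"
  shows "is_diag n n (arc n i j)"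
proof (rule is_diagI)
  show "x \<in> pts n n" if "(x, y) \<in> arc n i j" for x y
    using that assms by (cases x; cases y) (auto simp: arc_iff pts_def)
  show "sym (arc n i j)" by (auto simp: ed_def symc_sym)
  show "(x, x) \<notin> arc n i j" for x using assms by (cases x) (auto simp: arc_iff)
  show "x \<in> Domain (arc n i j)" if x: "x \<in> pts n n" for x
  proof (cases x)
    case (Pair b a)
    then have "a < n" using x by (auto simp: pts_def)
    then have "(x, if a = i then (b, j) else if a = j then (b, i) else (\<not> b, a)) \<in> arc n i j"
      using Pair by (auto simp: arc_iff)
    then show ?thesis by blast
  qed
  show "single_valued (arc n i j)"
    using assms(3) by (auto simp: single_valued_def arc_iff)
qed

lemma rdiag_arc:
  assumes p: "p permutes {..<n}"
  shows "rdiag p p (arc n i j) = arc n (p i) (p j)"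
proof -
  have "inv p x < n \<longleftrightarrow> x < n" for x
    using permutes_in_image[OF permutes_inv[OF p], of x] by simp
  moreover have "inv p x = a \<longleftrightarrow> x = p a" for x a
    using permutes_inverses[OF p] by metis
  moreover have "inv p x = inv p a \<longleftrightarrow> x = a" for x a
    using permutes_inverses[OF p] by metis
  ultimately show ?thesis
    by (auto simp: rdiag_iff[OF p p] relabel_def arc_iff)
qed

text \<open>Both diagrams join bottoms j, k and tops i, j, run from bottom i to top k, and are
  vertical elsewhere; this is the product e_ij e_jk.\<close>

lemma rdiag_swp_arc:
  assumes "i < n" "j < n" "k < n" "distinct [i, j, k]"
  shows "rdiag (swp i k) id (arc n i j) = rdiag id (swp i k) (arc n j k)"
proof -
  have s: "swp i k permutes {..<n}" using assms by (simp add: swp_permutes)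
  show ?thesis
    using assms
    by (auto simp: rdiag_iff[OF s permutes_id] rdiag_iff[OF permutes_id s] relabel_def arc_iff
        inv_swp swp_def split: if_splits)
qed

lemma rdiag_swp_arc_same:
  assumes "i < n" "j < n" "i \<noteq> j"
  shows "rdiag (swp i j) id (arc n i j) = arc n i j" "rdiag id (swp i j) (arc n i j) = arc n i j"
proof -
  have s: "swp i j permutes {..<n}" using assms by (simp add: swp_permutes)
  show "rdiag (swp i j) id (arc n i j) = arc n i j" "rdiag id (swp i j) (arc n i j) = arc n i j"
    using assms
    by (auto simp: rdiag_iff[OF s permutes_id] rdiag_iff[OF permutes_id s] relabel_def arc_iff
        inv_swp swp_def split: if_splits)
qed

lemma stack_edges:
  "((False, a), (False, b)) \<in> A \<Longrightarrow> ((0, a), (0, b)) \<in> (stack_graph B A)\<^sup>*"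
  "((False, a), (True, b)) \<in> A \<Longrightarrow> ((0, a), (1, b)) \<in> (stack_graph B A)\<^sup>*"
  "((True, a), (False, b)) \<in> A \<Longrightarrow> ((1, a), (0, b)) \<in> (stack_graph B A)\<^sup>*"
  "((True, a), (True, b)) \<in> A \<Longrightarrow> ((1, a), (1, b)) \<in> (stack_graph B A)\<^sup>*"
  "((False, a), (False, b)) \<in> B \<Longrightarrow> ((1, a), (1, b)) \<in> (stack_graph B A)\<^sup>*"
  "((False, a), (True, b)) \<in> B \<Longrightarrow> ((1, a), (2, b)) \<in> (stack_graph B A)\<^sup>*"
  "((True, a), (False, b)) \<in> B \<Longrightarrow> ((2, a), (1, b)) \<in> (stack_graph B A)\<^sup>*"
  "((True, a), (True, b)) \<in> B \<Longrightarrow> ((2, a), (2, b)) \<in> (stack_graph B A)\<^sup>*"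
  by (drule stack_lower[of _ _ A B] stack_upper[of _ _ B A], simp add: lowerL_def upperL_def)+

lemma sym_reach:
  "is_diag k n B \<Longrightarrow> is_diag m k A \<Longrightarrow> (u, v) \<in> (stack_graph B A)\<^sup>* \<longleftrightarrow> (v, u) \<in> (stack_graph B A)\<^sup>*"
  by (meson is_diagD(1) symD sym_rtrancl sym_stack_graph)

lemma stacks_cases:
  assumes B: "is_diag k n B" and A: "is_diag m k A" and C: "is_diag m n C"
    and bot: "\<And>a b. ((False, a), (False, b)) \<in> C \<Longrightarrow> ((0, a), (0, b)) \<in> (stack_graph B A)\<^sup>*"
    and top: "\<And>a b. ((True, a), (True, b)) \<in> C \<Longrightarrow> ((2, a), (2, b)) \<in> (stack_graph B A)\<^sup>*"
    and thru: "\<And>a b. ((False, a), (True, b)) \<in> C \<Longrightarrow> ((0, a), (2, b)) \<in> (stack_graph B A)\<^sup>*"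
  shows "(x, y) \<in> C \<Longrightarrow> (outerL x, outerL y) \<in> (stack_graph B A)\<^sup>*"
  using bot top thru symD[OF is_diagD(1)[OF C]] sym_reach[OF B A]
  by (cases x; cases y) (auto simp: outerL_def)

lemma arc_paths:
  assumes "i < n" "j < n" "i \<noteq> j"
  shows "((1, i), (1, j)) \<in> (stack_graph (arc n i j) D)\<^sup>*"
    "((1, j), (1, i)) \<in> (stack_graph (arc n i j) D)\<^sup>*"
    "((2, i), (2, j)) \<in> (stack_graph (arc n i j) D)\<^sup>*"
    "((2, j), (2, i)) \<in> (stack_graph (arc n i j) D)\<^sup>*"
    "a < n \<Longrightarrow> a \<noteq> i \<Longrightarrow> a \<noteq> j \<Longrightarrow> ((1, a), (2, a)) \<in> (stack_graph (arc n i j) D)\<^sup>*"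
    "a < n \<Longrightarrow> a \<noteq> i \<Longrightarrow> a \<noteq> j \<Longrightarrow> ((2, a), (1, a)) \<in> (stack_graph (arc n i j) D)\<^sup>*"
  by (rule stack_edges(5-8), use assms in \<open>simp add: arc_iff\<close>)+

lemma arc_paths_lower:
  assumes "i < n" "j < n" "i \<noteq> j"
  shows "((1, i), (1, j)) \<in> (stack_graph D (arc n i j))\<^sup>*"
    "((1, j), (1, i)) \<in> (stack_graph D (arc n i j))\<^sup>*"
    "((0, i), (0, j)) \<in> (stack_graph D (arc n i j))\<^sup>*"
    "((0, j), (0, i)) \<in> (stack_graph D (arc n i j))\<^sup>*"
    "a < n \<Longrightarrow> a \<noteq> i \<Longrightarrow> a \<noteq> j \<Longrightarrow> ((1, a), (0, a)) \<in> (stack_graph D (arc n i j))\<^sup>*"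
    "a < n \<Longrightarrow> a \<noteq> i \<Longrightarrow> a \<noteq> j \<Longrightarrow> ((0, a), (1, a)) \<in> (stack_graph D (arc n i j))\<^sup>*"
  by (rule stack_edges(1-4), use assms in \<open>simp add: arc_iff\<close>)+

lemma stacks_arc_arc_adjacent:
  assumes l: "i < n" "j < n" "k < n" and d: "distinct [i, j, k]"
  shows "stacks n n n (arc n i j) (arc n j k) (rdiag (swp i k) id (arc n i j))"
proof (rule stacksI)
  let ?G = "(stack_graph (arc n i j) (arc n j k))\<^sup>*"
  have s: "swp i k permutes {..<n}" using l by (simp add: swp_permutes)
  show B: "is_diag n n (arc n i j)" "is_diag n n (arc n j k)"
    using l d by (auto intro: is_diag_arc)
  show C: "is_diag n n (rdiag (swp i k) id (arc n i j))"
    by (intro is_diag_rdiag B s permutes_id)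
  note C_iff = rdiag_iff[OF s permutes_id] relabel_def arc_iff inv_swp swp_def
  have ij: "i \<noteq> j" "j \<noteq> k" "i \<noteq> k" using d by auto
  note up = arc_paths[OF l(1,2) ij(1), where D = "arc n j k"]
  note lo = arc_paths_lower[OF l(2,3) ij(2), where D = "arc n i j"]
  show "(x, y) \<in> rdiag (swp i k) id (arc n i j) \<Longrightarrow> (outerL x, outerL y) \<in> ?G" for x y
  proof (rule stacks_cases[OF B C])
    fix a b
    show "((0, a), (0, b)) \<in> ?G" if "((False, a), (False, b)) \<in> rdiag (swp i k) id (arc n i j)"
      using that ij lo(3,4) by (auto simp: C_iff split: if_splits)
    show "((2, a), (2, b)) \<in> ?G" if "((True, a), (True, b)) \<in> rdiag (swp i k) id (arc n i j)"
      using that ij up(3,4) by (auto simp: C_iff split: if_splits)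
    assume ab: "((False, a), (True, b)) \<in> rdiag (swp i k) id (arc n i j)"
    show "((0, a), (2, b)) \<in> ?G"
    \<comment> \<open>The strand from bottom i zigzags through the middle level: across to j by the
      lower arc of the upper diagram, then to k by the upper arc of the lower one.\<close>
    proof (cases "a = i")
      case True
      then have "b = k" using ab ij by (auto simp: C_iff split: if_splits)
      have "((0, i), (1, i)) \<in> ?G" using lo(6)[of i] l ij by blast
      also note up(1)
      also note lo(1)
      also have "((1, k), (2, k)) \<in> ?G" using up(5)[of k] l ij by blast
      finally (rtrancl_trans) show ?thesis using True \<open>b = k\<close> by simp
    next
      case False
      then have "a < n" "a \<noteq> j" "a \<noteq> k" "b = a" using ab ij by (auto simp: C_iff split: if_splits)
      then show ?thesis using False lo(6)[of a] up(5)[of a] by (meson rtrancl_trans)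
    qed
  qed
  \<comment> \<open>Middle point j is the only one on two arcs; it leaves by way of i.\<close>
  have "((1, a), (2, a)) \<in> ?G \<or> ((1, a), (0, a)) \<in> ?G \<or> ((1, a), (0, i)) \<in> ?G" if "a < n" for a
    using that up(2) up(5)[of a] lo(5)[of a] lo(5)[of i] l ij by (metis rtrancl_trans)
  then show "\<exists>v. ((1, a), v) \<in> ?G \<and> fst v \<noteq> 1" if "a < n" for a
    using that by fastforce
qed

text \<open>The product e_ij e_kl for disjoint pairs. Described strand by strand it is symmetric in
  the two pairs, which is how the two factors are seen to commute.\<close>

definition two_arcs :: "nat \<Rightarrow> nat \<Rightarrow> nat \<Rightarrow> nat \<Rightarrow> nat \<Rightarrow> diag" where
  "two_arcs n i j k l = {(x, y). (if snd x \<in> {i, j} then (x, y) \<in> arc n i j else (x, y) \<in> arc n k l)}"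

lemma two_arcs_commute: "distinct [i, j, k, l] \<Longrightarrow> two_arcs n i j k l = two_arcs n k l i j"
  by (auto simp: two_arcs_def arc_iff)

lemma is_diag_two_arcs:
  assumes "i < n" "j < n" "k < n" "l < n" "distinct [i, j, k, l]"
  shows "is_diag n n (two_arcs n i j k l)"
proof -
  have ij: "is_diag n n (arc n i j)" "is_diag n n (arc n k l)" using assms by (auto intro: is_diag_arc)
  show ?thesis
  proof (rule is_diagI)
    show "x \<in> pts n n" if "(x, y) \<in> two_arcs n i j k l" for x y
      using that is_diagD(5)[OF ij(1)] is_diagD(5)[OF ij(2)] by (auto simp: two_arcs_def split: if_splits)
    show "sym (two_arcs n i j k l)"
      using assms(5) by (auto simp: sym_def two_arcs_def arc_iff split: if_splits)
    show "(x, x) \<notin> two_arcs n i j k l" for x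
      using is_diagD(4)[OF ij(1)] is_diagD(4)[OF ij(2)] by (auto simp: two_arcs_def)
    show "x \<in> Domain (two_arcs n i j k l)" if "x \<in> pts n n" for x
    proof -
      have "x \<in> Domain (arc n i j)" "x \<in> Domain (arc n k l)"
        using that is_diagD(3)[OF ij(1)] is_diagD(3)[OF ij(2)] by simp_all
      then obtain y z where "(x, y) \<in> arc n i j" "(x, z) \<in> arc n k l" by blast
      then have "(x, if snd x \<in> {i, j} then y else z) \<in> two_arcs n i j k l"
        by (auto simp: two_arcs_def)
      then show ?thesis by blast
    qed
    show "single_valued (two_arcs n i j k l)"
      using is_diagD(2)[OF ij(1)] is_diagD(2)[OF ij(2)]
      unfolding single_valued_def two_arcs_def by (simp split: if_splits)
  qed
qed

lemma stacks_arc_arc_disjoint: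
  assumes l: "i < n" "j < n" "k < n" "l < n" and d: "distinct [i, j, k, l]"
  shows "stacks n n n (arc n i j) (arc n k l) (two_arcs n i j k l)"
proof (rule stacksI)
  let ?G = "(stack_graph (arc n i j) (arc n k l))\<^sup>*"
  show B: "is_diag n n (arc n i j)" "is_diag n n (arc n k l)"
    using l d by (auto intro: is_diag_arc)
  show C: "is_diag n n (two_arcs n i j k l)"
    using l d by (rule is_diag_two_arcs)
  note C_iff = two_arcs_def arc_iff
  have ij: "i \<noteq> j" "k \<noteq> l" "i \<noteq> k" "i \<noteq> l" "j \<noteq> k" "j \<noteq> l" using d by auto
  note up = arc_paths[OF l(1,2) ij(1), where D = "arc n k l"]
  note lo = arc_paths_lower[OF l(3,4) ij(2), where D = "arc n i j"]
  \<comment> \<open>The lower diagram is vertical on strands i and j, so the bottom arc between them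
    is the arc of the upper diagram seen through it; the top arc between k and l arises in the same
    way from the lower diagram.\<close>
  have bot: "((0, i), (0, j)) \<in> ?G" "((0, j), (0, i)) \<in> ?G"
    using l ij
    by (auto intro: rtrancl_trans[OF lo(6) rtrancl_trans[OF up(1) lo(5)]]
        rtrancl_trans[OF lo(6) rtrancl_trans[OF up(2) lo(5)]])
  have top: "((2, k), (2, l)) \<in> ?G" "((2, l), (2, k)) \<in> ?G"
    using l ij
    by (auto intro: rtrancl_trans[OF up(6) rtrancl_trans[OF lo(1) up(5)]]
        rtrancl_trans[OF up(6) rtrancl_trans[OF lo(2) up(5)]])
  show "(x, y) \<in> two_arcs n i j k l \<Longrightarrow> (outerL x, outerL y) \<in> ?G" for x y
  proof (rule stacks_cases[OF B C])
    fix a b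
    show "((0, a), (0, b)) \<in> ?G" if "((False, a), (False, b)) \<in> two_arcs n i j k l"
      using that lo(3,4) bot by (auto simp: C_iff split: if_splits)
    show "((2, a), (2, b)) \<in> ?G" if "((True, a), (True, b)) \<in> two_arcs n i j k l"
      using that up(3,4) top by (auto simp: C_iff split: if_splits)
    assume "((False, a), (True, b)) \<in> two_arcs n i j k l"
    then have "a < n" "a \<noteq> i" "a \<noteq> j" "a \<noteq> k" "a \<noteq> l" "b = a" by (auto simp: C_iff split: if_splits)
    then show "((0, a), (2, b)) \<in> ?G"
      using lo(6)[of a] up(5)[of a] by (meson rtrancl_trans)
  qed
  have "((1, a), (2, a)) \<in> ?G \<or> ((1, a), (0, a)) \<in> ?G" if "a < n" for a
    using that up(5)[of a] lo(5)[of a] ij by metis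
  then show "\<exists>v. ((1, a), v) \<in> ?G \<and> fst v \<noteq> 1" if "a < n" for a
    using that by fastforce
qed

text \<open>The one composite with a closed loop, hence outside \<open>stacks\<close>: the facing
  arcs close up into a circle through the middle points i and j, while every other middle point
  reaches the top.\<close>

lemma arc_arc_same:
  assumes l: "i < n" "j < n" and d: "i \<noteq> j"
  shows "dcomp (arc n i j) (arc n i j) = arc n i j" "dloops (arc n i j) (arc n i j) = 1"
proof -
  let ?S = "stack_graph (arc n i j) (arc n i j)"
  let ?G = "?S\<^sup>*"
  note up = arc_paths[OF l d, where D = "arc n i j"]
  note lo = arc_paths_lower[OF l d, where D = "arc n i j"]
  have B: "is_diag n n (arc n i j)" using assms by (rule is_diag_arc)
  show "dcomp (arc n i j) (arc n i j) = arc n i j"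
  proof (rule dcomp_eqI[OF B B B], rule stacks_cases[OF B B B])
    fix a b
    show "((0, a), (0, b)) \<in> ?G" if "((False, a), (False, b)) \<in> arc n i j"
      using that lo(3,4) by (auto simp: arc_iff split: if_splits)
    show "((2, a), (2, b)) \<in> ?G" if "((True, a), (True, b)) \<in> arc n i j"
      using that up(3,4) by (auto simp: arc_iff split: if_splits)
    assume "((False, a), (True, b)) \<in> arc n i j"
    then have "a < n" "a \<noteq> i" "a \<noteq> j" "b = a" by (auto simp: arc_iff split: if_splits)
    then show "((0, a), (2, b)) \<in> ?G"
      using lo(6)[of a] up(5)[of a] by (meson rtrancl_trans)
  qed
  have closed: "v \<in> {(1, i), (1, j)}" if "(u, v) \<in> ?S" "u \<in> {(1, i), (1, j)}" for u v
    using that by (auto simp: stack_graph_def lowerL_def upperL_def arc_iff split: if_splits)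
  have sub: "?G `` {u} \<subseteq> {(1, i), (1, j)}" if "u \<in> {(1, i), (1, j)}" for u
  proof
    fix v assume "v \<in> ?G `` {u}"
    then have "(u, v) \<in> ?G" by simp
    then show "v \<in> {(1, i), (1, j)}"
      by (induction rule: rtrancl_induct) (use that closed in blast)+
  qed
  then have comp: "?G `` {u} = {(1, i), (1, j)}" if "u \<in> {(1, i), (1, j)}" for u
    using that up(1,2) by blast
  have "{?G `` {v} | v. v \<in> Domain ?S \<and> (\<forall>w\<in>?G `` {v}. fst w = 1)} = {{(1, i), (1, j)}}" (is "?L = _")
  proof
    have "((1, i), (1, j)) \<in> ?S"
      unfolding stack_graph_def
      by (rule UnI1, rule image_eqI[of _ _ "((True, i), (True, j))"]) (simp_all add: lowerL_def arc_iff)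
    then show "{{(1, i), (1, j)}} \<subseteq> ?L"
      using comp[of "(1, i)"] by (intro subsetI) (clarsimp, metis DomainI fst_conv insert_iff singletonD)
    show "?L \<subseteq> {{(1, i), (1, j)}}"
    proof
      fix X assume "X \<in> ?L"
      then obtain b a where ba: "(b, a) \<in> Domain ?S" "\<forall>w\<in>?G `` {(b, a)}. fst w = 1"
        and X: "X = ?G `` {(b, a)}" by auto
      then have b: "b = 1" by (metis Image_singleton_iff fst_conv rtrancl.rtrancl_refl)
      then have "a < n"
        using stack_graph_Domain[OF B B ba(1)]
        by (auto simp: lowerL_def upperL_def pts_def split: if_splits)
      have "a = i \<or> a = j"
      proof (rule ccontr)
        assume "\<not> (a = i \<or> a = j)"
        then have "(2, a) \<in> ?G `` {(b, a)}" using up(5)[of a] \<open>a < n\<close> b by simp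
        then have "fst (2 :: nat, a) = 1" using ba(2) by blast
        then show False by simp
      qed
      then have "X = {(1, i), (1, j)}" unfolding X b by (intro comp) auto
      then show "X \<in> {{(1, i), (1, j)}}" by simp
    qed
  qed
  then show "dloops (arc n i j) (arc n i j) = 1" by (simp add: dloops_def)
qed

subsection \<open>Juxtaposition and the small diagrams in the skew-symmetry relation\<close>

text \<open>The inequalities guard the truncated subtraction that undoes \<open>shift_pt\<close>;
  without them points of the first factor would be mistaken for points of the second.\<close>

lemma dtens_iff:
  "((b, x), (b', y)) \<in> dtens m n D D' \<longleftrightarrow> ((b, x), (b', y)) \<in> D \<or>
     ((if b then n else m) \<le> x \<and> (if b' then n else m) \<le> y \<and>
      ((b, x - (if b then n else m)), (b', y - (if b' then n else m))) \<in> D')"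
proof -
  have "((b, x), (b', y)) \<in> map_prod (shift_pt m n) (shift_pt m n) ` D'"
    if "(if b then n else m) \<le> x" "(if b' then n else m) \<le> y"
      "((b, x - (if b then n else m)), (b', y - (if b' then n else m))) \<in> D'"
    using that by (intro image_eqI[OF _ that(3)]) (auto simp: shift_pt_def)
  then show ?thesis
    unfolding dtens_def by (auto simp: shift_pt_def split: if_splits)
qed

lemma is_diag_dtens:
  assumes D: "is_diag m n D" and D': "is_diag m' n' D'"
  shows "is_diag (m + m') (n + n') (dtens m n D D')"
proof -
  let ?s = "shift_pt m n"
  have inj: "inj ?s" by (auto simp: inj_def shift_pt_def split: if_splits)
  have pts: "pts (m + m') (n + n') = pts m n \<union> ?s ` pts m' n'"
  proof
    show "pts (m + m') (n + n') \<subseteq> pts m n \<union> ?s ` pts m' n'"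
    proof
      fix x assume x: "x \<in> pts (m + m') (n + n')"
      have "x = ?s (fst x, snd x - (if fst x then n else m))" if "x \<notin> pts m n"
        using that x by (cases x) (auto simp: pts_def shift_pt_def)
      moreover have "(fst x, snd x - (if fst x then n else m)) \<in> pts m' n'" if "x \<notin> pts m n"
        using that x by (cases x) (auto simp: pts_def)
      ultimately show "x \<in> pts m n \<union> ?s ` pts m' n'" by blast
    qed
  qed (auto simp: pts_def shift_pt_def)
  have disj: "x \<notin> ?s ` UNIV" if "x \<in> pts m n" for x
    using that by (auto simp: pts_def shift_pt_def)
  let ?D = "map_prod ?s ?s ` D'"
  have sv: "single_valued ?D" by (rule single_valued_map_prod_image[OF inj is_diagD(2)[OF D']])
  have dom: "Domain ?D = ?s ` pts m' n'"
    unfolding is_diagD(3)[OF D', symmetric] by force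
  show ?thesis
    unfolding dtens_def
  proof (rule is_diagI)
    have Dom: "Domain (D \<union> ?D) = pts (m + m') (n + n')"
      by (simp only: pts dom is_diagD(3)[OF D] Domain_Un_eq)
    then show "x \<in> pts (m + m') (n + n')" if "(x, y) \<in> D \<union> ?D" for x y
      using that by (metis DomainI)
    show "sym (D \<union> ?D)"
      by (intro sym_Un is_diagD(1)[OF D] sym_map_prod_image is_diagD(1)[OF D'])
    show "(x, x) \<notin> D \<union> ?D" for x
    proof
      assume "(x, x) \<in> D \<union> ?D"
      then have "(x, x) \<in> ?D" using is_diagD(4)[OF D] by blast
      then obtain u v where "(u, v) \<in> D'" "?s u = ?s v" by auto
      then show False using is_diagD(4)[OF D'] injD[OF inj] by metis
    qed
    show "x \<in> Domain (D \<union> ?D)" if "x \<in> pts (m + m') (n + n')" for x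
      using that unfolding Dom .
    show "single_valued (D \<union> ?D)"
      unfolding single_valued_def
    proof (intro allI impI)
      fix x y z assume xy: "(x, y) \<in> D \<union> ?D" and xz: "(x, z) \<in> D \<union> ?D"
      show "y = z"
      proof (cases "x \<in> pts m n")
        case True
        then have "x \<notin> Domain ?D" using disj dom by blast
        then have "(x, y) \<in> D" "(x, z) \<in> D" using xy xz by blast+
        then show ?thesis by (rule is_diagD(7)[OF D])
      next
        case False
        then have "x \<notin> Domain D" using is_diagD(3)[OF D] by simp
        then have "(x, y) \<in> ?D" "(x, z) \<in> ?D" using xy xz by blast+
        then show ?thesis by (rule single_valuedD[OF sv])
      qed
    qed
  qed
qed

lemma is_diag_dtens_eq:
  "is_diag m n D \<Longrightarrow> is_diag m' n' D' \<Longrightarrow> M = m + m' \<Longrightarrow> N = n + n' \<Longrightarrow> is_diag M N (dtens m n D D')"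
  using is_diag_dtens by simp

lemma idd_iff: "((b, x), (b', y)) \<in> idd n \<longleftrightarrow> b \<noteq> b' \<and> x = y \<and> x < n"
  by (auto simp: idd_def perm_diag_iff)

lemma diag_eqI:
  fixes D D' :: diag
  shows "(\<And>b x b' y. ((b, x), (b', y)) \<in> D \<longleftrightarrow> ((b, x), (b', y)) \<in> D') \<Longrightarrow> D = D'"
  by auto

lemma dtens_idd_idd: "dtens m m (idd m) (idd n) = idd (m + n)"
  by (rule diag_eqI) (auto simp: dtens_iff idd_iff)

lemma dtens_idd_arc: "dtens (Suc 0) (Suc 0) (idd (Suc 0)) (arc n i j) = arc (Suc n) (Suc i) (Suc j)"
proof (rule diag_eqI)
  fix b x b' y
  show "((b, x), (b', y)) \<in> dtens (Suc 0) (Suc 0) (idd (Suc 0)) (arc n i j) \<longleftrightarrow>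
      ((b, x), (b', y)) \<in> arc (Suc n) (Suc i) (Suc j)"
    by (cases x; cases y; cases b; cases b') (simp_all add: dtens_iff idd_iff arc_iff)
qed

lemma dtens_arc_idd: "i < m \<Longrightarrow> j < m \<Longrightarrow> dtens m m (arc m i j) (idd n) = arc (m + n) i j"
  by (rule diag_eqI) (auto simp: dtens_iff idd_iff arc_iff)

lemma Xd_eq: "Xd = perm_diag 2 (swp 0 1)"
  by (rule diag_eqI) (auto simp: Xd_def perm_diag_iff swp_def)

text \<open>A permutation of the first m numbers is the identity from m on, so the added vertical
  strands need no separate description.\<close>

lemma dtens_perm_idd:
  assumes "p permutes {..<m}"
  shows "dtens m m (perm_diag m p) (idd n) = perm_diag (m + n) p"
proof (rule diag_eqI)
  fix b x b' y
  have lt: "p a < m \<longleftrightarrow> a < m" for a using permutes_in_image[OF assms] by auto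
  have fix_eq: "p a = a" if "\<not> a < m" for a using permutes_not_in[OF assms] that by auto
  have ge: "m \<le> a \<and> m \<le> c \<and> a - m = c - m \<and> a - m < n \<longleftrightarrow> a < m + n \<and> c = p a" if "\<not> a < m" for a c
    using that fix_eq[OF that] by auto
  show "((b, x), (b', y)) \<in> dtens m m (perm_diag m p) (idd n) \<longleftrightarrow>
      ((b, x), (b', y)) \<in> perm_diag (m + n) p"
  proof -
    consider "b = b'" | "\<not> b" b' | b "\<not> b'" by blast
    then show ?thesis
    proof cases
      case 2
      then show ?thesis using ge[of x y] by (simp add: dtens_iff idd_iff perm_diag_iff) linarith
    next
      case 3
      then show ?thesis using ge[of y x] by (simp add: dtens_iff idd_iff perm_diag_iff) linarith
    qed (auto simp: dtens_iff idd_iff perm_diag_iff)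
  qed
qed

text \<open>A permutation fixing strand 0 is an identity strand next to a permutation of the others,
  the form of diagram that the connector absorbs in \<open>ph_io\<close> and
  \<open>io_ph\<close>.\<close>

lemma perm_diag_fixing_0:
  assumes p: "p permutes {..<Suc n}" and 0: "p 0 = 0"
  obtains q where "q permutes {..<n}"
    "perm_diag (Suc n) p = dtens (Suc 0) (Suc 0) (idd (Suc 0)) (perm_diag n q)"
proof
  \<comment> \<open>The subtraction never truncates: \<open>p 0 = 0\<close> and injectivity make
    \<open>p (Suc a)\<close> positive.\<close>
  define q where "q a = p (Suc a) - 1" for a
  have pos: "p (Suc a) = Suc (q a)" for a
  proof -
    have "p (Suc a) \<noteq> p 0" using permutes_inj[OF p] by (metis injD nat.distinct(1))
    then show ?thesis using 0 by (simp add: q_def)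
  qed
  have inj: "inj q"
    using permutes_inj[OF p] pos by (metis injD injI nat.inject)
  have im: "q ` {..<n} \<subseteq> {..<n}"
    using permutes_in_image[OF p] pos by (metis Suc_less_eq image_subsetI lessThan_iff)
  have "bij_betw q {..<n} {..<n}"
    using im inj_on_subset[OF inj subset_UNIV] by (simp add: bij_betw_def endo_inj_surj)
  moreover have "q a = a" if "a \<notin> {..<n}" for a
    using permutes_not_in[OF p, of "Suc a"] that by (simp add: q_def)
  ultimately show "q permutes {..<n}" by (rule bij_imp_permutes)
  have p_eq: "p a = (case a of 0 \<Rightarrow> 0 | Suc c \<Rightarrow> Suc (q c))" for a
    using 0 pos by (cases a) auto
  show "perm_diag (Suc n) p = dtens (Suc 0) (Suc 0) (idd (Suc 0)) (perm_diag n q)"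
    by (rule diag_eqI) (auto simp: dtens_iff idd_iff perm_diag_iff p_eq split: nat.splits)
qed

lemma capd_iff: "((b, x), (b', y)) \<in> capd \<longleftrightarrow> \<not> b \<and> \<not> b' \<and> (x = 0 \<and> y = 1 \<or> x = 1 \<and> y = 0)"
  by (auto simp: capd_def symc_iff)

lemma cupd_iff: "((b, x), (b', y)) \<in> cupd \<longleftrightarrow> b \<and> b' \<and> (x = 0 \<and> y = 1 \<or> x = 1 \<and> y = 0)"
  by (auto simp: cupd_def symc_iff)

lemma is_diag_capd: "is_diag 2 0 capd"
  by (rule is_diagI) (auto simp: pts_def single_valued_def capd_def symc_sym symc_iff less_2_cases_iff
      Domain_iff)

lemma is_diag_cupd: "is_diag 0 2 cupd"
  by (rule is_diagI) (auto simp: pts_def single_valued_def cupd_def symc_sym symc_iff less_2_cases_iff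
      Domain_iff)

lemma stacks_cup_cap: "stacks 2 0 2 cupd capd (arc 2 0 1)"
proof (rule stacksI[OF is_diag_cupd is_diag_capd])
  show C: "is_diag 2 2 (arc 2 0 1)" by (rule is_diag_arc) auto
  show "(x, y) \<in> arc 2 0 1 \<Longrightarrow> (outerL x, outerL y) \<in> (stack_graph cupd capd)\<^sup>*" for x y
    by (rule stacks_cases[OF is_diag_cupd is_diag_capd C])
      (auto simp: arc_iff capd_iff cupd_iff intro: stack_edges)
qed auto

text \<open>In the skew-symmetry relation, juxtaposed with one strand and composed with a further cup (cap),
  the connector slides along zig (zag); contracting the outer cap (cup) then leaves a crossing.\<close>

abbreviation "cupII \<equiv> dtens 1 3 (dtens 0 2 cupd (idd 1)) (idd 1)"
abbreviation "capII \<equiv> dtens 3 1 (dtens 2 0 capd (idd 1)) (idd 1)"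
abbreviation "Icup \<equiv> dtens 1 1 (idd 1) cupd"
abbreviation "Icap \<equiv> dtens 1 1 (idd 1) capd"
abbreviation "cupcup \<equiv> dtens 0 2 cupd cupd"
abbreviation "capcap \<equiv> dtens 2 0 capd capd"

text \<open>\<open>zig\<close> is (X (x) I)(I (x) cup) and \<open>zag\<close> is (I (x) cap)(X (x)
  I): the crossing is that of \<open>skew_lhs\<close>, the cup or cap is the one that avoids the
  strand of the connector.\<close>

abbreviation "zig \<equiv> rdiag id (swp 0 1) Icup"
abbreviation "zag \<equiv> rdiag (swp 0 1) id Icap"

lemmas small_iff = dtens_iff idd_iff capd_iff cupd_iff

lemma is_diag_small:
  "is_diag 2 4 cupII" "is_diag 4 2 capII" "is_diag 1 3 Icup" "is_diag 3 1 Icap"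
  "is_diag 0 4 cupcup" "is_diag 4 0 capcap" "is_diag 1 3 zig" "is_diag 3 1 zag"
  "is_diag 2 4 (dtens 1 1 (idd 1) Icup)" "is_diag 4 2 (dtens 1 1 (idd 1) Icap)"
  "is_diag 2 4 (dtens 1 1 (idd 1) zig)" "is_diag 4 2 (dtens 1 1 (idd 1) zag)"
  "is_diag 1 3 (dtens 0 2 cupd (idd 1))" "is_diag 3 1 (dtens 2 0 capd (idd 1))"
  "is_diag 2 2 Xd"
proof -
  note i = is_diag_idd[of 1] is_diag_cupd is_diag_capd
  have s: "swp 0 1 permutes {..<3}" by (rule swp_permutes) auto
  note t = is_diag_dtens_eq
  show 1: "is_diag 1 3 Icup" "is_diag 3 1 Icap" "is_diag 0 4 cupcup" "is_diag 4 0 capcap"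
    "is_diag 1 3 (dtens 0 2 cupd (idd 1))" "is_diag 3 1 (dtens 2 0 capd (idd 1))"
    by (rule t[OF i(1,2)] t[OF i(1,3)] t[OF i(2,2)] t[OF i(3,3)] t[OF i(2,1)] t[OF i(3,1)]; simp)+
  show 2: "is_diag 1 3 zig" "is_diag 3 1 zag"
    by (rule is_diag_rdiag[OF 1(1) permutes_id s] is_diag_rdiag[OF 1(2) s permutes_id])+
  show "is_diag 2 4 cupII" "is_diag 4 2 capII"
    "is_diag 2 4 (dtens 1 1 (idd 1) Icup)" "is_diag 4 2 (dtens 1 1 (idd 1) Icap)"
    "is_diag 2 4 (dtens 1 1 (idd 1) zig)" "is_diag 4 2 (dtens 1 1 (idd 1) zag)"
    by (rule t[OF 1(5) i(1)] t[OF 1(6) i(1)] t[OF i(1) 1(1)] t[OF i(1) 1(2)] t[OF i(1) 2(1)]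
        t[OF i(1) 2(2)]; simp)+
  show "is_diag 2 2 Xd" unfolding Xd_eq by (rule is_diag_perm[OF swp_permutes]) auto
qed

lemma zig_iff: "((b, x), (b', y)) \<in> zig \<longleftrightarrow> ((b, if b then swp 0 1 x else x), (b', if b' then swp 0 1 y else y)) \<in> Icup"
  using rdiag_iff[OF permutes_id swp_permutes[of 0 3 1]] by (simp add: relabel_def inv_swp)

lemma zag_iff: "((b, x), (b', y)) \<in> zag \<longleftrightarrow> ((b, if b then x else swp 0 1 x), (b', if b' then y else swp 0 1 y)) \<in> Icap"
  using rdiag_iff[OF swp_permutes[of 0 3 1] permutes_id] by (simp add: relabel_def inv_swp)

lemma cupcup_iff: "((b, x), (b', y)) \<in> cupcup \<longleftrightarrow>
    b \<and> b' \<and> (x = 0 \<and> y = 1 \<or> x = 1 \<and> y = 0 \<or> x = 2 \<and> y = 3 \<or> x = 3 \<and> y = 2)"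
  by (auto simp: small_iff)

lemma capcap_iff: "((b, x), (b', y)) \<in> capcap \<longleftrightarrow>
    \<not> b \<and> \<not> b' \<and> (x = 0 \<and> y = 1 \<or> x = 1 \<and> y = 0 \<or> x = 2 \<and> y = 3 \<or> x = 3 \<and> y = 2)"
  by (auto simp: small_iff)

text \<open>Two cups side by side can be created in either order, as \<open>stacks_IIcup_cup\<close>
  completes. So the upper factor, whose cup ends on the strand of the connector, can be replaced by
  one that is vertical there.\<close>

lemma stacks_cupII_cup: "stacks 0 2 4 cupII cupd cupcup"
proof (rule stacksI)
  note d = is_diag_small(1) is_diag_cupd
  let ?G = "(stack_graph cupII cupd)\<^sup>*"
  show "is_diag 2 4 cupII" "is_diag 0 2 cupd" "is_diag 0 4 cupcup" by (rule d is_diag_small)+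
  have e: "((1, 0), (2, 2)) \<in> ?G" "((2, 2), (1, 0)) \<in> ?G" "((1, 1), (2, 3)) \<in> ?G" "((2, 3), (1, 1)) \<in> ?G"
    "((2, 0), (2, 1)) \<in> ?G" "((2, 1), (2, 0)) \<in> ?G" "((1, 0), (1, 1)) \<in> ?G" "((1, 1), (1, 0)) \<in> ?G"
    by (rule stack_edges; simp add: small_iff)+
  have "((2, 2), (2, 3)) \<in> ?G" "((2, 3), (2, 2)) \<in> ?G"
    by (rule rtrancl_trans[OF e(2) rtrancl_trans[OF e(7) e(3)]] rtrancl_trans[OF e(4) rtrancl_trans[OF e(8) e(1)]])+
  then show "(x, y) \<in> cupcup \<Longrightarrow> (outerL x, outerL y) \<in> ?G" for x y
    using e(5,6) by (cases x; cases y) (auto simp only: cupcup_iff capcap_iff outerL_def fst_conv snd_conv if_True if_False)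
  show "\<exists>v. ((1, i), v) \<in> ?G \<and> fst v \<noteq> 1" if "i < 2" for i
    using that e(1,3) by (fastforce simp: less_2_cases_iff)
qed

lemma stacks_IIcup_cup: "stacks 0 2 4 (dtens 1 1 (idd 1) Icup) cupd cupcup"
proof (rule stacksI)
  let ?G = "(stack_graph (dtens 1 1 (idd 1) Icup) cupd)\<^sup>*"
  show "is_diag 2 4 (dtens 1 1 (idd 1) Icup)" "is_diag 0 2 cupd" "is_diag 0 4 cupcup"
    by (rule is_diag_small is_diag_cupd)+
  have e: "((1, 0), (2, 0)) \<in> ?G" "((2, 0), (1, 0)) \<in> ?G" "((1, 1), (2, 1)) \<in> ?G" "((2, 1), (1, 1)) \<in> ?G"
    "((2, 2), (2, 3)) \<in> ?G" "((2, 3), (2, 2)) \<in> ?G" "((1, 0), (1, 1)) \<in> ?G" "((1, 1), (1, 0)) \<in> ?G"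
    by (rule stack_edges; simp add: small_iff)+
  have "((2, 0), (2, 1)) \<in> ?G" "((2, 1), (2, 0)) \<in> ?G"
    by (rule rtrancl_trans[OF e(2) rtrancl_trans[OF e(7) e(3)]] rtrancl_trans[OF e(4) rtrancl_trans[OF e(8) e(1)]])+
  then show "(x, y) \<in> cupcup \<Longrightarrow> (outerL x, outerL y) \<in> ?G" for x y
    using e(5,6) by (cases x; cases y) (auto simp only: cupcup_iff capcap_iff outerL_def fst_conv snd_conv if_True if_False)
  show "\<exists>v. ((1, i), v) \<in> ?G \<and> fst v \<noteq> 1" if "i < 2" for i
    using that e(1,3) by (fastforce simp: less_2_cases_iff)
qed

lemma stacks_cap_capII: "stacks 4 2 0 capd capII capcap"
proof (rule stacksI)
  let ?G = "(stack_graph capd capII)\<^sup>*"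
  show "is_diag 4 2 capII" "is_diag 2 0 capd" "is_diag 4 0 capcap" by (rule is_diag_small is_diag_capd)+
  have e: "((1, 0), (0, 2)) \<in> ?G" "((0, 2), (1, 0)) \<in> ?G" "((1, 1), (0, 3)) \<in> ?G" "((0, 3), (1, 1)) \<in> ?G"
    "((0, 0), (0, 1)) \<in> ?G" "((0, 1), (0, 0)) \<in> ?G" "((1, 0), (1, 1)) \<in> ?G" "((1, 1), (1, 0)) \<in> ?G"
    by (rule stack_edges; simp add: small_iff)+
  have "((0, 2), (0, 3)) \<in> ?G" "((0, 3), (0, 2)) \<in> ?G"
    by (rule rtrancl_trans[OF e(2) rtrancl_trans[OF e(7) e(3)]] rtrancl_trans[OF e(4) rtrancl_trans[OF e(8) e(1)]])+
  then show "(x, y) \<in> capcap \<Longrightarrow> (outerL x, outerL y) \<in> ?G" for x y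
    using e(5,6) by (cases x; cases y) (auto simp only: cupcup_iff capcap_iff outerL_def fst_conv snd_conv if_True if_False)
  show "\<exists>v. ((1, i), v) \<in> ?G \<and> fst v \<noteq> 1" if "i < 2" for i
    using that e(1,3) by (fastforce simp: less_2_cases_iff)
qed

lemma stacks_cap_IIcap: "stacks 4 2 0 capd (dtens 1 1 (idd 1) Icap) capcap"
proof (rule stacksI)
  let ?G = "(stack_graph capd (dtens 1 1 (idd 1) Icap))\<^sup>*"
  show "is_diag 4 2 (dtens 1 1 (idd 1) Icap)" "is_diag 2 0 capd" "is_diag 4 0 capcap"
    by (rule is_diag_small is_diag_capd)+
  have e: "((1, 0), (0, 0)) \<in> ?G" "((0, 0), (1, 0)) \<in> ?G" "((1, 1), (0, 1)) \<in> ?G" "((0, 1), (1, 1)) \<in> ?G"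
    "((0, 2), (0, 3)) \<in> ?G" "((0, 3), (0, 2)) \<in> ?G" "((1, 0), (1, 1)) \<in> ?G" "((1, 1), (1, 0)) \<in> ?G"
    by (rule stack_edges; simp add: small_iff)+
  have "((0, 0), (0, 1)) \<in> ?G" "((0, 1), (0, 0)) \<in> ?G"
    by (rule rtrancl_trans[OF e(2) rtrancl_trans[OF e(7) e(3)]] rtrancl_trans[OF e(4) rtrancl_trans[OF e(8) e(1)]])+
  then show "(x, y) \<in> capcap \<Longrightarrow> (outerL x, outerL y) \<in> ?G" for x y
    using e(5,6) by (cases x; cases y) (auto simp only: cupcup_iff capcap_iff outerL_def fst_conv snd_conv if_True if_False)
  show "\<exists>v. ((1, i), v) \<in> ?G \<and> fst v \<noteq> 1" if "i < 2" for i
    using that e(1,3) by (fastforce simp: less_2_cases_iff)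
qed

lemma less_4_cases: "(i::nat) < 4 \<longleftrightarrow> i = 0 \<or> i = 1 \<or> i = 2 \<or> i = 3"
  by auto

lemma Xd_iff: "((b, x), (b', y)) \<in> Xd \<longleftrightarrow> b \<noteq> b' \<and> (x = 0 \<and> y = 1 \<or> x = 1 \<and> y = 0)"
  by (auto simp: Xd_eq perm_diag_iff swp_def)

text \<open>This is where the crossing in the final form of skew symmetry comes from: bottom 0 runs
  over the middle points 0, 1, 3 to top 1, and bottom 1 over the middle point 2 to top 0.\<close>

lemma stacks_capII_zig: "stacks 2 4 2 capII (dtens 1 1 (idd 1) zig) Xd"
proof (rule stacksI)
  let ?G = "(stack_graph capII (dtens 1 1 (idd 1) zig))\<^sup>*"
  show d: "is_diag 4 2 capII" "is_diag 2 4 (dtens 1 1 (idd 1) zig)" "is_diag 2 2 Xd" by (rule is_diag_small)+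
  have e: "((0, 0), (1, 0)) \<in> ?G" "((1, 0), (1, 1)) \<in> ?G" "((1, 1), (1, 3)) \<in> ?G" "((1, 3), (2, 1)) \<in> ?G"
    "((0, 1), (1, 2)) \<in> ?G" "((1, 2), (2, 0)) \<in> ?G"
    by (rule stack_edges; simp add: small_iff zig_iff swp_def del: One_nat_def)+
  have p: "((1, 1), (2, 1)) \<in> ?G" "((1, 0), (2, 1)) \<in> ?G" "((0, 0), (2, 1)) \<in> ?G" "((0, 1), (2, 0)) \<in> ?G"
    by (rule e rtrancl_trans[OF e(1)] rtrancl_trans[OF e(2)] rtrancl_trans[OF e(3)] rtrancl_trans[OF e(5)])+
  show "(x, y) \<in> Xd \<Longrightarrow> (outerL x, outerL y) \<in> ?G" for x y
    by (rule stacks_cases[OF d]) (use p in \<open>auto simp: Xd_iff\<close>)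
  show "\<exists>v. ((1, i), v) \<in> ?G \<and> fst v \<noteq> 1" if "i < 4" for i
    using that e(4,6) p(1,2) by (fastforce simp: less_4_cases)
qed

lemma stacks_zag_cupII: "stacks 2 4 2 (dtens 1 1 (idd 1) zag) cupII Xd"
proof (rule stacksI)
  let ?G = "(stack_graph (dtens 1 1 (idd 1) zag) cupII)\<^sup>*"
  show d: "is_diag 4 2 (dtens 1 1 (idd 1) zag)" "is_diag 2 4 cupII" "is_diag 2 2 Xd" by (rule is_diag_small)+
  have e: "((0, 0), (1, 2)) \<in> ?G" "((1, 2), (2, 1)) \<in> ?G" "((0, 1), (1, 3)) \<in> ?G" "((1, 3), (1, 1)) \<in> ?G"
    "((1, 1), (1, 0)) \<in> ?G" "((1, 0), (2, 0)) \<in> ?G"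
    by (rule stack_edges; simp add: small_iff zag_iff swp_def del: One_nat_def)+
  have p: "((1, 1), (2, 0)) \<in> ?G" "((1, 3), (2, 0)) \<in> ?G" "((0, 1), (2, 0)) \<in> ?G" "((0, 0), (2, 1)) \<in> ?G"
    by (rule e rtrancl_trans[OF e(1)] rtrancl_trans[OF e(3)] rtrancl_trans[OF e(4)] rtrancl_trans[OF e(5)])+
  show "(x, y) \<in> Xd \<Longrightarrow> (outerL x, outerL y) \<in> ?G" for x y
    by (rule stacks_cases[OF d]) (use p in \<open>auto simp: Xd_iff\<close>)
  show "\<exists>v. ((1, i), v) \<in> ?G \<and> fst v \<noteq> 1" if "i < 4" for i
    using that e(2,6) p(1,2) by (fastforce simp: less_4_cases)
qed

section \<open>Calculating in the polar Brauer category\<close>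

declare peq.trans [trans]

abbreviation io :: "nat \<Rightarrow> nat \<Rightarrow> diag \<Rightarrow> 'k pexp" where
  "io m n D \<equiv> PTens PI0 m n D"

text \<open>The strand of the connector is not counted in \<open>m\<close> and \<open>n\<close>:
  \<open>ph m n D\<close> has m + 1 strands below and n + 1 above.\<close>

abbreviation ph :: "nat \<Rightarrow> nat \<Rightarrow> diag \<Rightarrow> 'k pexp" where
  "ph m n D \<equiv> PTens PH m n D"

lemma pwt_io: "is_diag m n D \<Longrightarrow> pwt (io m n D) m n"
  using pwt.intros(7)[OF pwt.intros(4), of m n D] by simp

lemma pwt_ph: "is_diag m n D \<Longrightarrow> pwt (ph m n D) (Suc m) (Suc n)"
  using pwt.intros(7)[OF pwt.intros(5), of m n D] by simp

lemma pwt_pid: "pwt (pid n) n n"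
  unfolding pid_def by (rule pwt_io[OF is_diag_idd])

lemma peq_zero_add: "pwt a m n \<Longrightarrow> peq \<delta> m n (PAdd (PZero m n) a) a"
  by (rule peq.trans[OF peq.add_comm peq.add_zero]) (intro pwt.intros(1) | assumption)+

lemma peq_neg_add:
  assumes "peq \<delta> m n a (PSmul (-1) b)" "pwt b m n"
  shows "peq \<delta> m n (PAdd a b) (PZero m n)"
proof -
  note w = assms(2) pwt.intros(3)
  have "peq \<delta> m n (PAdd a b) (PAdd (PSmul (-1) b) b)" by (intro peq.add_cong assms peq.refl)
  also have "peq \<delta> m n \<dots> (PAdd b (PSmul (-1) b))" by (intro peq.add_comm w)
  also have "peq \<delta> m n \<dots> (PZero m n)" by (intro peq.add_neg w)
  finally show ?thesis .
qed

text \<open>\<open>fourterm_lhs\<close> is a commutator set equal to zero; this turns it into an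
  equation between the two products.\<close>

lemma peq_sub_zeroD:
  assumes "peq \<delta> m n (PAdd a (PSmul (-1) b)) (PZero m n)" "pwt a m n" "pwt b m n"
  shows "peq \<delta> m n a b"
proof -
  note w = assms(2,3) pwt.intros(1-3)
  let ?nb = "PSmul (-1) b"
  have "peq \<delta> m n a (PAdd a (PZero m n))" by (intro peq.sym[OF peq.add_zero] w)
  also have "peq \<delta> m n \<dots> (PAdd a (PAdd ?nb b))"
    by (intro peq.add_cong peq.refl w peq.sym[OF peq_neg_add])
  also have "peq \<delta> m n \<dots> (PAdd (PAdd a ?nb) b)" by (intro peq.sym[OF peq.add_assoc] w)
  also have "peq \<delta> m n \<dots> (PAdd (PZero m n) b)" by (intro peq.add_cong assms(1) peq.refl w)
  also have "peq \<delta> m n \<dots> b" by (intro peq_zero_add w)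
  finally show ?thesis .
qed

lemma peq_sub_self:
  assumes "peq \<delta> m n a b" "pwt b m n"
  shows "peq \<delta> m n (PAdd a (PSmul (-1) b)) (PZero m n)"
  by (rule peq.trans[OF peq.add_cong[OF assms(1) peq.refl] peq.add_neg])
    (intro assms pwt.intros(3))+

lemma peq_smul_1: "x = 1 \<Longrightarrow> pwt a m n \<Longrightarrow> peq \<delta> m n b (PSmul x a) \<Longrightarrow> peq \<delta> m n b a"
  by (metis peq.trans peq.smul_one)

lemma stacksD:
  assumes "stacks m k n B A C"
  shows "is_diag k n B" "is_diag m k A" "is_diag m n C" "dcomp B A = C" "\<delta> ^ dloops B A = 1"
  using assms by (auto simp: stacks_def)

lemma io_comp:
  assumes "stacks m k n B A C"
  shows "peq \<delta> m n (PComp (io k n B) (io m k A)) (io m n C)"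
  by (rule peq_smul_1[OF stacksD(5)[OF assms] pwt_io[OF stacksD(3)[OF assms]]
        peq.rel_I0[OF stacksD(1,2)[OF assms], unfolded stacksD(4)[OF assms]]])

lemma tens_comp:
  assumes w: "pwt a k n" "pwt b m k" and s: "stacks m' k' n' B A C"
  shows "peq \<delta> (m + m') (n + n') (PComp (PTens a k' n' B) (PTens b m' k' A)) (PTens (PComp a b) m' n' C)"
  by (rule peq_smul_1[OF stacksD(5)[OF s] pwt.intros(7)[OF pwt.intros(6)[OF w] stacksD(3)[OF s]]
        peq.interchange[OF w stacksD(1,2)[OF s], unfolded stacksD(4)[OF s]]])

lemma io_tens:
  assumes "is_diag m n D" "is_diag m' n' D'"
  shows "peq \<delta> (m + m') (n + n') (PTens (io m n D) m' n' D') (io (m + m') (n + n') (dtens m n D D'))"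
  using peq.tens_tens[OF pwt.intros(4) assms, of \<delta>] by simp

lemma ph_tens:
  assumes "is_diag m n D" "is_diag m' n' D'"
  shows "peq \<delta> (Suc (m + m')) (Suc (n + n')) (PTens (ph m n D) m' n' D') (ph (m + m') (n + n') (dtens m n D D'))"
  using peq.tens_tens[OF pwt.intros(5) assms, of \<delta>] by simp

text \<open>\<open>rel_H1\<close> with its lower factor flattened from \<open>PTens (pid 1)\<close>
  to a single diagram: whatever is an identity strand followed by a diagram on the other strands is
  absorbed by the connector.\<close>

lemma ph_io:
  assumes s: "stacks m k n B A C"
  shows "peq \<delta> (Suc m) (Suc n) (PComp (ph k n B) (io (Suc m) (Suc k) (dtens (Suc 0) (Suc 0) (idd (Suc 0)) A)))
    (ph m n C)"
proof -
  note d = stacksD[OF s]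
  have t: "peq \<delta> (Suc m) (Suc k) (PTens (pid 1) m k A)
      (io (Suc m) (Suc k) (dtens (Suc 0) (Suc 0) (idd (Suc 0)) A))"
    using io_tens[OF is_diag_idd[of 1] d(2), of \<delta>] by (simp add: pid_def)
  have "peq \<delta> (Suc m) (Suc n) (PComp (ph k n B) (io (Suc m) (Suc k) (dtens (Suc 0) (Suc 0) (idd (Suc 0)) A)))
      (PComp (ph k n B) (PTens (pid 1) m k A))"
    by (rule peq.comp_cong peq.refl pwt_ph d(1,2) peq.sym[OF t])+
  also have "peq \<delta> (Suc m) (Suc n) \<dots> (ph m n C)"
    by (rule peq_smul_1[OF d(5) pwt_ph[OF d(3)] peq.rel_H1[OF d(1,2), unfolded d(4) plus_1_eq_Suc]])
  finally show ?thesis .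
qed

lemma io_ph:
  assumes s: "stacks m k n B A C"
  shows "peq \<delta> (Suc m) (Suc n) (PComp (io (Suc k) (Suc n) (dtens (Suc 0) (Suc 0) (idd (Suc 0)) B)) (ph m k A))
    (ph m n C)"
proof -
  note d = stacksD[OF s]
  have t: "peq \<delta> (Suc k) (Suc n) (PTens (pid 1) k n B)
      (io (Suc k) (Suc n) (dtens (Suc 0) (Suc 0) (idd (Suc 0)) B))"
    using io_tens[OF is_diag_idd[of 1] d(1), of \<delta>] by (simp add: pid_def)
  have "peq \<delta> (Suc m) (Suc n) (PComp (io (Suc k) (Suc n) (dtens (Suc 0) (Suc 0) (idd (Suc 0)) B)) (ph m k A))
      (PComp (PTens (pid 1) k n B) (ph m k A))"
    by (rule peq.comp_cong peq.refl pwt_ph d(1,2) peq.sym[OF t])+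
  also have "peq \<delta> (Suc m) (Suc n) \<dots> (ph m n C)"
    by (rule peq_smul_1[OF d(5) pwt_ph[OF d(3)] peq.rel_H2[OF d(1,2), unfolded d(4) plus_1_eq_Suc]])
  finally show ?thesis .
qed

subsection \<open>Skew symmetry absorbed into cups and caps\<close>

text \<open>The extra strand supplies the second end that the outer cup of \<open>skew_cup\<close>
  and the outer cap of \<open>skew_cap\<close> need.\<close>

lemma skew_two_strands:
  "peq \<delta> 2 2 (PComp (io 4 2 capII) (PComp (ph 3 3 (perm_diag 3 (swp 0 1))) (io 2 4 cupII)))
     (PSmul (-1) (ph 1 1 (idd 1)))" (is "peq _ _ _ ?S _")
proof -
  let ?A = "io 3 1 (dtens 2 0 capd (idd 1))" and ?B = "ph 2 2 Xd" and ?C = "io 1 3 (dtens 0 2 cupd (idd 1))"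
  note d = is_diag_small is_diag_idd[of 1]
  have wB: "pwt ?B 3 3" using pwt_ph[OF d(15)] by (simp add: numeral_3_eq_3 numeral_2_eq_2)
  note w = pwt_io[OF d(14)] pwt_io[OF d(13)] wB
  note ii = stacks_idd_left[OF d(16)]
  have A: "peq \<delta> 4 2 (PTens ?A 1 1 (idd 1)) (io 4 2 capII)"
    using io_tens[OF d(14,16), of \<delta>] by (simp add: numeral_eq_Suc)
  have C: "peq \<delta> 2 4 (PTens ?C 1 1 (idd 1)) (io 2 4 cupII)"
    using io_tens[OF d(13,16), of \<delta>] by (simp add: numeral_eq_Suc)
  have X: "dtens 2 2 Xd (idd 1) = perm_diag 3 (swp 0 1)"
    unfolding Xd_eq using dtens_perm_idd[OF swp_permutes[of 0 2 1], of 1] by simp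
  have B: "peq \<delta> 4 4 (PTens ?B 1 1 (idd 1)) (ph 3 3 (perm_diag 3 (swp 0 1)))"
    using ph_tens[OF d(15,16), of \<delta>] by (simp add: X[simplified])
  have "peq \<delta> 2 2 ?S (PComp (PTens ?A 1 1 (idd 1)) (PComp (PTens ?B 1 1 (idd 1)) (PTens ?C 1 1 (idd 1))))"
    by (rule peq.comp_cong peq.sym[OF A] peq.sym[OF B] peq.sym[OF C])+
  also have "peq \<delta> 2 2 \<dots> (PComp (PTens ?A 1 1 (idd 1)) (PTens (PComp ?B ?C) 1 1 (idd 1)))"
    using tens_comp[OF wB w(2) ii, of \<delta>] pwt.intros(7)[OF w(1) d(16)]
    by (intro peq.comp_cong[of _ 4] peq.refl) (simp_all add: numeral_eq_Suc)
  also have "peq \<delta> 2 2 \<dots> (PTens skew_lhs 1 1 (idd 1))"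
    using tens_comp[OF w(1) pwt.intros(6)[OF wB w(2)] ii, of \<delta>] by (simp add: skew_lhs_def numeral_eq_Suc)
  also have "peq \<delta> 2 2 \<dots> (PTens (pneg PH) 1 1 (idd 1))"
    using peq.tens_cong[OF peq.rel_skew d(16), of \<delta>] by (simp add: numeral_eq_Suc)
  also have "peq \<delta> 2 2 \<dots> (PSmul (-1) (ph 1 1 (idd 1)))"
    using peq.tens_smul[OF pwt.intros(5) d(16), of \<delta> "-1"] by (simp add: pneg_def numeral_eq_Suc)
  finally show ?thesis .
qed

lemma pwt_ph11: "pwt (ph 1 1 (idd 1)) 2 2"
  using pwt_ph[OF is_diag_idd[of 1]] by (simp add: numeral_2_eq_2)

lemma skew_cup:
  "peq \<delta> 0 2 (PSmul (-1) (PComp (ph 1 1 (idd 1)) (io 0 2 cupd)))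
     (PComp (io 2 2 Xd) (PComp (ph 1 1 (idd 1)) (io 0 2 cupd)))"
proof -
  let ?H = "ph 1 1 (idd 1)" and ?P = "ph 3 3 (perm_diag 3 (swp 0 1))" and ?c = "io 0 2 cupd"
  let ?V = "io 2 4 (dtens 1 1 (idd 1) Icup)" and ?Z = "io 2 4 (dtens 1 1 (idd 1) zig)"
  have s: "swp 0 1 permutes {..<3}" by (rule swp_permutes) auto
  have wP: "pwt ?P 4 4" using pwt_ph[OF is_diag_perm[OF s]] by (simp add: numeral_eq_Suc)
  note w = pwt.intros(3,6) pwt_io[OF is_diag_small(1)] pwt_io[OF is_diag_small(2)]
    pwt_io[OF is_diag_small(9)] pwt_io[OF is_diag_small(11)] pwt_io[OF is_diag_small(15)]
    pwt_io[OF is_diag_cupd] wP pwt_ph11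
  have cup: "peq \<delta> 0 4 (PComp (io 2 4 cupII) ?c) (PComp ?V ?c)"
    by (rule peq.trans[OF io_comp[OF stacks_cupII_cup] peq.sym[OF io_comp[OF stacks_IIcup_cup]]])
  \<comment> \<open>\<open>?V\<close> leaves the strand of the connector vertical, so the connector
    absorbs it from below and then releases the merged diagram above itself.\<close>
  have "peq \<delta> 2 4 (PComp ?P ?V) (ph 1 3 zig)"
    using ph_io[OF stacks_perm_left[OF is_diag_small(3) s], of \<delta>] by (simp add: numeral_eq_Suc)
  also have "peq \<delta> 2 4 \<dots> (PComp ?Z ?H)"
    using peq.sym[OF io_ph[OF stacks_idd_right[OF is_diag_small(7)], of \<delta>]] by (simp add: numeral_eq_Suc)
  finally have slide: "peq \<delta> 2 4 (PComp ?P ?V) (PComp ?Z ?H)" .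
  have "peq \<delta> 0 2 (PSmul (-1) (PComp ?H ?c)) (PComp (PSmul (-1) ?H) ?c)"
    by (rule peq.sym[OF peq.comp_smul_left] w)+
  also have "peq \<delta> 0 2 \<dots> (PComp (PComp (io 4 2 capII) (PComp ?P (io 2 4 cupII))) ?c)"
    by (rule peq.comp_cong peq.sym[OF skew_two_strands] peq.refl w)+
  also have "peq \<delta> 0 2 \<dots> (PComp (io 4 2 capII) (PComp (PComp ?P (io 2 4 cupII)) ?c))"
    by (rule peq.comp_assoc w)+
  also have "peq \<delta> 0 2 \<dots> (PComp (io 4 2 capII) (PComp ?P (PComp (io 2 4 cupII) ?c)))"
    by (rule peq.comp_cong peq.comp_assoc peq.refl w)+
  also have "peq \<delta> 0 2 \<dots> (PComp (io 4 2 capII) (PComp ?P (PComp ?V ?c)))"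
    by (rule peq.comp_cong cup peq.refl w)+
  also have "peq \<delta> 0 2 \<dots> (PComp (io 4 2 capII) (PComp (PComp ?P ?V) ?c))"
    by (rule peq.comp_cong peq.sym[OF peq.comp_assoc] peq.refl w)+
  also have "peq \<delta> 0 2 \<dots> (PComp (io 4 2 capII) (PComp (PComp ?Z ?H) ?c))"
    by (rule peq.comp_cong slide peq.refl w)+
  also have "peq \<delta> 0 2 \<dots> (PComp (io 4 2 capII) (PComp ?Z (PComp ?H ?c)))"
    by (rule peq.comp_cong peq.comp_assoc peq.refl w)+
  also have "peq \<delta> 0 2 \<dots> (PComp (PComp (io 4 2 capII) ?Z) (PComp ?H ?c))"
    by (rule peq.sym[OF peq.comp_assoc] w)+
  also have "peq \<delta> 0 2 \<dots> (PComp (io 2 2 Xd) (PComp ?H ?c))"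
    by (rule peq.comp_cong io_comp[OF stacks_capII_zig] peq.refl w)+
  finally show ?thesis .
qed

lemma skew_cap:
  "peq \<delta> 2 0 (PSmul (-1) (PComp (io 2 0 capd) (ph 1 1 (idd 1))))
     (PComp (PComp (io 2 0 capd) (ph 1 1 (idd 1))) (io 2 2 Xd))"
proof -
  let ?H = "ph 1 1 (idd 1)" and ?P = "ph 3 3 (perm_diag 3 (swp 0 1))" and ?c = "io 2 0 capd"
  let ?V = "io 4 2 (dtens 1 1 (idd 1) Icap)" and ?Z = "io 4 2 (dtens 1 1 (idd 1) zag)"
  have s: "swp 0 1 permutes {..<3}" by (rule swp_permutes) auto
  have wP: "pwt ?P 4 4" using pwt_ph[OF is_diag_perm[OF s]] by (simp add: numeral_eq_Suc)
  note w = pwt.intros(3,6) pwt_io[OF is_diag_small(1)] pwt_io[OF is_diag_small(2)]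
    pwt_io[OF is_diag_small(10)] pwt_io[OF is_diag_small(12)] pwt_io[OF is_diag_small(15)]
    pwt_io[OF is_diag_capd] wP pwt_ph11
  have cap: "peq \<delta> 4 0 (PComp ?c (io 4 2 capII)) (PComp ?c ?V)"
    by (rule peq.trans[OF io_comp[OF stacks_cap_capII] peq.sym[OF io_comp[OF stacks_cap_IIcap]]])
  have "peq \<delta> 4 2 (PComp ?V ?P) (ph 3 1 zag)"
    using io_ph[OF stacks_perm_right[OF is_diag_small(4) s], of \<delta>] by (simp add: numeral_eq_Suc inv_swp)
  also have "peq \<delta> 4 2 \<dots> (PComp ?H ?Z)"
    using peq.sym[OF ph_io[OF stacks_idd_left[OF is_diag_small(8)], of \<delta>]] by (simp add: numeral_eq_Suc)
  finally have slide: "peq \<delta> 4 2 (PComp ?V ?P) (PComp ?H ?Z)" .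
  have "peq \<delta> 2 0 (PSmul (-1) (PComp ?c ?H)) (PComp ?c (PSmul (-1) ?H))"
    by (rule peq.sym[OF peq.comp_smul_right] w)+
  also have "peq \<delta> 2 0 \<dots> (PComp ?c (PComp (io 4 2 capII) (PComp ?P (io 2 4 cupII))))"
    by (rule peq.comp_cong peq.sym[OF skew_two_strands] peq.refl w)+
  also have "peq \<delta> 2 0 \<dots> (PComp (PComp ?c (io 4 2 capII)) (PComp ?P (io 2 4 cupII)))"
    by (rule peq.sym[OF peq.comp_assoc] w)+
  also have "peq \<delta> 2 0 \<dots> (PComp (PComp ?c ?V) (PComp ?P (io 2 4 cupII)))"
    by (rule peq.comp_cong cap peq.refl w)+
  also have "peq \<delta> 2 0 \<dots> (PComp ?c (PComp ?V (PComp ?P (io 2 4 cupII))))"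
    by (rule peq.comp_assoc w)+
  also have "peq \<delta> 2 0 \<dots> (PComp ?c (PComp (PComp ?V ?P) (io 2 4 cupII)))"
    by (rule peq.comp_cong peq.sym[OF peq.comp_assoc] peq.refl w)+
  also have "peq \<delta> 2 0 \<dots> (PComp ?c (PComp (PComp ?H ?Z) (io 2 4 cupII)))"
    by (rule peq.comp_cong slide peq.refl w)+
  also have "peq \<delta> 2 0 \<dots> (PComp ?c (PComp ?H (PComp ?Z (io 2 4 cupII))))"
    by (rule peq.comp_cong peq.comp_assoc peq.refl w)+
  also have "peq \<delta> 2 0 \<dots> (PComp (PComp ?c ?H) (PComp ?Z (io 2 4 cupII)))"
    by (rule peq.sym[OF peq.comp_assoc] w)+
  also have "peq \<delta> 2 0 \<dots> (PComp (PComp ?c ?H) (io 2 2 Xd))"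
    by (rule peq.comp_cong io_comp[OF stacks_zag_cupII] peq.refl w)+
  finally show ?thesis .
qed

section \<open>Endomorphisms of r strands\<close>

definition commutes :: "'k::comm_ring_1 \<Rightarrow> nat \<Rightarrow> 'k pexp \<Rightarrow> 'k pexp \<Rightarrow> bool" where
  "commutes \<delta> r a b \<longleftrightarrow> peq \<delta> r r (PComp a b) (PComp b a)"

lemma commutes_sym: "commutes \<delta> r a b \<Longrightarrow> commutes \<delta> r b a"
  unfolding commutes_def by (rule peq.sym)

lemma commutes_cong:
  "commutes \<delta> r a b \<Longrightarrow> peq \<delta> r r a' a \<Longrightarrow> peq \<delta> r r b' b \<Longrightarrow> commutes \<delta> r a' b'"
  unfolding commutes_def by (meson peq.comp_cong peq.sym peq.trans)

lemma commutes_add: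
  assumes w: "pwt a r r" "pwt b r r" "pwt c r r" and c: "commutes \<delta> r a b" "commutes \<delta> r a c"
  shows "commutes \<delta> r a (PAdd b c)"
proof -
  have "peq \<delta> r r (PComp a (PAdd b c)) (PAdd (PComp a b) (PComp a c))"
    by (rule peq.comp_add_right w)+
  also have "peq \<delta> r r \<dots> (PAdd (PComp b a) (PComp c a))"
    using c unfolding commutes_def by (rule peq.add_cong)
  also have "peq \<delta> r r \<dots> (PComp (PAdd b c) a)"
    by (rule peq.sym[OF peq.comp_add_left] w)+
  finally show ?thesis unfolding commutes_def .
qed

lemma commutes_smul:
  assumes w: "pwt a r r" "pwt b r r" and c: "commutes \<delta> r a b"
  shows "commutes \<delta> r a (PSmul x b)"
proof -
  have "peq \<delta> r r (PComp a (PSmul x b)) (PSmul x (PComp a b))"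
    by (rule peq.comp_smul_right w)+
  also have "peq \<delta> r r \<dots> (PSmul x (PComp b a))"
    using c unfolding commutes_def by (rule peq.smul_cong)
  also have "peq \<delta> r r \<dots> (PComp (PSmul x b) a)"
    by (rule peq.sym[OF peq.comp_smul_left] w)+
  finally show ?thesis unfolding commutes_def .
qed

section \<open>Conjugation by permutation diagrams\<close>

abbreviation ip :: "nat \<Rightarrow> (nat \<Rightarrow> nat) \<Rightarrow> 'k pexp" where
  "ip r p \<equiv> io r r (perm_diag r p)"

definition pconj :: "nat \<Rightarrow> (nat \<Rightarrow> nat) \<Rightarrow> 'k pexp \<Rightarrow> 'k pexp" where
  "pconj r p a = PComp (ip r p) (PComp a (ip r (inv p)))"

lemma pwt_ip: "p permutes {..<r} \<Longrightarrow> pwt (ip r p) r r"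
  by (rule pwt_io[OF is_diag_perm])

lemma pwt_pconj: "p permutes {..<r} \<Longrightarrow> pwt a r r \<Longrightarrow> pwt (pconj r p a) r r"
  unfolding pconj_def by (intro pwt.intros(6)[of _ r] pwt_ip permutes_inv)

lemma ip_comp:
  "p permutes {..<r} \<Longrightarrow> q permutes {..<r} \<Longrightarrow> peq \<delta> r r (PComp (ip r p) (ip r q)) (ip r (p \<circ> q))"
  by (rule io_comp[OF stacks_perm_perm])

lemma ip_id: "ip r id = pid r"
  by (simp add: pid_def idd_def)

lemma ip_cancel:
  assumes p: "p permutes {..<r}" and b: "pwt b m r"
  shows "peq \<delta> m r (PComp (ip r (inv p)) (PComp (ip r p) b)) b"
    "peq \<delta> m r (PComp (ip r p) (PComp (ip r (inv p)) b)) b"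
proof -
  note pi = permutes_inv[OF p]
  have "peq \<delta> m r (PComp (ip r (inv p)) (PComp (ip r p) b)) (PComp (PComp (ip r (inv p)) (ip r p)) b)"
    by (rule peq.sym[OF peq.comp_assoc] pwt_ip p pi b)+
  also have "peq \<delta> m r \<dots> (PComp (pid r) b)"
    using ip_comp[OF pi p, of \<delta>] by (intro peq.comp_cong[OF _ peq.refl[OF b]]) (simp add: permutes_inv_o[OF p] ip_id)
  also have "peq \<delta> m r \<dots> b" by (rule peq.comp_id_left[OF b])
  finally show "peq \<delta> m r (PComp (ip r (inv p)) (PComp (ip r p) b)) b" .
  have "peq \<delta> m r (PComp (ip r p) (PComp (ip r (inv p)) b)) (PComp (PComp (ip r p) (ip r (inv p))) b)"
    by (rule peq.sym[OF peq.comp_assoc] pwt_ip p pi b)+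
  also have "peq \<delta> m r \<dots> (PComp (pid r) b)"
    using ip_comp[OF p pi, of \<delta>] by (intro peq.comp_cong[OF _ peq.refl[OF b]]) (simp add: permutes_inv_o[OF p] ip_id)
  also have "peq \<delta> m r \<dots> b" by (rule peq.comp_id_left[OF b])
  finally show "peq \<delta> m r (PComp (ip r p) (PComp (ip r (inv p)) b)) b" .
qed

lemma pconj_cong: "p permutes {..<r} \<Longrightarrow> peq \<delta> r r a b \<Longrightarrow> peq \<delta> r r (pconj r p a) (pconj r p b)"
  unfolding pconj_def by (intro peq.comp_cong[of _ r] peq.refl pwt_ip permutes_inv)

lemma pconj_comp:
  assumes p: "p permutes {..<r}" and a: "pwt a r r" and b: "pwt b r r"
  shows "peq \<delta> r r (PComp (pconj r p a) (pconj r p b)) (pconj r p (PComp a b))"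
proof -
  let ?p = "ip r p" and ?q = "ip r (inv p)"
  note w = pwt.intros(6) pwt_ip[OF p] pwt_ip[OF permutes_inv[OF p]] a b
  have "peq \<delta> r r (PComp (pconj r p a) (pconj r p b)) (PComp ?p (PComp (PComp a ?q) (pconj r p b)))"
    unfolding pconj_def by (rule peq.comp_assoc w)+
  also have "peq \<delta> r r \<dots> (PComp ?p (PComp a (PComp ?q (pconj r p b))))"
    unfolding pconj_def by (rule peq.comp_cong[OF peq.refl peq.comp_assoc] w)+
  also have "peq \<delta> r r \<dots> (PComp ?p (PComp a (PComp b ?q)))"
    unfolding pconj_def by (rule peq.comp_cong[OF peq.refl peq.comp_cong[OF peq.refl ip_cancel(1)]] w p)+
  also have "peq \<delta> r r \<dots> (pconj r p (PComp a b))"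
    unfolding pconj_def by (rule peq.comp_cong[OF peq.refl peq.sym[OF peq.comp_assoc]] w)+
  finally show ?thesis .
qed

lemma pconj_add:
  assumes p: "p permutes {..<r}" and a: "pwt a r r" and b: "pwt b r r"
  shows "peq \<delta> r r (pconj r p (PAdd a b)) (PAdd (pconj r p a) (pconj r p b))"
proof -
  note w = pwt.intros(6) pwt_ip[OF p] pwt_ip[OF permutes_inv[OF p]] a b
  show ?thesis
    unfolding pconj_def
    by (rule peq.trans[OF peq.comp_cong[OF peq.refl peq.comp_add_left] peq.comp_add_right] w)+
qed

lemma pconj_smul:
  assumes p: "p permutes {..<r}" and a: "pwt a r r"
  shows "peq \<delta> r r (pconj r p (PSmul c a)) (PSmul c (pconj r p a))"
proof -
  note w = pwt.intros(6) pwt_ip[OF p] pwt_ip[OF permutes_inv[OF p]] a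
  show ?thesis
    unfolding pconj_def
    by (rule peq.trans[OF peq.comp_cong[OF peq.refl peq.comp_smul_left] peq.comp_smul_right] w)+
qed

lemma pconj_commutes:
  assumes p: "p permutes {..<r}" and a: "pwt a r r" and b: "pwt b r r" and c: "commutes \<delta> r a b"
  shows "commutes \<delta> r (pconj r p a) (pconj r p b)"
proof -
  have "peq \<delta> r r (PComp (pconj r p a) (pconj r p b)) (pconj r p (PComp a b))" by (rule pconj_comp[OF p a b])
  also have "peq \<delta> r r \<dots> (pconj r p (PComp b a))"
    using c unfolding commutes_def by (rule pconj_cong[OF p])
  also have "peq \<delta> r r \<dots> (PComp (pconj r p b) (pconj r p a))" by (rule peq.sym[OF pconj_comp[OF p b a]])
  finally show ?thesis unfolding commutes_def .
qed

lemma pconj_pconj: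
  assumes p: "p permutes {..<r}" and q: "q permutes {..<r}" and a: "pwt a r r"
  shows "peq \<delta> r r (pconj r p (pconj r q a)) (pconj r (p \<circ> q) a)"
proof -
  let ?p = "ip r p" and ?p' = "ip r (inv p)" and ?q = "ip r q" and ?q' = "ip r (inv q)"
  note i = permutes_inv[OF p] permutes_inv[OF q]
  note w = pwt.intros(6) pwt_ip[OF p] pwt_ip[OF q] pwt_ip[OF i(1)] pwt_ip[OF i(2)] a
  have "peq \<delta> r r (pconj r p (pconj r q a)) (PComp ?p (PComp ?q (PComp (PComp a ?q') ?p')))"
    unfolding pconj_def by (rule peq.comp_cong[OF peq.refl peq.comp_assoc] w)+
  also have "peq \<delta> r r \<dots> (PComp (PComp ?p ?q) (PComp (PComp a ?q') ?p'))"
    by (rule peq.sym[OF peq.comp_assoc] w)+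
  also have "peq \<delta> r r \<dots> (PComp (PComp ?p ?q) (PComp a (PComp ?q' ?p')))"
    by (rule peq.comp_cong[OF peq.refl peq.comp_assoc] w)+
  also have "peq \<delta> r r \<dots> (PComp (ip r (p \<circ> q)) (PComp a (ip r (inv q \<circ> inv p))))"
    by (rule peq.comp_cong[OF ip_comp peq.comp_cong[OF peq.refl ip_comp]] p q i a)+
  finally show ?thesis
    unfolding pconj_def o_inv_distrib[OF permutes_bij[OF p] permutes_bij[OF q]] .
qed

lemma pconj_io:
  assumes p: "p permutes {..<r}" and D: "is_diag r r D"
  shows "peq \<delta> r r (pconj r p (io r r D)) (io r r (rdiag p p D))"
proof -
  have i: "inv (inv p) = p" by (rule inv_inv_eq[OF permutes_bij[OF p]])
  note s1 = stacks_perm_right[OF D permutes_inv[OF p], unfolded i]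
  have "peq \<delta> r r (pconj r p (io r r D)) (PComp (ip r p) (io r r (rdiag p id D)))"
    unfolding pconj_def
    by (rule peq.comp_cong[OF peq.refl[OF pwt_ip[OF p]] io_comp[OF s1]])
  also have "peq \<delta> r r \<dots> (io r r (rdiag id p (rdiag p id D)))"
    by (rule io_comp[OF stacks_perm_left[OF stacksD(3)[OF s1] p]])
  finally show ?thesis by (simp add: rdiag_rdiag)
qed

lemma rdiag_swp:
  assumes p: "p permutes {..<r}" and "i < r" "j < r"
  shows "rdiag p p (perm_diag r (swp i j)) = perm_diag r (swp (p i) (p j))"
proof -
  have s: "swp i j permutes {..<r}" using assms by (simp add: swp_permutes)
  have i: "inv (inv p) = p" by (rule inv_inv_eq[OF permutes_bij[OF p]])
  have "rdiag p p (perm_diag r (swp i j)) = rdiag id p (rdiag p id (perm_diag r (swp i j)))"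
    by (simp add: rdiag_rdiag)
  also have "\<dots> = perm_diag r (p \<circ> (swp i j \<circ> inv p))"
    using rdiag_perm_right[OF permutes_inv[OF p] s]
      rdiag_perm_left[OF p permutes_compose[OF permutes_inv[OF p] s]]
    by (simp add: i)
  also have "p \<circ> (swp i j \<circ> inv p) = swp (p i) (p j)"
  proof
    fix x
    have "inv p x = a \<longleftrightarrow> x = p a" for a using permutes_inverses[OF p] by metis
    then show "(p \<circ> (swp i j \<circ> inv p)) x = swp (p i) (p j) x"
      using permutes_inverses[OF p] by (simp add: swp_def)
  qed
  finally show ?thesis .
qed

section \<open>The connector under conjugation\<close>

abbreviation hb :: "nat \<Rightarrow> 'k pexp" where
  "hb n \<equiv> ph n n (idd n)"

lemma pwt_hb: "pwt (hb n) (Suc n) (Suc n)"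
  by (rule pwt_ph[OF is_diag_idd])

text \<open>Both products are \<open>ph n n D\<close>, since the connector absorbs the diagram from
  either side.\<close>

lemma hb_commutes:
  assumes D: "is_diag n n D"
  shows "commutes \<delta> (Suc n) (hb n) (io (Suc n) (Suc n) (dtens (Suc 0) (Suc 0) (idd (Suc 0)) D))"
  unfolding commutes_def
  by (rule peq.trans[OF ph_io[OF stacks_idd_left[OF D]] peq.sym[OF io_ph[OF stacks_idd_right[OF D]]]])

lemma pconj_hb_fixing_0:
  assumes p: "p permutes {..<Suc n}" and 0: "p 0 = 0"
  shows "peq \<delta> (Suc n) (Suc n) (pconj (Suc n) p (hb n)) (hb n)"
proof -
  obtain q where q: "q permutes {..<n}"
    "perm_diag (Suc n) p = dtens (Suc 0) (Suc 0) (idd (Suc 0)) (perm_diag n q)"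
    using perm_diag_fixing_0[OF p 0] .
  let ?r = "Suc n"
  note w = pwt_ip[OF p] pwt_ip[OF permutes_inv[OF p]] pwt_hb
  have c: "peq \<delta> ?r ?r (PComp (ip ?r p) (hb n)) (PComp (hb n) (ip ?r p))"
    using hb_commutes[OF is_diag_perm[OF q(1)], of \<delta>] unfolding commutes_def q(2) by (rule peq.sym)
  have "peq \<delta> ?r ?r (pconj ?r p (hb n)) (PComp (PComp (ip ?r p) (hb n)) (ip ?r (inv p)))"
    unfolding pconj_def by (rule peq.sym[OF peq.comp_assoc] w)+
  also have "peq \<delta> ?r ?r \<dots> (PComp (PComp (hb n) (ip ?r p)) (ip ?r (inv p)))"
    by (rule peq.comp_cong[OF c peq.refl] w)+
  also have "peq \<delta> ?r ?r \<dots> (PComp (hb n) (PComp (ip ?r p) (ip ?r (inv p))))"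
    by (rule peq.comp_assoc w)+
  also have "peq \<delta> ?r ?r \<dots> (PComp (hb n) (pid ?r))"
    using ip_comp[OF p permutes_inv[OF p], of \<delta>]
    by (intro peq.comp_cong[OF peq.refl[OF pwt_hb]]) (simp add: permutes_inv_o[OF p] ip_id)
  also have "peq \<delta> ?r ?r \<dots> (hb n)" by (rule peq.comp_id_right[OF pwt_hb])
  finally show ?thesis .
qed

text \<open>These are the permutations of \<open>siginvd\<close> and \<open>sigd\<close> on strands
  counted from 0; that they are inverse to each other makes \<open>H0e\<close> a conjugate of
  \<open>hb\<close>.\<close>

lemma siginv_permutes:
  fixes i r :: nat
  assumes "i < r"
  shows "(\<lambda>a. if a = 0 then i else if a \<le> i then a - 1 else a) permutes {..<r}" (is "?t permutes _")
    "inv (\<lambda>a. if a = 0 then i else if a \<le> i then a - 1 else a) =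
      (\<lambda>a. if a < i then a + 1 else if a = i then 0 else a)" (is "_ = ?s")
proof -
  have *: "?t (?s x) = x" "?s (?t x) = x" for x by auto
  have "bij_betw ?t {..<r} {..<r}"
  proof (rule bij_betw_byWitness[of _ ?s])
    show "?t ` {..<r} \<subseteq> {..<r}" "?s ` {..<r} \<subseteq> {..<r}" using assms by auto
  qed (use * in blast)+
  moreover have "?t x = x" if "x \<notin> {..<r}" for x using that assms by auto
  ultimately show "?t permutes {..<r}" by (rule bij_imp_permutes)
  show "inv ?t = ?s" by (rule inv_equality) (use * in simp_all)
qed

text \<open>Any permutation with \<open>p 0 = i\<close> may replace the cycle \<open>t\<close> in
  the definition of \<open>H0e\<close>, since \<open>inv t \<circ> p\<close> fixes strand 0 and so
  leaves \<open>hb n\<close> unchanged.\<close>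

lemma H0e_pconj:
  assumes p: "p permutes {..<Suc n}" and p0: "p 0 = i"
  shows "peq \<delta> (Suc n) (Suc n) (H0e (Suc n) (Suc i)) (pconj (Suc n) p (hb n))"
proof -
  let ?r = "Suc n"
  define t where "t = (\<lambda>a. if a = 0 then i else if a \<le> i then a - 1 else a)"
  have i: "i < ?r" using permutes_in_image[OF p, of 0] p0 by simp
  have t: "t permutes {..<?r}" "inv t = (\<lambda>a. if a < i then a + 1 else if a = i then 0 else a)"
    using siginv_permutes[OF i] by (simp_all add: t_def)
  have H: "H0e ?r (Suc i) = pconj ?r t (hb n)"
    unfolding H0e_def pconj_def siginvd_def sigd_def t(2) diff_Suc_1 by (simp add: t_def)
  have q: "inv t \<circ> p permutes {..<?r}" by (rule permutes_compose[OF p permutes_inv[OF t(1)]])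
  have "peq \<delta> ?r ?r (pconj ?r t (hb n)) (pconj ?r t (pconj ?r (inv t \<circ> p) (hb n)))"
    by (rule pconj_cong[OF t(1) peq.sym[OF pconj_hb_fixing_0[OF q]]]) (simp add: t(2) p0)
  also have "peq \<delta> ?r ?r \<dots> (pconj ?r (t \<circ> (inv t \<circ> p)) (hb n))"
    by (rule pconj_pconj[OF t(1) q pwt_hb])
  also have "t \<circ> (inv t \<circ> p) = p" by (simp add: o_assoc permutes_inv_o[OF t(1)])
  finally show ?thesis by (simp add: H)
qed

lemma pwt_H0e: "i < r \<Longrightarrow> pwt (H0e r (Suc i)) r r"
proof -
  assume i: "i < r"
  then obtain n where r: "r = Suc n" by (cases r) auto
  note t = siginv_permutes[OF i]
  show ?thesis
    using pwt_pconj[OF t(1) pwt_hb[of n, folded r]]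
    unfolding pconj_def t(2) H0e_def siginvd_def sigd_def diff_Suc_1 by (simp add: r)
qed

text \<open>\<open>H0e r (Suc i)\<close> is the conjugate of \<open>hb\<close> by the swap of 0 and
  i, and that swap followed by p sends 0 to \<open>p i\<close>.\<close>

lemma pconj_H0e:
  assumes p: "p permutes {..<r}" and i: "i < r"
  shows "peq \<delta> r r (pconj r p (H0e r (Suc i))) (H0e r (Suc (p i)))"
proof -
  obtain n where r: "r = Suc n" using i by (cases r) auto
  have s: "swp 0 i permutes {..<r}" using i by (intro swp_permutes) auto
  have ps: "p \<circ> swp 0 i permutes {..<r}" by (rule permutes_compose[OF s p])
  have "peq \<delta> r r (pconj r p (H0e r (Suc i))) (pconj r p (pconj r (swp 0 i) (hb n)))"
    using H0e_pconj[OF s[unfolded r], of i \<delta>] r by (intro pconj_cong[OF p]) (simp add: swp_def)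
  also have "peq \<delta> r r \<dots> (pconj r (p \<circ> swp 0 i) (hb n))"
    using pconj_pconj[OF p s, of "hb n" \<delta>] pwt_hb[of n] by (simp add: r)
  also have "peq \<delta> r r \<dots> (H0e r (Suc (p i)))"
    using peq.sym[OF H0e_pconj[OF ps[unfolded r], of "p i" \<delta>]] by (simp add: r swp_def)
  finally show ?thesis .
qed

section \<open>The chord relations\<close>

text \<open>Strands count from 0 here; in \<open>Hmat\<close> index 0 is the pole and strands count
  from 1, whence the shift in \<open>Hmat_Suc\<close>.\<close>

definition brauer_H :: "nat \<Rightarrow> nat \<Rightarrow> nat \<Rightarrow> 'k::comm_ring_1 pexp" where
  "brauer_H r i j = PAdd (ip r (swp i j)) (PSmul (-1) (io r r (arc r i j)))"

lemma Hmat_Suc: "Hmat r (Suc i) (Suc j) = brauer_H r i j"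
  by (simp add: Hmat_def brauer_H_def transd_def pneg_def)

lemma brauer_H_commute: "brauer_H r i j = brauer_H r j i"
  by (simp add: brauer_H_def swp_commute[of i j] arc_commute[of r i j])

lemma pwt_arc: "i < r \<Longrightarrow> j < r \<Longrightarrow> i \<noteq> j \<Longrightarrow> pwt (io r r (arc r i j)) r r"
  by (intro pwt_io is_diag_arc)

lemma pwt_swp: "i < r \<Longrightarrow> j < r \<Longrightarrow> pwt (ip r (swp i j)) r r"
  by (intro pwt_ip swp_permutes)

lemma pwt_brauer_H: "i < r \<Longrightarrow> j < r \<Longrightarrow> i \<noteq> j \<Longrightarrow> pwt (brauer_H r i j) r r"
  unfolding brauer_H_def by (intro pwt.intros(2,3) pwt_arc pwt_swp)

lemma pconj_brauer_H:
  assumes p: "p permutes {..<r}" and l: "i < r" "j < r" "i \<noteq> j"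
  shows "peq \<delta> r r (pconj r p (brauer_H r i j)) (brauer_H r (p i) (p j))"
proof -
  note w = pwt_arc[OF l] pwt_swp[OF l(1,2)]
  have "peq \<delta> r r (pconj r p (brauer_H r i j))
      (PAdd (pconj r p (ip r (swp i j))) (pconj r p (PSmul (-1) (io r r (arc r i j)))))"
    unfolding brauer_H_def by (rule pconj_add p w pwt.intros(3))+
  also have "peq \<delta> r r \<dots> (PAdd (pconj r p (ip r (swp i j))) (PSmul (-1) (pconj r p (io r r (arc r i j)))))"
    by (rule peq.add_cong[OF peq.refl pconj_smul] pwt_pconj p w)+
  also have "peq \<delta> r r \<dots> (brauer_H r (p i) (p j))"
    using pconj_io[OF p is_diag_perm[OF swp_permutes[OF l(1,2)]], of \<delta>] pconj_io[OF p is_diag_arc[OF l], of \<delta>]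
    unfolding brauer_H_def rdiag_swp[OF p l(1,2)] rdiag_arc[OF p]
    by (intro peq.add_cong peq.smul_cong)
  finally show ?thesis .
qed

lemma commutes_ip:
  assumes p: "p permutes {..<r}" and a: "pwt a r r" and c: "peq \<delta> r r (pconj r p a) a"
  shows "commutes \<delta> r a (ip r p)"
proof -
  let ?p = "ip r p" and ?q = "ip r (inv p)"
  note w = pwt.intros(6) pwt_ip[OF p] pwt_ip[OF permutes_inv[OF p]] a
  have inv: "peq \<delta> r r (PComp ?q ?p) (pid r)"
    using ip_comp[OF permutes_inv[OF p] p, of \<delta>] by (simp add: permutes_inv_o[OF p] ip_id)
  have "peq \<delta> r r (PComp a ?p) (PComp (pconj r p a) ?p)"
    by (rule peq.comp_cong[OF peq.sym[OF c] peq.refl] w)+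
  also have "peq \<delta> r r \<dots> (PComp ?p (PComp (PComp a ?q) ?p))"
    unfolding pconj_def by (rule peq.comp_assoc w)+
  also have "peq \<delta> r r \<dots> (PComp ?p (PComp a (PComp ?q ?p)))"
    by (rule peq.comp_cong[OF peq.refl peq.comp_assoc] w)+
  also have "peq \<delta> r r \<dots> (PComp ?p (PComp a (pid r)))"
    by (rule peq.comp_cong[OF peq.refl peq.comp_cong[OF peq.refl inv]] w)+
  also have "peq \<delta> r r \<dots> (PComp ?p a)"
    by (rule peq.comp_cong[OF peq.refl peq.comp_id_right] w)+
  finally show ?thesis unfolding commutes_def .
qed

text \<open>Applied with T = H_ki + H_kj, where k = 0 stands for the pole.\<close>

lemma commutes_brauer_H:
  assumes l: "i < r" "j < r" "i \<noteq> j" and T: "pwt T r r"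
    and symm: "peq \<delta> r r (pconj r (swp i j) T) T"
    and right: "peq \<delta> r r (PComp T (io r r (arc r i j))) (PZero r r)"
    and left: "peq \<delta> r r (PComp (io r r (arc r i j)) T) (PZero r r)"
  shows "commutes \<delta> r T (brauer_H r i j)"
  unfolding brauer_H_def
proof (intro commutes_add commutes_smul pwt_arc pwt_swp pwt.intros(3) T l)
  show "commutes \<delta> r T (ip r (swp i j))"
    by (rule commutes_ip[OF swp_permutes[OF l(1,2)] T symm])
  show "commutes \<delta> r T (io r r (arc r i j))"
    unfolding commutes_def by (rule peq.trans[OF right peq.sym[OF left]])
qed

text \<open>Conjugation by (k l) fixes \<open>brauer_H r i j\<close>, which settles the first
  summand of \<open>brauer_H r k l\<close>. For e_kl, conjugation by (i j) fixes it, and the product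
  of two disjoint arc diagrams does not depend on the order.\<close>

lemma commutes_brauer_H_brauer_H:
  assumes l: "i < r" "j < r" "k < r" "l < r" and d: "distinct [i, j, k, l]"
  shows "commutes \<delta> r (brauer_H r i j) (brauer_H r k l)"
proof -
  have ij: "i \<noteq> j" "k \<noteq> l" "i \<noteq> k" "i \<noteq> l" "j \<noteq> k" "j \<noteq> l" using d by auto
  note w = pwt_arc[OF l(1,2) ij(1)] pwt_arc[OF l(3,4) ij(2)] pwt_swp[OF l(1,2)] pwt_swp[OF l(3,4)]
    pwt_brauer_H[OF l(1,2) ij(1)] pwt.intros(3)
  note s = swp_permutes[OF l(1,2)] swp_permutes[OF l(3,4)]
  have e: "swp i j k = k" "swp i j l = l" "swp k l i = i" "swp k l j = j" using ij by (auto simp: swp_def)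
  have "commutes \<delta> r (brauer_H r i j) (ip r (swp k l))"
    using pconj_brauer_H[OF s(2) l(1,2) ij(1), of \<delta>] by (intro commutes_ip s w) (simp add: e)
  moreover have "commutes \<delta> r (io r r (arc r k l)) (brauer_H r i j)"
    unfolding brauer_H_def
  proof (intro commutes_add commutes_smul w)
    show "commutes \<delta> r (io r r (arc r k l)) (ip r (swp i j))"
      using pconj_io[OF s(1) is_diag_arc[OF l(3,4) ij(2)], of \<delta>]
      by (intro commutes_ip s w) (simp add: e rdiag_arc[OF s(1)])
    have "distinct [k, l, i, j]" using d by auto
    from stacks_arc_arc_disjoint[OF l(3,4,1,2) this]
    show "commutes \<delta> r (io r r (arc r k l)) (io r r (arc r i j))"
      unfolding commutes_def
      using io_comp[OF stacks_arc_arc_disjoint[OF l d], of \<delta>] io_comp[of r r r "arc r k l" "arc r i j" _ \<delta>]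
      by (metis peq.sym peq.trans two_arcs_commute[OF d])
  qed
  ultimately show ?thesis
    unfolding brauer_H_def[of r k l]
    by (intro commutes_add commutes_smul w commutes_sym[of \<delta> r "io r r (arc r k l)"])
qed

lemma arc_swp:
  assumes l: "i < r" "j < r" and d: "i \<noteq> j"
  shows "peq \<delta> r r (PComp (ip r (swp i j)) (io r r (arc r i j))) (io r r (arc r i j))"
    "peq \<delta> r r (PComp (io r r (arc r i j)) (ip r (swp i j))) (io r r (arc r i j))"
  using io_comp[OF stacks_perm_left[OF is_diag_arc[OF l d] swp_permutes[OF l]], of \<delta>]
    io_comp[OF stacks_perm_right[OF is_diag_arc[OF l d] swp_permutes[OF l]], of \<delta>]
  by (simp_all add: inv_swp rdiag_swp_arc_same[OF l d])

lemma arc_arc_adjacent: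
  assumes l: "i < r" "j < r" "k < r" and d: "distinct [i, j, k]"
  shows "peq \<delta> r r (PComp (ip r (swp i k)) (io r r (arc r j k))) (PComp (io r r (arc r i j)) (io r r (arc r j k)))"
    "peq \<delta> r r (PComp (io r r (arc r i j)) (ip r (swp i k))) (PComp (io r r (arc r i j)) (io r r (arc r j k)))"
proof -
  have D: "is_diag r r (arc r i j)" "is_diag r r (arc r j k)" using l d by (auto intro: is_diag_arc)
  note s = swp_permutes[OF l(1,3)]
  note c = peq.sym[OF io_comp[OF stacks_arc_arc_adjacent[OF l d]], of \<delta>]
  show "peq \<delta> r r (PComp (ip r (swp i k)) (io r r (arc r j k))) (PComp (io r r (arc r i j)) (io r r (arc r j k)))"
    using peq.trans[OF io_comp[OF stacks_perm_left[OF D(2) s]] c[unfolded rdiag_swp_arc[OF l d]]] .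
  show "peq \<delta> r r (PComp (io r r (arc r i j)) (ip r (swp i k))) (PComp (io r r (arc r i j)) (io r r (arc r j k)))"
    using peq.trans[OF io_comp[OF stacks_perm_right[OF D(1) s], unfolded inv_swp] c] .
qed

lemma peq_cancel_pair:
  assumes w: "pwt x m n" "pwt y m n"
  shows "peq \<delta> m n (PAdd (PAdd x (PSmul (-1) y)) (PAdd y (PSmul (-1) x))) (PZero m n)"
proof -
  let ?x = "PSmul (-1) x" and ?y = "PSmul (-1) y"
  note W = w pwt.intros(1-3)
  have "peq \<delta> m n (PAdd (PAdd x ?y) (PAdd y ?x)) (PAdd x (PAdd ?y (PAdd y ?x)))"
    by (rule peq.add_assoc W)+
  also have "peq \<delta> m n \<dots> (PAdd x (PAdd (PAdd ?y y) ?x))"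
    by (rule peq.add_cong[OF peq.refl peq.sym[OF peq.add_assoc]] W)+
  also have "peq \<delta> m n \<dots> (PAdd x (PAdd (PZero m n) ?x))"
    by (rule peq.add_cong[OF peq.refl peq.add_cong[OF peq_neg_add[OF peq.refl] peq.refl]] W)+
  also have "peq \<delta> m n \<dots> (PAdd x ?x)"
    by (rule peq.add_cong[OF peq.refl peq_zero_add] W)+
  also have "peq \<delta> m n \<dots> (PZero m n)" by (rule peq.add_neg W)+
  finally show ?thesis .
qed

text \<open>The transposition (k i) times e_ij is e_kj e_ij. Each right-hand side changes sign when
  i and j are exchanged, so adding the version for \<open>brauer_H r k j\<close> leaves
  zero.\<close>

lemma brauer_H_arc:
  assumes l: "i < r" "j < r" "k < r" and d: "distinct [k, i, j]"
  shows "peq \<delta> r r (PComp (brauer_H r k i) (io r r (arc r i j)))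
     (PAdd (PComp (io r r (arc r k j)) (io r r (arc r i j)))
       (PSmul (-1) (PComp (io r r (arc r k i)) (io r r (arc r i j)))))" (is ?L)
    "peq \<delta> r r (PComp (io r r (arc r i j)) (brauer_H r k i))
     (PAdd (PComp (io r r (arc r i j)) (io r r (arc r k j)))
       (PSmul (-1) (PComp (io r r (arc r i j)) (io r r (arc r k i)))))" (is ?R)
proof -
  have d': "k \<noteq> i" "k \<noteq> j" "i \<noteq> j" "distinct [k, j, i]" "distinct [i, j, k]" using d by auto
  let ?s = "ip r (swp k i)" and ?e = "io r r (arc r i j)" and ?f = "io r r (arc r k i)"
  note w = pwt.intros(3,6) pwt_arc[OF l(1,2) d'(3)] pwt_arc[OF l(3,1) d'(1)] pwt_swp[OF l(3,1)]
  have "peq \<delta> r r (PComp (brauer_H r k i) ?e) (PAdd (PComp ?s ?e) (PComp (PSmul (-1) ?f) ?e))"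
    unfolding brauer_H_def by (rule peq.comp_add_left w)+
  also have "peq \<delta> r r \<dots> (PAdd (PComp (io r r (arc r k j)) ?e) (PSmul (-1) (PComp ?f ?e)))"
    by (rule peq.add_cong arc_arc_adjacent(1)[OF l(3,2,1) d'(4), unfolded arc_commute[of r j i]]
        peq.comp_smul_left w)+
  finally show ?L .
  have "peq \<delta> r r (PComp ?e (brauer_H r k i)) (PAdd (PComp ?e ?s) (PComp ?e (PSmul (-1) ?f)))"
    unfolding brauer_H_def by (rule peq.comp_add_right w)+
  also have "peq \<delta> r r \<dots> (PAdd (PComp ?e (io r r (arc r k j))) (PSmul (-1) (PComp ?e ?f)))"
    by (rule peq.add_cong arc_arc_adjacent(2)[OF l d'(5), unfolded arc_commute[of r j k] swp_commute[of i k]]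
        peq.comp_smul_right w)+
  finally show ?R .
qed

lemma commutes_brauer_H_add_brauer_H:
  assumes l: "i < r" "j < r" "k < r" and d: "distinct [k, i, j]"
  shows "commutes \<delta> r (PAdd (brauer_H r k i) (brauer_H r k j)) (brauer_H r i j)"
proof -
  have d': "k \<noteq> i" "k \<noteq> j" "i \<noteq> j" "distinct [k, j, i]" using d by auto
  let ?e = "io r r (arc r i j)" and ?f = "io r r (arc r k i)" and ?h = "io r r (arc r k j)"
  note s = swp_permutes[OF l(1,2)]
  note w = pwt.intros(2,3,6) pwt_brauer_H[OF l(3,1) d'(1)] pwt_brauer_H[OF l(3,2) d'(2)] pwt_arc[OF l(1,2) d'(3)]
    pwt_arc[OF l(3,1) d'(1)] pwt_arc[OF l(3,2) d'(2)]
  note c = arc_commute[of r j i]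
  show ?thesis
  proof (rule commutes_brauer_H[OF l(1,2) d'(3)])
    show "pwt (PAdd (brauer_H r k i) (brauer_H r k j)) r r" by (rule w)+
    have "peq \<delta> r r (pconj r (swp i j) (PAdd (brauer_H r k i) (brauer_H r k j)))
        (PAdd (pconj r (swp i j) (brauer_H r k i)) (pconj r (swp i j) (brauer_H r k j)))"
      by (rule pconj_add[OF s] w)+
    also have "peq \<delta> r r \<dots> (PAdd (brauer_H r k j) (brauer_H r k i))"
      using pconj_brauer_H[OF s l(3,1) d'(1), of \<delta>] pconj_brauer_H[OF s l(3,2) d'(2), of \<delta>] d'
      by (intro peq.add_cong) (simp_all add: swp_def)
    also have "peq \<delta> r r \<dots> (PAdd (brauer_H r k i) (brauer_H r k j))" by (rule peq.add_comm w)+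
    finally show "peq \<delta> r r (pconj r (swp i j) (PAdd (brauer_H r k i) (brauer_H r k j))) (PAdd (brauer_H r k i) (brauer_H r k j))" .
    have "peq \<delta> r r (PComp (PAdd (brauer_H r k i) (brauer_H r k j)) ?e)
        (PAdd (PComp (brauer_H r k i) ?e) (PComp (brauer_H r k j) ?e))"
      by (rule peq.comp_add_left w)+
    also have "peq \<delta> r r \<dots> (PAdd (PAdd (PComp ?h ?e) (PSmul (-1) (PComp ?f ?e)))
        (PAdd (PComp ?f ?e) (PSmul (-1) (PComp ?h ?e))))"
      by (rule peq.add_cong brauer_H_arc(1)[OF l d] brauer_H_arc(1)[OF l(2,1,3) d'(4), unfolded c])+
    also have "peq \<delta> r r \<dots> (PZero r r)" by (rule peq_cancel_pair w)+
    finally show "peq \<delta> r r (PComp (PAdd (brauer_H r k i) (brauer_H r k j)) ?e) (PZero r r)" .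
    have "peq \<delta> r r (PComp ?e (PAdd (brauer_H r k i) (brauer_H r k j)))
        (PAdd (PComp ?e (brauer_H r k i)) (PComp ?e (brauer_H r k j)))"
      by (rule peq.comp_add_right w)+
    also have "peq \<delta> r r \<dots> (PAdd (PAdd (PComp ?e ?h) (PSmul (-1) (PComp ?e ?f)))
        (PAdd (PComp ?e ?f) (PSmul (-1) (PComp ?e ?h))))"
      by (rule peq.add_cong brauer_H_arc(2)[OF l d] brauer_H_arc(2)[OF l(2,1,3) d'(4), unfolded c])+
    also have "peq \<delta> r r \<dots> (PZero r r)" by (rule peq_cancel_pair w)+
    finally show "peq \<delta> r r (PComp ?e (PAdd (brauer_H r k i) (brauer_H r k j))) (PZero r r)" .
  qed
qed

text \<open>The swap of 0 and i brings the connector to the first strand and j, k to positive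
  positions. There the Brauer part is an identity strand next to a diagram, which passes the
  connector; conjugation carries the result back.\<close>

lemma commutes_H0e_brauer_H:
  assumes l: "i < r" "j < r" "k < r" and d: "distinct [i, j, k]"
  shows "commutes \<delta> r (H0e r (Suc i)) (brauer_H r j k)"
proof -
  obtain n where r: "r = Suc n" using l by (cases r) auto
  have p: "swp 0 i permutes {..<r}" using l by (intro swp_permutes) auto
  have "swp 0 i j \<noteq> 0" "swp 0 i k \<noteq> 0" using d by (auto simp: swp_def)
  then obtain a b where ab: "swp 0 i j = Suc a" "swp 0 i k = Suc b" by (metis not0_implies_Suc)
  have "swp 0 i j < r" "swp 0 i k < r" using l by (auto simp: swp_def)
  then have "Suc a < r" "Suc b < r" by (simp_all only: ab)
  moreover have jk: "swp 0 i (Suc a) = j" "swp 0 i (Suc b) = k"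
    by (simp_all only: swp_swp flip: ab)
  ultimately have abl: "Suc a < r" "Suc b < r" "Suc a \<noteq> Suc b" "a < n" "b < n" "a \<noteq> b"
    using d r by auto
  have s: "swp (Suc a) (Suc b) permutes {..<Suc n}" using abl r by (intro swp_permutes) auto
  have w: "pwt (hb n) r r" using pwt_hb r by simp
  obtain q where q: "q permutes {..<n}"
    "perm_diag (Suc n) (swp (Suc a) (Suc b)) = dtens (Suc 0) (Suc 0) (idd (Suc 0)) (perm_diag n q)"
    by (rule perm_diag_fixing_0[OF s]) (auto simp: swp_def)
  have "commutes \<delta> r (hb n) (brauer_H r (Suc a) (Suc b))"
    unfolding brauer_H_def
  proof (intro commutes_add commutes_smul w pwt_arc pwt_swp pwt.intros(3) abl)
    show "commutes \<delta> r (hb n) (ip r (swp (Suc a) (Suc b)))"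
      unfolding r q(2) by (rule hb_commutes[OF is_diag_perm[OF q(1)]])
    show "commutes \<delta> r (hb n) (io r r (arc r (Suc a) (Suc b)))"
      using hb_commutes[OF is_diag_arc[OF abl(4-6)], of \<delta>] by (simp add: r dtens_idd_arc)
  qed
  then have c: "commutes \<delta> r (pconj r (swp 0 i) (hb n)) (pconj r (swp 0 i) (brauer_H r (Suc a) (Suc b)))"
    by (rule pconj_commutes[OF p w pwt_brauer_H[OF abl(1-3)]])
  show ?thesis
  proof (rule commutes_cong[OF c])
    show "peq \<delta> r r (H0e r (Suc i)) (pconj r (swp 0 i) (hb n))"
      using H0e_pconj[OF p[unfolded r], of i \<delta>] by (simp add: r swp_def)
    show "peq \<delta> r r (brauer_H r j k) (pconj r (swp 0 i) (brauer_H r (Suc a) (Suc b)))"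
      using peq.sym[OF pconj_brauer_H[OF p abl(1-3), of \<delta>]] by (simp add: jk)
  qed
qed

section \<open>Two-strand relations carried over to r strands\<close>

lemma hb_eq: "peq \<delta> (Suc (Suc n)) (Suc (Suc n)) (PTens (ph 1 1 (idd 1)) n n (idd n)) (hb (Suc n))"
  using ph_tens[OF is_diag_idd[of 1] is_diag_idd[of n], of \<delta>] dtens_idd_idd[of 1 n] by simp

lemma arc01_eq: "peq \<delta> (Suc (Suc n)) (Suc (Suc n)) (PTens (io 2 2 (arc 2 0 1)) n n (idd n))
    (io (Suc (Suc n)) (Suc (Suc n)) (arc (Suc (Suc n)) 0 1))"
  using io_tens[OF is_diag_arc[of 0 2 1] is_diag_idd[of n], of \<delta>] dtens_arc_idd[of 0 2 1 n]
  by (simp add: numeral_2_eq_2)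

lemma Xd_tens_eq: "peq \<delta> (Suc (Suc n)) (Suc (Suc n)) (PTens (io 2 2 Xd) n n (idd n))
    (ip (Suc (Suc n)) (swp 0 1))"
  using io_tens[OF is_diag_small(15) is_diag_idd[of n], of \<delta>]
    dtens_perm_idd[OF swp_permutes[of 0 2 1], of n]
  by (simp add: numeral_2_eq_2 Xd_eq)

lemma tens_idd_comp:
  "pwt a 2 2 \<Longrightarrow> pwt b 2 2 \<Longrightarrow> peq \<delta> (Suc (Suc n)) (Suc (Suc n))
     (PTens (PComp a b) n n (idd n)) (PComp (PTens a n n (idd n)) (PTens b n n (idd n)))"
  using peq.sym[OF tens_comp[OF _ _ stacks_idd_left[OF is_diag_idd[of n]]], of a 2 2 b 2 \<delta>] by simp

lemma tens_idd_cong: "peq \<delta> 2 2 a b \<Longrightarrow>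
    peq \<delta> (Suc (Suc n)) (Suc (Suc n)) (PTens a n n (idd n)) (PTens b n n (idd n))"
  using peq.tens_cong[OF _ is_diag_idd[of n], of \<delta> 2 2 a b] by simp

lemma tens_idd_add: "pwt a 2 2 \<Longrightarrow> pwt b 2 2 \<Longrightarrow> peq \<delta> (Suc (Suc n)) (Suc (Suc n))
    (PTens (PAdd a b) n n (idd n)) (PAdd (PTens a n n (idd n)) (PTens b n n (idd n)))"
  using peq.tens_add[OF _ _ is_diag_idd[of n], of a 2 2 b \<delta>] by simp

lemma tens_idd_smul: "pwt a 2 2 \<Longrightarrow> peq \<delta> (Suc (Suc n)) (Suc (Suc n))
    (PTens (PSmul c a) n n (idd n)) (PSmul c (PTens a n n (idd n)))"
  using peq.tens_smul[OF _ is_diag_idd[of n], of a 2 2 \<delta> c] by simp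

lemma pwt_two:
  "pwt (ph 1 1 (idd 1)) 2 2" "pwt (io 2 2 Xd) 2 2" "pwt (io 2 2 (arc 2 0 1)) 2 2"
  "pwt (io 2 0 capd) 2 0" "pwt (io 0 2 cupd) 0 2"
  by (rule pwt_ph11 pwt_io[OF is_diag_small(15)] pwt_io[OF is_diag_arc[of 0 2 1]]
      pwt_io[OF is_diag_capd] pwt_io[OF is_diag_cupd]; simp)+

text \<open>On two strands the arc diagram is cup o cap, so \<open>skew_cup\<close> and
  \<open>skew_cap\<close> act on the half next to the connector; tensoring with \<open>idd n\<close>
  supplies the further strands.\<close>

lemma hb_arc:
  "peq \<delta> (Suc (Suc n)) (Suc (Suc n))
     (PComp (ip (Suc (Suc n)) (swp 0 1)) (PComp (hb (Suc n)) (io (Suc (Suc n)) (Suc (Suc n)) (arc (Suc (Suc n)) 0 1))))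
     (PSmul (-1) (PComp (hb (Suc n)) (io (Suc (Suc n)) (Suc (Suc n)) (arc (Suc (Suc n)) 0 1))))" (is ?L)
  "peq \<delta> (Suc (Suc n)) (Suc (Suc n))
     (PComp (PComp (io (Suc (Suc n)) (Suc (Suc n)) (arc (Suc (Suc n)) 0 1)) (hb (Suc n))) (ip (Suc (Suc n)) (swp 0 1)))
     (PSmul (-1) (PComp (io (Suc (Suc n)) (Suc (Suc n)) (arc (Suc (Suc n)) 0 1)) (hb (Suc n))))" (is ?R)
proof -
  let ?H = "ph 1 1 (idd 1)" and ?E = "io 2 2 (arc 2 0 1)" and ?X = "io 2 2 Xd"
  let ?cap = "io 2 0 capd" and ?cup = "io 0 2 cupd" and ?r = "Suc (Suc n)"
  let ?h = "hb (Suc n)" and ?e = "io ?r ?r (arc ?r 0 1)" and ?s = "ip ?r (swp 0 1)"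
  note w = pwt.intros(3,6) pwt_two
  have E: "peq \<delta> 2 2 (PComp ?cup ?cap) ?E" by (rule io_comp[OF stacks_cup_cap])
  have HE: "peq \<delta> 2 2 (PComp ?H ?E) (PComp (PComp ?H ?cup) ?cap)"
    by (rule peq.trans[OF peq.comp_cong[OF peq.refl peq.sym[OF E]] peq.sym[OF peq.comp_assoc]] w)+
  have EH: "peq \<delta> 2 2 (PComp ?E ?H) (PComp ?cup (PComp ?cap ?H))"
    by (rule peq.trans[OF peq.comp_cong[OF peq.sym[OF E] peq.refl] peq.comp_assoc] w)+
  have "peq \<delta> 2 2 (PComp ?X (PComp ?H ?E)) (PComp ?X (PComp (PComp ?H ?cup) ?cap))"
    by (rule peq.comp_cong[OF peq.refl HE] w)+
  also have "peq \<delta> 2 2 \<dots> (PComp (PComp ?X (PComp ?H ?cup)) ?cap)"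
    by (rule peq.sym[OF peq.comp_assoc] w)+
  also have "peq \<delta> 2 2 \<dots> (PComp (PSmul (-1) (PComp ?H ?cup)) ?cap)"
    by (rule peq.comp_cong[OF peq.sym[OF skew_cup] peq.refl] w)+
  also have "peq \<delta> 2 2 \<dots> (PSmul (-1) (PComp (PComp ?H ?cup) ?cap))"
    by (rule peq.comp_smul_left w)+
  also have "peq \<delta> 2 2 \<dots> (PSmul (-1) (PComp ?H ?E))"
    by (rule peq.smul_cong[OF peq.sym[OF HE]])
  finally have XHE: "peq \<delta> 2 2 (PComp ?X (PComp ?H ?E)) (PSmul (-1) (PComp ?H ?E))" .
  have "peq \<delta> 2 2 (PComp (PComp ?E ?H) ?X) (PComp (PComp ?cup (PComp ?cap ?H)) ?X)"
    by (rule peq.comp_cong[OF EH peq.refl] w)+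
  also have "peq \<delta> 2 2 \<dots> (PComp ?cup (PComp (PComp ?cap ?H) ?X))"
    by (rule peq.comp_assoc w)+
  also have "peq \<delta> 2 2 \<dots> (PComp ?cup (PSmul (-1) (PComp ?cap ?H)))"
    by (rule peq.comp_cong[OF peq.refl peq.sym[OF skew_cap]] w)+
  also have "peq \<delta> 2 2 \<dots> (PSmul (-1) (PComp ?cup (PComp ?cap ?H)))"
    by (rule peq.comp_smul_right w)+
  also have "peq \<delta> 2 2 \<dots> (PSmul (-1) (PComp ?E ?H))"
    by (rule peq.smul_cong[OF peq.sym[OF EH]])
  finally have EHX: "peq \<delta> 2 2 (PComp (PComp ?E ?H) ?X) (PSmul (-1) (PComp ?E ?H))" .
  have he: "peq \<delta> ?r ?r (PTens (PComp ?H ?E) n n (idd n)) (PComp ?h ?e)"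
    by (rule peq.trans[OF tens_idd_comp peq.comp_cong[OF hb_eq arc01_eq]] w)+
  have eh: "peq \<delta> ?r ?r (PTens (PComp ?E ?H) n n (idd n)) (PComp ?e ?h)"
    by (rule peq.trans[OF tens_idd_comp peq.comp_cong[OF arc01_eq hb_eq]] w)+
  have "peq \<delta> ?r ?r (PComp ?s (PComp ?h ?e)) (PTens (PComp ?X (PComp ?H ?E)) n n (idd n))"
    by (rule peq.sym[OF peq.trans[OF tens_idd_comp peq.comp_cong[OF Xd_tens_eq he]]] w)+
  also have "peq \<delta> ?r ?r \<dots> (PTens (PSmul (-1) (PComp ?H ?E)) n n (idd n))"
    by (rule tens_idd_cong[OF XHE])
  also have "peq \<delta> ?r ?r \<dots> (PSmul (-1) (PComp ?h ?e))"
    by (rule peq.trans[OF tens_idd_smul peq.smul_cong[OF he]] w)+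
  finally show ?L .
  have "peq \<delta> ?r ?r (PComp (PComp ?e ?h) ?s) (PTens (PComp (PComp ?E ?H) ?X) n n (idd n))"
    by (rule peq.sym[OF peq.trans[OF tens_idd_comp peq.comp_cong[OF eh Xd_tens_eq]]] w)+
  also have "peq \<delta> ?r ?r \<dots> (PTens (PSmul (-1) (PComp ?E ?H)) n n (idd n))"
    by (rule tens_idd_cong[OF EHX])
  also have "peq \<delta> ?r ?r \<dots> (PSmul (-1) (PComp ?e ?h))"
    by (rule peq.trans[OF tens_idd_smul peq.smul_cong[OF eh]] w)+
  finally show ?R .
qed

text \<open>The swap is its own inverse, so the term of \<open>fourterm_lhs\<close> with
  \<open>H1e\<close> between two copies of \<open>X0e\<close> is a conjugate, the connector on the
  second strand. The rest is tensoring with \<open>idd n\<close>.\<close>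

lemma fourterm_hb:
  "commutes \<delta> (Suc (Suc n)) (hb (Suc n))
     (PAdd (pconj (Suc (Suc n)) (swp 0 1) (hb (Suc n))) (brauer_H (Suc (Suc n)) 0 1))"
proof -
  let ?H = "ph 1 1 (idd 1)" and ?E = "io 2 2 (arc 2 0 1)" and ?X = "io 2 2 Xd" and ?r = "Suc (Suc n)"
  let ?XHX = "PComp ?X (PComp ?H ?X)"
  note w = pwt.intros(2,3,6) pwt_two
  have H1: "H1e = ?H" and X0: "X0e = ?X" and HB: "HBe = PAdd ?X (PSmul (-1) ?E)"
    by (simp_all only: H1e_def X0e_def HBe_def pneg_def stacksD(4)[OF stacks_cup_cap])
  have wY: "pwt (PAdd ?XHX HBe) 2 2" unfolding HB by (rule w)+
  have "peq \<delta> 2 2 (PComp ?H (PAdd ?XHX HBe)) (PComp (PAdd ?XHX HBe) ?H)"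
    using peq.rel_fourterm[of \<delta>] unfolding fourterm_lhs_def Let_def pneg_def H1 X0
    by (rule peq_sub_zeroD) (rule w wY)+
  then have "peq \<delta> ?r ?r (PTens (PComp ?H (PAdd ?XHX HBe)) n n (idd n)) (PTens (PComp (PAdd ?XHX HBe) ?H) n n (idd n))"
    by (rule tens_idd_cong)
  then have c: "commutes \<delta> ?r (PTens ?H n n (idd n)) (PTens (PAdd ?XHX HBe) n n (idd n))"
    unfolding commutes_def
    using tens_idd_comp[OF pwt_two(1) wY, of \<delta> n] tens_idd_comp[OF wY pwt_two(1), of \<delta> n]
    by (meson peq.sym peq.trans)
  have "peq \<delta> ?r ?r (PTens (PAdd ?XHX HBe) n n (idd n))
      (PAdd (PTens ?XHX n n (idd n)) (PTens HBe n n (idd n)))"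
    unfolding HB by (rule tens_idd_add w)+
  also have "peq \<delta> ?r ?r \<dots> (PAdd (pconj ?r (swp 0 1) (hb (Suc n))) (brauer_H ?r 0 1))"
  proof (rule peq.add_cong)
    show "peq \<delta> ?r ?r (PTens ?XHX n n (idd n)) (pconj ?r (swp 0 1) (hb (Suc n)))"
      unfolding pconj_def inv_swp
      by (rule peq.trans[OF tens_idd_comp peq.comp_cong[OF Xd_tens_eq
            peq.trans[OF tens_idd_comp peq.comp_cong[OF hb_eq Xd_tens_eq]]]] w)+
    show "peq \<delta> ?r ?r (PTens HBe n n (idd n)) (brauer_H ?r 0 1)"
      unfolding HB brauer_H_def
      by (rule peq.trans[OF tens_idd_add peq.add_cong[OF Xd_tens_eq
            peq.trans[OF tens_idd_smul peq.smul_cong[OF arc01_eq]]]] w)+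
  qed
  finally have Y: "peq \<delta> ?r ?r (PTens (PAdd ?XHX HBe) n n (idd n))
      (PAdd (pconj ?r (swp 0 1) (hb (Suc n))) (brauer_H ?r 0 1))" .
  show ?thesis
    by (rule commutes_cong[OF c peq.sym[OF hb_eq] peq.sym[OF Y]])
qed

lemma H0e_hb:
  "peq \<delta> (Suc n) (Suc n) (H0e (Suc n) (Suc 0)) (hb n)"
  "peq \<delta> (Suc (Suc n)) (Suc (Suc n)) (H0e (Suc (Suc n)) (Suc 1)) (pconj (Suc (Suc n)) (swp 0 1) (hb (Suc n)))"
proof -
  show "peq \<delta> (Suc n) (Suc n) (H0e (Suc n) (Suc 0)) (hb n)"
    by (rule peq.trans[OF H0e_pconj[OF permutes_id] pconj_hb_fixing_0[OF permutes_id]]) simp_all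
  show "peq \<delta> (Suc (Suc n)) (Suc (Suc n)) (H0e (Suc (Suc n)) (Suc 1)) (pconj (Suc (Suc n)) (swp 0 1) (hb (Suc n)))"
    by (rule H0e_pconj[OF swp_permutes]) (simp_all add: swp_def)
qed

lemma permutes_two_points:
  assumes "i < Suc (Suc n)" "j < Suc (Suc n)" "i \<noteq> j"
  obtains p where "p permutes {..<Suc (Suc n)}" "p 0 = i" "p 1 = j"
proof
  \<comment> \<open>Chosen so that the swap of 0 and i sends k to j. As j differs from i, k is not
    0, and the swap of 1 and k keeps 0 in place.\<close>
  define k where "k = swp 0 i j"
  have k: "k \<noteq> 0" "k < Suc (Suc n)" "swp 0 i k = j" using assms by (auto simp: swp_def k_def)
  show "swp 0 i \<circ> swp 1 k permutes {..<Suc (Suc n)}"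
    by (intro permutes_compose swp_permutes) (use assms k in auto)
  show "(swp 0 i \<circ> swp 1 k) 0 = i" using k by (simp add: swp_def)
  have "swp 1 k 1 = k" by (simp add: swp_def)
  then show "(swp 0 i \<circ> swp 1 k) 1 = j" using k(3) by simp
qed

lemma commutes_fourterm:
  assumes l: "i < r" "j < r" "i \<noteq> j"
  shows "commutes \<delta> r (H0e r (Suc i)) (PAdd (H0e r (Suc j)) (brauer_H r i j))"
proof -
  obtain n where r: "r = Suc (Suc n)" using l by (metis less_Suc0 not0_implies_Suc not_less_zero)
  obtain p where p: "p permutes {..<r}" "p 0 = i" "p 1 = j"
    using permutes_two_points l unfolding r by metis
  have lt: "0 < r" "1 < r" "(0::nat) \<noteq> 1" using r by auto
  note w = pwt_H0e[OF lt(1)] pwt_H0e[OF lt(2)] pwt_brauer_H[OF lt] pwt.intros(2)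
  have "commutes \<delta> r (H0e r (Suc 0)) (PAdd (H0e r (Suc 1)) (brauer_H r 0 1))"
    unfolding r
    by (rule commutes_cong[OF fourterm_hb H0e_hb(1) peq.add_cong[OF H0e_hb(2) peq.refl[OF w(3)[unfolded r]]]])
  then have c: "commutes \<delta> r (pconj r p (H0e r (Suc 0))) (pconj r p (PAdd (H0e r (Suc 1)) (brauer_H r 0 1)))"
    by (rule pconj_commutes[OF p(1) w(1) w(4)[OF w(2,3)]])
  have "peq \<delta> r r (PAdd (H0e r (Suc j)) (brauer_H r i j)) (PAdd (pconj r p (H0e r (Suc 1))) (pconj r p (brauer_H r 0 1)))"
    by (rule peq.sym[OF peq.add_cong[OF pconj_H0e[OF p(1) lt(2), unfolded p] pconj_brauer_H[OF p(1) lt, unfolded p]]])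
  also have "peq \<delta> r r \<dots> (pconj r p (PAdd (H0e r (Suc 1)) (brauer_H r 0 1)))"
    by (rule peq.sym[OF pconj_add] p w)+
  finally show ?thesis
    by (rule commutes_cong[OF c peq.sym[OF pconj_H0e[OF p(1) lt(1), unfolded p]]])
qed

lemma commutes_skew:
  assumes l: "i < r" "j < r" "i \<noteq> j"
  shows "commutes \<delta> r (PAdd (H0e r (Suc i)) (H0e r (Suc j))) (brauer_H r i j)"
proof -
  obtain n where r: "r = Suc (Suc n)" using l by (metis less_Suc0 not0_implies_Suc not_less_zero)
  obtain p where p: "p permutes {..<r}" "p 0 = i" "p 1 = j"
    using permutes_two_points l unfolding r by metis
  have lt: "0 < r" "1 < r" "(0::nat) \<noteq> 1" using r by auto
  let ?a = "H0e r (Suc 0)" and ?b = "H0e r (Suc 1)" and ?e = "io r r (arc r 0 1)" and ?s = "ip r (swp 0 1)"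
  let ?h = "ph (Suc n) (Suc n) (idd (Suc n))"
  have h: "pwt ?h r r" unfolding r by (rule pwt_hb)
  note w = pwt.intros(2,3,6) pwt_H0e[OF lt(1)] pwt_H0e[OF lt(2)] pwt_brauer_H[OF lt] pwt_arc[OF lt] pwt_swp[OF lt(1,2)] h
  note s = swp_permutes[OF lt(1,2)]
  have a: "peq \<delta> r r ?a ?h" unfolding r by (rule H0e_hb)
  have b: "peq \<delta> r r ?b (PComp ?s (PComp ?h ?s))"
    using H0e_hb(2)[of \<delta> n] unfolding r pconj_def inv_swp .
  have "commutes \<delta> r (PAdd ?a ?b) (brauer_H r 0 1)"
  proof (rule commutes_brauer_H[OF lt])
    show "pwt (PAdd ?a ?b) r r" by (rule w)+
    have "peq \<delta> r r (pconj r (swp 0 1) (PAdd ?a ?b)) (PAdd (pconj r (swp 0 1) ?a) (pconj r (swp 0 1) ?b))"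
      by (rule pconj_add s w)+
    also have "peq \<delta> r r \<dots> (PAdd ?b ?a)"
      using pconj_H0e[OF s lt(1), of \<delta>] pconj_H0e[OF s lt(2), of \<delta>]
      by (intro peq.add_cong) (simp_all add: swp_def)
    also have "peq \<delta> r r \<dots> (PAdd ?a ?b)" by (rule peq.add_comm w)+
    finally show "peq \<delta> r r (pconj r (swp 0 1) (PAdd ?a ?b)) (PAdd ?a ?b)" .
    \<comment> \<open>With b = s h s and s e = e one gets b e = s h e, which is - h e by skew
      symmetry in the form of \<open>hb_arc\<close>. The product e b is the mirror image.\<close>
    have "peq \<delta> r r (PComp ?b ?e) (PComp (PComp ?s (PComp ?h ?s)) ?e)"
      by (rule peq.comp_cong[OF b peq.refl] w)+
    also have "peq \<delta> r r \<dots> (PComp ?s (PComp (PComp ?h ?s) ?e))" by (rule peq.comp_assoc w)+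
    also have "peq \<delta> r r \<dots> (PComp ?s (PComp ?h (PComp ?s ?e)))"
      by (rule peq.comp_cong[OF peq.refl peq.comp_assoc] w)+
    also have "peq \<delta> r r \<dots> (PComp ?s (PComp ?h ?e))"
      by (rule peq.comp_cong[OF peq.refl peq.comp_cong[OF peq.refl arc_swp(1)[OF lt]]] w)+
    also have "peq \<delta> r r \<dots> (PSmul (-1) (PComp ?h ?e))" unfolding r by (rule hb_arc)
    also have "peq \<delta> r r \<dots> (PSmul (-1) (PComp ?a ?e))"
      by (rule peq.smul_cong[OF peq.comp_cong[OF peq.sym[OF a] peq.refl]] w)+
    finally have be: "peq \<delta> r r (PComp ?b ?e) (PSmul (-1) (PComp ?a ?e))" .
    have "peq \<delta> r r (PComp (PAdd ?a ?b) ?e) (PAdd (PComp ?a ?e) (PComp ?b ?e))"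
      by (rule peq.comp_add_left w)+
    also have "peq \<delta> r r \<dots> (PAdd (PComp ?b ?e) (PComp ?a ?e))" by (rule peq.add_comm w)+
    also have "peq \<delta> r r \<dots> (PZero r r)" by (rule peq_neg_add[OF be] w)+
    finally show "peq \<delta> r r (PComp (PAdd ?a ?b) ?e) (PZero r r)" .
    have "peq \<delta> r r (PComp ?e ?b) (PComp ?e (PComp ?s (PComp ?h ?s)))"
      by (rule peq.comp_cong[OF peq.refl b] w)+
    also have "peq \<delta> r r \<dots> (PComp (PComp ?e ?s) (PComp ?h ?s))" by (rule peq.sym[OF peq.comp_assoc] w)+
    also have "peq \<delta> r r \<dots> (PComp ?e (PComp ?h ?s))"
      by (rule peq.comp_cong[OF arc_swp(2)[OF lt] peq.refl] w)+
    also have "peq \<delta> r r \<dots> (PComp (PComp ?e ?h) ?s)" by (rule peq.sym[OF peq.comp_assoc] w)+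
    also have "peq \<delta> r r \<dots> (PSmul (-1) (PComp ?e ?h))" unfolding r by (rule hb_arc)
    also have "peq \<delta> r r \<dots> (PSmul (-1) (PComp ?e ?a))"
      by (rule peq.smul_cong[OF peq.comp_cong[OF peq.refl peq.sym[OF a]]] w)+
    finally have eb: "peq \<delta> r r (PComp ?e ?b) (PSmul (-1) (PComp ?e ?a))" .
    have "peq \<delta> r r (PComp ?e (PAdd ?a ?b)) (PAdd (PComp ?e ?a) (PComp ?e ?b))"
      by (rule peq.comp_add_right w)+
    also have "peq \<delta> r r \<dots> (PAdd (PComp ?e ?b) (PComp ?e ?a))" by (rule peq.add_comm w)+
    also have "peq \<delta> r r \<dots> (PZero r r)" by (rule peq_neg_add[OF eb] w)+
    finally show "peq \<delta> r r (PComp ?e (PAdd ?a ?b)) (PZero r r)" .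
  qed
  then have c: "commutes \<delta> r (pconj r p (PAdd ?a ?b)) (pconj r p (brauer_H r 0 1))"
    by (rule pconj_commutes[OF p(1) w(1)[OF w(4,5)] w(6)])
  have "peq \<delta> r r (PAdd (H0e r (Suc i)) (H0e r (Suc j))) (PAdd (pconj r p ?a) (pconj r p ?b))"
    by (rule peq.sym[OF peq.add_cong[OF pconj_H0e[OF p(1) lt(1), unfolded p] pconj_H0e[OF p(1) lt(2), unfolded p]]])
  also have "peq \<delta> r r \<dots> (pconj r p (PAdd ?a ?b))"
    by (rule peq.sym[OF pconj_add] p w)+
  finally show ?thesis
    by (rule commutes_cong[OF c _ peq.sym[OF pconj_brauer_H[OF p(1) lt, unfolded p]]])
qed

section \<open>The homomorphism from the chord algebra\<close>

text \<open>Symmetric in the indices like t_ij, with 0 for the pole, so that the chord relations can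
  be checked without ordering the indices.\<close>

definition chord_H :: "nat \<Rightarrow> nat \<Rightarrow> nat \<Rightarrow> 'k::comm_ring_1 pexp" where
  "chord_H r a b = Hmat r (min a b) (max a b)"

lemma chord_H_commute: "chord_H r a b = chord_H r b a"
  by (simp add: chord_H_def min.commute max.commute)

lemma chord_H_simps:
  "chord_H r 0 (Suc i) = H0e r (Suc i)" "chord_H r (Suc i) 0 = H0e r (Suc i)" "chord_H r (Suc i) (Suc j) = brauer_H r i j"
proof -
  show "chord_H r 0 (Suc i) = H0e r (Suc i)" "chord_H r (Suc i) 0 = H0e r (Suc i)"
    by (simp_all add: chord_H_def Hmat_def)
  show "chord_H r (Suc i) (Suc j) = brauer_H r i j"
    by (cases "i \<le> j") (simp_all add: chord_H_def min_def max_def Hmat_Suc brauer_H_commute[of r j i])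
qed

lemma pwt_chord_H:
  assumes "a \<le> r" "b \<le> r" "a \<noteq> b"
  shows "pwt (chord_H r a b) r r"
  using assms by (cases a; cases b) (auto simp: chord_H_simps intro: pwt_H0e pwt_brauer_H)

lemma commutes_chord_H_chord_H:
  assumes "a \<le> r" "b \<le> r" "c \<le> r" "d \<le> r" "distinct [a, b, c, d]"
  shows "commutes \<delta> r (chord_H r a b) (chord_H r c d)"
  using assms
  by (cases a; cases b; cases c; cases d)
    (auto simp: chord_H_simps intro!: commutes_H0e_brauer_H commutes_brauer_H_brauer_H commutes_sym[OF commutes_H0e_brauer_H])

text \<open>The position of the pole decides the source: as the shared index \<open>a\<close> it is
  skew symmetry, as \<open>b\<close> or \<open>c\<close> it is the four-term relation, and without
  the pole it is a relation between Brauer diagrams.\<close>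

lemma commutes_chord_H_add_chord_H:
  assumes l: "a \<le> r" "b \<le> r" "c \<le> r" and d: "distinct [a, b, c]"
  shows "commutes \<delta> r (PAdd (chord_H r a b) (chord_H r a c)) (chord_H r b c)"
proof -
  have four: "commutes \<delta> r (PAdd (H0e r (Suc i)) (brauer_H r i k)) (H0e r (Suc k))"
    if "i < r" "k < r" "i \<noteq> k" for i k
    using commutes_sym[OF commutes_fourterm[of k r i \<delta>]] that by (simp add: brauer_H_commute[of r k i])
  consider i j where "a = 0" "b = Suc i" "c = Suc j" | i k where "a = Suc i" "b = 0" "c = Suc k"
    | i j where "a = Suc i" "b = Suc j" "c = 0" | i j k where "a = Suc i" "b = Suc j" "c = Suc k"
    using d by (cases a; cases b; cases c) auto
  then show ?thesis
  proof cases
    case 1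
    then show ?thesis using l d by (simp add: chord_H_simps commutes_skew)
  next
    case 2
    then show ?thesis using l d by (simp add: chord_H_simps four)
  next
    case 3
    then have ij: "i < r" "j < r" "i \<noteq> j" using l d by auto
    have "commutes \<delta> r (PAdd (brauer_H r i j) (H0e r (Suc i))) (H0e r (Suc j))"
      by (rule commutes_cong[OF four[OF ij] peq.add_comm peq.refl])
        (rule pwt_brauer_H pwt_H0e ij)+
    then show ?thesis using 3 by (simp add: chord_H_simps)
  next
    case 4
    then show ?thesis using l d by (simp add: chord_H_simps commutes_brauer_H_add_brauer_H)
  qed
qed

section \<open>Evaluation of chord expressions, and its compatibility with the relations\<close>

primrec chord_eval :: "nat \<Rightarrow> 'k::comm_ring_1 texp \<Rightarrow> 'k pexp" where
  "chord_eval r (TVar i j) = Hmat r (i - 1) (j - 1)"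
| "chord_eval r TZero = PZero r r"
| "chord_eval r TOne = pid r"
| "chord_eval r (TAdd a b) = PAdd (chord_eval r a) (chord_eval r b)"
| "chord_eval r (TSmul c a) = PSmul c (chord_eval r a)"
| "chord_eval r (TMul a b) = PComp (chord_eval r a) (chord_eval r b)"

lemma chord_eval_tv: "1 \<le> i \<Longrightarrow> 1 \<le> j \<Longrightarrow> chord_eval r (tv i j) = chord_H r (i - 1) (j - 1)"
  by (cases i; cases j) (simp_all add: tv_def chord_H_def)

lemma pwt_chord_eval:
  fixes t :: "'k::comm_ring_1 texp"
  shows "twf (Suc r) t \<Longrightarrow> pwt (chord_eval r t) r r"
proof (induction rule: twf.induct)
  case (1 i j)
  then have "chord_eval r (TVar i j) = (chord_H r (i - 1) (j - 1) :: 'k pexp)"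
    by (cases i; cases j) (simp_all add: chord_H_def)
  moreover have "i - 1 \<le> r" "j - 1 \<le> r" "i - 1 \<noteq> j - 1" using 1 by auto
  ultimately show ?case by (simp only: pwt_chord_H not_False_eq_True)
qed (auto intro: pwt.intros pwt_pid)

lemma peq_chord_eval_tcomm:
  assumes "commutes \<delta> r (chord_eval r a) (chord_eval r b)" "pwt (chord_eval r a) r r" "pwt (chord_eval r b) r r"
  shows "peq \<delta> r r (chord_eval r (tcomm a b)) (chord_eval r TZero)"
  using assms unfolding tcomm_def commutes_def
  by (simp add: peq_sub_self pwt.intros(6))

lemma peq_chord_eval: "teq (Suc r) s t \<Longrightarrow> peq \<delta> r r (chord_eval r s) (chord_eval r t)"
proof (induction rule: teq.induct)
  case (rel1 i j k l)
  \<comment> \<open>Indices of the chord algebra start at 1, so truncated subtraction keeps distinct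
    indices distinct; index 1 becomes the pole.\<close>
  then have "i - 1 \<le> r" "j - 1 \<le> r" "k - 1 \<le> r" "l - 1 \<le> r" "distinct [i - 1, j - 1, k - 1, l - 1]"
    by auto
  then show ?case
    using rel1 by (intro peq_chord_eval_tcomm) (auto simp: chord_eval_tv intro!: pwt_chord_H commutes_chord_H_chord_H)
next
  case (rel2 i k l)
  then have "i - 1 \<le> r" "k - 1 \<le> r" "l - 1 \<le> r" "distinct [i - 1, k - 1, l - 1]"
    by auto
  then show ?case
    using rel2 by (intro peq_chord_eval_tcomm) (auto simp: chord_eval_tv intro!: pwt_chord_H pwt.intros(2) commutes_chord_H_add_chord_H)
next
  case (rel3 i j k)
  then have l: "k - 1 \<le> r" "i - 1 \<le> r" "j - 1 \<le> r" "distinct [k - 1, i - 1, j - 1]"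
    by auto
  \<comment> \<open>The third chord relation is the second one with k as the shared index, up to the
    order in the commutator.\<close>
  have "commutes \<delta> r (chord_H r (i - 1) (j - 1)) (PAdd (chord_H r (i - 1) (k - 1)) (chord_H r (j - 1) (k - 1)))"
    using commutes_sym[OF commutes_chord_H_add_chord_H[OF l, of \<delta>]]
    by (simp only: chord_H_commute[of r "k - 1"])
  then show ?case
    using rel3 l by (intro peq_chord_eval_tcomm) (auto simp: chord_eval_tv intro!: pwt_chord_H pwt.intros(2))
qed (auto intro: peq.intros pwt_chord_eval)

section \<open>Operations on classes\<close>

lemma pcls_eq_iff: "pwt a r r \<Longrightarrow> pcls \<delta> r a = pcls \<delta> r b \<longleftrightarrow> peq \<delta> r r a b"
  unfolding pcls_def by (auto intro: peq.intros)

lemma padd_pcls: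
  assumes "pwt a r r" "pwt b r r"
  shows "padd \<delta> r (pcls \<delta> r a) (pcls \<delta> r b) = pcls \<delta> r (PAdd a b)"
  using peq.refl[OF assms(1), of \<delta>] peq.refl[OF assms(2), of \<delta>]
  unfolding padd_def pcls_def by (auto intro: peq.add_cong peq.trans)

lemma pmul_pcls:
  assumes "pwt a r r" "pwt b r r"
  shows "pmul \<delta> r (pcls \<delta> r a) (pcls \<delta> r b) = pcls \<delta> r (PComp a b)"
  using peq.refl[OF assms(1), of \<delta>] peq.refl[OF assms(2), of \<delta>]
  unfolding pmul_def pcls_def by (auto intro: peq.comp_cong peq.trans)

lemma psm_pcls: "pwt a r r \<Longrightarrow> psm \<delta> r c (pcls \<delta> r a) = pcls \<delta> r (PSmul c a)"
  using peq.refl[of a r r \<delta>]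
  unfolding psm_def pcls_def by (auto intro: peq.smul_cong peq.trans)

lemma tadd_tcls:
  assumes "twf n a" "twf n b"
  shows "tadd n (tcls n a) (tcls n b) = tcls n (TAdd a b)"
  using teq.refl[OF assms(1)] teq.refl[OF assms(2)]
  unfolding tadd_def tcls_def by (auto intro: teq.add_cong teq.trans)

lemma tmul_tcls:
  assumes "twf n a" "twf n b"
  shows "tmul n (tcls n a) (tcls n b) = tcls n (TMul a b)"
  using teq.refl[OF assms(1)] teq.refl[OF assms(2)]
  unfolding tmul_def tcls_def by (auto intro: teq.mul_cong teq.trans)

lemma tsm_tcls: "twf n a \<Longrightarrow> tsm n c (tcls n a) = tcls n (TSmul c a)"
  using teq.refl[of n a]
  unfolding tsm_def tcls_def by (auto intro: teq.smul_cong teq.trans)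

text \<open>Since 0 + 0 = 0, the element is its own double, and adding its negative cancels one
  copy.\<close>

lemma teq_smul_zero:
  assumes "twf n a"
  shows "teq n (TSmul 0 a) TZero"
proof -
  let ?z = "TSmul 0 a" and ?nz = "TSmul (-1) (TSmul 0 a)"
  note [trans] = teq.trans
  note w = assms twf.intros(2,4,5)
  have "teq n ?z (TAdd ?z TZero)" by (intro teq.sym[OF teq.add_zero] w)
  also have "teq n \<dots> (TAdd ?z (TAdd ?z ?nz))"
    by (intro teq.add_cong teq.refl teq.sym[OF teq.add_neg] w)
  also have "teq n \<dots> (TAdd (TAdd ?z ?z) ?nz)" by (intro teq.sym[OF teq.add_assoc] w)
  also have "teq n \<dots> (TAdd ?z ?nz)"
    using teq.sym[OF teq.add_smul[OF assms, of 0 0]]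
    by (intro teq.add_cong teq.refl w) simp
  also have "teq n \<dots> TZero" by (intro teq.add_neg w)
  finally show ?thesis .
qed

text \<open>\<open>chord_alg_hom\<close> has no clause for zero; writing it as 0 times the unit
  brings it under the clauses for \<open>tsm\<close> and \<open>tone\<close>, as needed for
  uniqueness.\<close>

lemma tcls_zero: "tcls n TZero = tsm n 0 (tone n)"
proof -
  have "teq n (TSmul 0 TOne) TZero" by (intro teq_smul_zero twf.intros)
  then have "tcls n TZero = tcls n (TSmul 0 TOne)"
    unfolding tcls_def by (auto intro: teq.trans teq.sym)
  then show ?thesis by (simp add: tone_def tsm_tcls twf.intros)
qed

text \<open>All members of the class are evaluated, so no representative is chosen;
  \<open>peq_chord_eval\<close> shows that the outcome is a single class.\<close>

definition chord_map :: "'k::comm_ring_1 \<Rightarrow> nat \<Rightarrow> 'k texp set \<Rightarrow> 'k pexp set" where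
  "chord_map \<delta> r X = {b. \<exists>t\<in>X. peq \<delta> r r (chord_eval r t) b}"

lemma chord_map_tcls: "twf (Suc r) t \<Longrightarrow> chord_map \<delta> r (tcls (Suc r) t) = pcls \<delta> r (chord_eval r t)"
  using teq.refl[of "Suc r" t]
  unfolding chord_map_def tcls_def pcls_def by (auto intro: peq_chord_eval peq.trans)

section \<open>The image lies in AB_r\<close>

lemma pwt_ABgen: "a \<in> ABgen r \<Longrightarrow> pwt a r r"
proof (induction rule: ABgen.induct)
  case (gen_H0 j)
  then show ?case using pwt_H0e[of "j - 1" r] by (cases j) simp_all
next
  case (gen_s k)
  then show ?case by (auto simp: transd_def intro!: pwt_swp)
next
  case (gen_e k)
  then obtain i where "k = Suc i" by (cases k) auto
  then show ?case using gen_e by (simp add: pwt_arc)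
qed (auto intro: pwt.intros pwt_pid)

text \<open>\<open>ABgen\<close> consists of particular expressions, whereas H_ij for distant
  strands is equal to one of them only modulo the relations; \<open>inAB\<close> is stable under
  \<open>peq\<close>.\<close>

definition inAB :: "'k::comm_ring_1 \<Rightarrow> nat \<Rightarrow> 'k pexp \<Rightarrow> bool" where
  "inAB \<delta> r x \<longleftrightarrow> (\<exists>a\<in>ABgen r. peq \<delta> r r x a)"

lemma inABI: "a \<in> ABgen r \<Longrightarrow> inAB \<delta> r a"
  unfolding inAB_def using peq.refl[OF pwt_ABgen] by blast

lemma inAB_cong: "peq \<delta> r r x y \<Longrightarrow> inAB \<delta> r y \<Longrightarrow> inAB \<delta> r x"
  unfolding inAB_def by (meson peq.trans)

lemma inAB_comp: "inAB \<delta> r x \<Longrightarrow> inAB \<delta> r y \<Longrightarrow> inAB \<delta> r (PComp x y)"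
  unfolding inAB_def by (meson ABgen.gen_comp peq.comp_cong)

lemma inAB_add: "inAB \<delta> r x \<Longrightarrow> inAB \<delta> r y \<Longrightarrow> inAB \<delta> r (PAdd x y)"
  unfolding inAB_def by (meson ABgen.gen_add peq.add_cong)

lemma inAB_smul: "inAB \<delta> r x \<Longrightarrow> inAB \<delta> r (PSmul c x)"
  unfolding inAB_def by (meson ABgen.gen_smul peq.smul_cong)

lemma inAB_swp_arc_adjacent:
  assumes "Suc i < r"
  shows "inAB \<delta> r (ip r (swp i (Suc i)))" "inAB \<delta> r (io r r (arc r i (Suc i)))"
  using inABI[OF ABgen.gen_s[of "Suc i" r]] inABI[OF ABgen.gen_e[of "Suc i" r]] assms
  by (simp_all add: transd_def)

text \<open>Only adjacent pairs occur among the generators. Conjugating by the swap of j and j + 1,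
  itself a generator, moves the pair (i, j) to (i, j + 1).\<close>

lemma inAB_swp_arc:
  assumes "i < j" "j < r"
  shows "inAB \<delta> r (ip r (swp i j)) \<and> inAB \<delta> r (io r r (arc r i j))"
  using assms
proof (induction j)
  case (Suc j)
  show ?case
  proof (cases "i = j")
    case True
    then show ?thesis using inAB_swp_arc_adjacent Suc.prems by blast
  next
    case False
    then have ij: "i < r" "j < r" "i \<noteq> j" "Suc j < r" using Suc.prems by auto
    note IH = Suc.IH[OF _ ij(2)] inAB_swp_arc_adjacent(1)[OF ij(4), of \<delta>]
    let ?p = "swp j (Suc j)"
    have p: "?p permutes {..<r}" using ij by (intro swp_permutes)
    have e: "?p i = i" "?p j = Suc j" using False Suc.prems by (auto simp: swp_def)
    have pconj: "inAB \<delta> r (pconj r ?p x)" if "inAB \<delta> r x" for x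
      unfolding pconj_def inv_swp by (intro inAB_comp IH(2) that)
    have "peq \<delta> r r (pconj r ?p (ip r (swp i j))) (ip r (swp i (Suc j)))"
      using pconj_io[OF p is_diag_perm[OF swp_permutes[OF ij(1,2)]], of \<delta>]
      by (simp add: rdiag_swp[OF p ij(1,2)] e)
    moreover have "peq \<delta> r r (pconj r ?p (io r r (arc r i j))) (io r r (arc r i (Suc j)))"
      using pconj_io[OF p is_diag_arc[OF ij(1-3)], of \<delta>] by (simp add: rdiag_arc[OF p] e)
    ultimately show ?thesis
      using pconj IH(1) False Suc.prems by (metis inAB_cong less_antisym peq.sym)
  qed
qed simp

lemma inAB_chord_eval: "twf (Suc r) t \<Longrightarrow> inAB \<delta> r (chord_eval r t)"
proof (induction rule: twf.induct)
  case (1 i j)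
  \<comment> \<open>Two shifts add up: index m of the chord algebra is index m - 1 of
    \<open>Hmat\<close>, which is the pole for m = 1 and otherwise strand m - 2 counted from
    0.\<close>
  then obtain b where j: "j = Suc (Suc b)" by (cases j; cases "j - 1") auto
  show ?case
  proof (cases "i = 1")
    case True
    then show ?thesis using 1 inABI[OF ABgen.gen_H0[of "Suc b" r]] by (simp add: j Hmat_def)
  next
    case False
    then obtain a where i: "i = Suc (Suc a)" using 1 by (cases i; cases "i - 1") auto
    have "inAB \<delta> r (brauer_H r a b)"
      unfolding brauer_H_def using inAB_swp_arc[of a b r \<delta>] 1 i j by (intro inAB_add inAB_smul) auto
    then show ?thesis by (simp add: i j Hmat_Suc)
  qed
qed (auto intro: inABI ABgen.intros inAB_add inAB_smul inAB_comp)

lemma chord_map_in_ABr: "twf (Suc r) t \<Longrightarrow> pcls \<delta> r (chord_eval r t) \<in> ABr \<delta> r"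
  using inAB_chord_eval[of r t \<delta>] pcls_eq_iff[OF pwt_chord_eval, of r t \<delta>]
  unfolding inAB_def ABr_def by blast

section \<open>Homomorphism property and uniqueness\<close>

lemma Tcar_cases:
  assumes "X \<in> Tcar n"
  obtains t where "twf n t" "X = tcls n t"
  using assms unfolding Tcar_def by auto

lemma chord_alg_hom_chord_map: "chord_alg_hom \<delta> r (chord_map \<delta> r)"
proof -
  have "chord_map \<delta> r X \<in> ABr \<delta> r" if "X \<in> Tcar (Suc r)" for X
    using that by (elim Tcar_cases) (simp add: chord_map_tcls chord_map_in_ABr)
  moreover have "chord_map \<delta> r (tadd (Suc r) X Y) = padd \<delta> r (chord_map \<delta> r X) (chord_map \<delta> r Y)"
    if "X \<in> Tcar (Suc r)" "Y \<in> Tcar (Suc r)" for X Y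
    using that
    by (elim Tcar_cases) (simp add: chord_map_tcls tadd_tcls padd_pcls pwt_chord_eval twf.intros(4))
  moreover have "chord_map \<delta> r (tmul (Suc r) X Y) = pmul \<delta> r (chord_map \<delta> r X) (chord_map \<delta> r Y)"
    if "X \<in> Tcar (Suc r)" "Y \<in> Tcar (Suc r)" for X Y
    using that
    by (elim Tcar_cases) (simp add: chord_map_tcls tmul_tcls pmul_pcls pwt_chord_eval twf.intros(6))
  moreover have "chord_map \<delta> r (tsm (Suc r) c X) = psm \<delta> r c (chord_map \<delta> r X)"
    if "X \<in> Tcar (Suc r)" for c X
    using that
    by (elim Tcar_cases) (simp add: chord_map_tcls tsm_tcls psm_pcls pwt_chord_eval twf.intros(5))
  moreover have "chord_map \<delta> r (tone (Suc r)) = pone \<delta> r"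
    by (simp add: tone_def pone_def chord_map_tcls twf.intros(3))
  ultimately show ?thesis by (simp add: chord_alg_hom_def)
qed

lemma sends_generators_chord_map: "sends_generators \<delta> r (chord_map \<delta> r)"
  by (simp add: sends_generators_def chord_map_tcls twf.intros(1))

lemma chord_alg_hom_unique:
  fixes \<delta> :: "'k::comm_ring_1"
  assumes h: "chord_alg_hom \<delta> r \<Psi>" "sends_generators \<delta> r \<Psi>"
    and h': "chord_alg_hom \<delta> r \<Phi>" "sends_generators \<delta> r \<Phi>"
    and X: "X \<in> Tcar (r + 1)"
  shows "\<Psi> X = \<Phi> X"
proof -
  have mem: "tcls (r + 1) t \<in> Tcar (r + 1)" if "twf (r + 1) t" for t :: "'k texp"
    using that by (simp add: Tcar_def)
  have "\<Psi> (tcls (r + 1) t) = \<Phi> (tcls (r + 1) t)" if "twf (r + 1) t" for t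
    using that
  proof (induction rule: twf.induct)
    case (1 i j)
    then show ?case using h(2) h'(2) by (simp add: sends_generators_def)
  next
    case 2
    have "(tone (r + 1) :: 'k texp set) \<in> Tcar (r + 1)" unfolding tone_def by (intro mem twf.intros)
    then show ?case using h(1) h'(1) by (simp add: chord_alg_hom_def tcls_zero)
  next
    case 3
    then show ?case using h(1) h'(1) by (simp add: chord_alg_hom_def tone_def)
  next
    case (4 a b)
    then show ?case
      using h(1) h'(1) mem by (simp add: chord_alg_hom_def flip: tadd_tcls)
  next
    case (5 a c)
    then show ?case
      using h(1) h'(1) mem by (simp add: chord_alg_hom_def flip: tsm_tcls)
  next
    case (6 a b)
    then show ?case
      using h(1) h'(1) mem by (simp add: chord_alg_hom_def flip: tmul_tcls)
  qed
  then show ?thesis using X by (auto elim: Tcar_cases)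
qed

section \<open>Surjectivity\<close>

lemma arc_squared:
  assumes l: "i < r" "j < r" "i \<noteq> j"
  shows "peq \<delta> r r (PComp (io r r (arc r i j)) (io r r (arc r i j))) (PSmul \<delta> (io r r (arc r i j)))"
  using peq.rel_I0[OF is_diag_arc[OF l] is_diag_arc[OF l], of \<delta>] by (simp add: arc_arc_same[OF l])

lemma swp_squared:
  assumes l: "i < r" "j < r"
  shows "peq \<delta> r r (PComp (ip r (swp i j)) (ip r (swp i j))) (pid r)"
  using ip_comp[OF swp_permutes[OF l] swp_permutes[OF l], of \<delta>] by (simp add: swp_comp_swp ip_id)

text \<open>Expand (s - e)^2 = s^2 - s e - e s + e^2 and use s^2 = 1, s e = e s = e and e^2 =
  \<delta> e: the 2 in the coefficient comes from the mixed terms and \<delta> from the closed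
  loop.\<close>

lemma brauer_H_squared:
  assumes l: "i < r" "j < r" "i \<noteq> j"
  shows "peq \<delta> r r (PAdd (PComp (brauer_H r i j) (brauer_H r i j)) (PSmul (-1) (pid r)))
     (PSmul (\<delta> - 2) (io r r (arc r i j)))"
proof -
  let ?s = "ip r (swp i j)" and ?e = "io r r (arc r i j)" and ?g = "brauer_H r i j" and ?I = "pid r"
  note w = pwt.intros(1-3,6) pwt_arc[OF l] pwt_swp[OF l(1,2)] pwt_pid pwt_brauer_H[OF l]
  have lin: "peq \<delta> r r (PAdd (PSmul x ?e) (PSmul y ?e)) (PSmul (x + y) ?e)" for x y
    by (rule peq.sym[OF peq.add_smul] w)+
  have "peq \<delta> r r (PComp ?g ?s) (PAdd (PComp ?s ?s) (PComp (PSmul (-1) ?e) ?s))"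
    unfolding brauer_H_def by (rule peq.comp_add_left w)+
  also have "peq \<delta> r r \<dots> (PAdd ?I (PSmul (-1) ?e))"
    by (rule peq.add_cong[OF swp_squared[OF l(1,2)] peq.trans[OF peq.comp_smul_left
          peq.smul_cong[OF arc_swp(2)[OF l]]]] w)+
  finally have gs: "peq \<delta> r r (PComp ?g ?s) (PAdd ?I (PSmul (-1) ?e))" .
  have "peq \<delta> r r (PComp ?g ?e) (PAdd (PComp ?s ?e) (PComp (PSmul (-1) ?e) ?e))"
    unfolding brauer_H_def by (rule peq.comp_add_left w)+
  also have "peq \<delta> r r \<dots> (PAdd ?e (PSmul (-1) (PSmul \<delta> ?e)))"
    by (rule peq.add_cong[OF arc_swp(1)[OF l] peq.trans[OF peq.comp_smul_left
          peq.smul_cong[OF arc_squared[OF l]]]] w)+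
  also have "peq \<delta> r r \<dots> (PAdd (PSmul 1 ?e) (PSmul (-1 * \<delta>) ?e))"
    by (rule peq.add_cong[OF peq.sym[OF peq.smul_one] peq.sym[OF peq.smul_smul]] w)+
  also have "peq \<delta> r r \<dots> (PSmul (1 + -1 * \<delta>) ?e)" by (rule lin)
  finally have ge: "peq \<delta> r r (PComp ?g ?e) (PSmul (1 + -1 * \<delta>) ?e)" .
  have "peq \<delta> r r (PComp ?g (PSmul (-1) ?e)) (PSmul (-1) (PComp ?g ?e))"
    by (rule peq.comp_smul_right w)+
  also have "peq \<delta> r r \<dots> (PSmul (-1) (PSmul (1 + -1 * \<delta>) ?e))" by (rule peq.smul_cong[OF ge])
  also have "peq \<delta> r r \<dots> (PSmul (-1 * (1 + -1 * \<delta>)) ?e)" by (rule peq.sym[OF peq.smul_smul] w)+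
  finally have ge': "peq \<delta> r r (PComp ?g (PSmul (-1) ?e)) (PSmul (-1 * (1 + -1 * \<delta>)) ?e)" .
  have "peq \<delta> r r (PComp ?g ?g) (PAdd (PComp ?g ?s) (PComp ?g (PSmul (-1) ?e)))"
    by (subst (2) brauer_H_def) (rule peq.comp_add_right w)+
  also have "peq \<delta> r r \<dots> (PAdd (PAdd ?I (PSmul (-1) ?e)) (PSmul (-1 * (1 + -1 * \<delta>)) ?e))"
    by (rule peq.add_cong[OF gs ge'])
  also have "peq \<delta> r r \<dots> (PAdd ?I (PAdd (PSmul (-1) ?e) (PSmul (-1 * (1 + -1 * \<delta>)) ?e)))"
    by (rule peq.add_assoc w)+
  also have "peq \<delta> r r \<dots> (PAdd ?I (PSmul (-1 + -1 * (1 + -1 * \<delta>)) ?e))"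
    by (rule peq.add_cong[OF peq.refl lin] w)+
  also have "-1 + -1 * (1 + -1 * \<delta>) = \<delta> - 2" by simp
  also have "peq \<delta> r r (PAdd ?I (PSmul (\<delta> - 2) ?e)) (PAdd (PSmul (\<delta> - 2) ?e) ?I)"
    by (rule peq.add_comm w)+
  finally have gg: "peq \<delta> r r (PComp ?g ?g) (PAdd (PSmul (\<delta> - 2) ?e) ?I)" .
  have "peq \<delta> r r (PAdd (PComp ?g ?g) (PSmul (-1) ?I)) (PAdd (PAdd (PSmul (\<delta> - 2) ?e) ?I) (PSmul (-1) ?I))"
    by (rule peq.add_cong[OF gg peq.refl] w)+
  also have "peq \<delta> r r \<dots> (PAdd (PSmul (\<delta> - 2) ?e) (PAdd ?I (PSmul (-1) ?I)))"
    by (rule peq.add_assoc w)+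
  also have "peq \<delta> r r \<dots> (PAdd (PSmul (\<delta> - 2) ?e) (PZero r r))"
    by (rule peq.add_cong[OF peq.refl peq.add_neg] w)+
  also have "peq \<delta> r r \<dots> (PSmul (\<delta> - 2) ?e)" by (rule peq.add_zero w)+
  finally show ?thesis .
qed

lemma ABgen_reached:
  fixes a :: "'k::comm_ring_1 pexp"
  assumes unit: "(\<delta> - 2) dvd 1" and a: "a \<in> ABgen r"
  shows "\<exists>t. twf (Suc r) t \<and> peq \<delta> r r (chord_eval r t) a"
proof -
  obtain u where u: "u * (\<delta> - 2) = 1" using unit by (metis dvdE mult.commute)
  \<comment> \<open>\<open>?v k\<close> is t_{k+1,k+2}, whose image is H_{k,k+1}. Since u inverts
    \<delta> - 2, the expression \<open>?te k\<close>, which is u times (\<open>?v k\<close> squared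
    minus 1), evaluates to e_k.\<close>
  let ?v = "\<lambda>k. TVar (Suc k) (Suc (Suc k)) :: 'k texp"
  let ?te = "\<lambda>k. TSmul u (TAdd (TMul (?v k) (?v k)) (TSmul (-1) TOne))"
  have v: "twf (Suc r) (?v k)" "chord_eval r (?v k) = brauer_H r (k - 1) k" if "1 \<le> k" "k < r" for k
    using that by (auto intro: twf.intros simp flip: Hmat_Suc)
  have e: "peq \<delta> r r (chord_eval r (?te k)) (io r r (arc r (k - 1) k))" and wte: "twf (Suc r) (?te k)"
    if k: "1 \<le> k" "k < r" for k
  proof -
    show "twf (Suc r) (?te k)" by (intro twf.intros(3-6) v k)
    have l: "k - 1 < r" "k < r" "k - 1 \<noteq> k" using k by auto
    note w = pwt_arc[OF l]
    have "peq \<delta> r r (chord_eval r (?te k)) (PSmul u (PSmul (\<delta> - 2) (io r r (arc r (k - 1) k))))"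
      unfolding chord_eval.simps(3-6) v(2)[OF k] by (rule peq.smul_cong[OF brauer_H_squared[OF l]])
    also have "peq \<delta> r r \<dots> (PSmul (u * (\<delta> - 2)) (io r r (arc r (k - 1) k)))"
      by (rule peq.sym[OF peq.smul_smul[OF w]])
    also have "peq \<delta> r r \<dots> (io r r (arc r (k - 1) k))"
      unfolding u by (rule peq.smul_one[OF w])
    finally show "peq \<delta> r r (chord_eval r (?te k)) (io r r (arc r (k - 1) k))" .
  qed
  show ?thesis
    using a
  proof (induction rule: ABgen.induct)
    case (gen_H0 j)
    then have "peq \<delta> r r (H0e r j) (H0e r j)" by (intro peq.refl pwt_ABgen ABgen.gen_H0)
    then show ?case
      using gen_H0 by (intro exI[of _ "TVar 1 (Suc j)"]) (auto intro: twf.intros simp: Hmat_def)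
  next
    case (gen_s k)
    then have l: "k - 1 < r" "k < r" "k - 1 \<noteq> k" by auto
    let ?s = "ip r (swp (k - 1) k)" and ?e = "io r r (arc r (k - 1) k)"
    note w = pwt.intros(1-3) pwt_arc[OF l] pwt_swp[OF l(1,2)] pwt_brauer_H[OF l]
    \<comment> \<open>The transposition is recovered as s_k = H_{k,k+1} + e_k.\<close>
    have "peq \<delta> r r (PAdd (chord_eval r (?v k)) (chord_eval r (?te k))) (PAdd (PAdd ?s (PSmul (-1) ?e)) ?e)"
      unfolding v(2)[OF gen_s] brauer_H_def[symmetric] by (rule peq.add_cong[OF peq.refl e[OF gen_s]] w)+
    also have "peq \<delta> r r \<dots> (PAdd ?s (PAdd (PSmul (-1) ?e) ?e))" by (rule peq.add_assoc w)+
    also have "peq \<delta> r r \<dots> (PAdd ?s (PZero r r))"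
      by (rule peq.add_cong[OF peq.refl peq_neg_add[OF peq.refl]] w)+
    also have "peq \<delta> r r \<dots> ?s" by (rule peq.add_zero w)+
    finally have "peq \<delta> r r (chord_eval r (TAdd (?v k) (?te k))) (io r r (transd r k (k + 1)))"
      by (simp add: transd_def)
    moreover have "twf (Suc r) (TAdd (?v k) (?te k))"
      by (intro twf.intros(4) v(1) wte gen_s)
    ultimately show ?case by blast
  next
    case (gen_e k)
    then show ?case using e[OF gen_e] wte[OF gen_e] by (intro exI[of _ "?te k"]) simp
  next
    case gen_one
    show ?case by (intro exI[of _ TOne]) (auto intro: twf.intros peq.refl pwt_pid)
  next
    case gen_zero
    show ?case by (intro exI[of _ TZero]) (auto intro: twf.intros peq.refl pwt.intros)
  next
    case (gen_add a b)
    then obtain s t where "twf (Suc r) s" "peq \<delta> r r (chord_eval r s) a" "twf (Suc r) t" "peq \<delta> r r (chord_eval r t) b"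
      by blast
    then show ?case by (intro exI[of _ "TAdd s t"]) (auto intro: twf.intros peq.add_cong)
  next
    case (gen_smul a c)
    then obtain s where "twf (Suc r) s" "peq \<delta> r r (chord_eval r s) a" by blast
    then show ?case by (intro exI[of _ "TSmul c s"]) (auto intro: twf.intros peq.smul_cong)
  next
    case (gen_comp a b)
    then obtain s t where "twf (Suc r) s" "peq \<delta> r r (chord_eval r s) a" "twf (Suc r) t" "peq \<delta> r r (chord_eval r t) b"
      by blast
    then show ?case by (intro exI[of _ "TMul s t"]) (auto intro: twf.intros peq.comp_cong)
  qed
qed

lemma chord_map_surj:
  assumes "(\<delta> - 2) dvd 1"
  shows "chord_map \<delta> r ` Tcar (r + 1) = ABr \<delta> r"
proof
  show "chord_map \<delta> r ` Tcar (r + 1) \<subseteq> ABr \<delta> r"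
    using chord_alg_hom_chord_map[of \<delta> r] by (auto simp: chord_alg_hom_def)
  show "ABr \<delta> r \<subseteq> chord_map \<delta> r ` Tcar (r + 1)"
  proof
    fix Y assume "Y \<in> ABr \<delta> r"
    then obtain a where a: "a \<in> ABgen r" "Y = pcls \<delta> r a" by (auto simp: ABr_def)
    obtain t where t: "twf (Suc r) t" "peq \<delta> r r (chord_eval r t) a"
      using ABgen_reached[OF assms a(1)] by blast
    then have "pcls \<delta> r (chord_eval r t) = Y"
      using a pcls_eq_iff[OF pwt_chord_eval[OF t(1)]] by blast
    then have "Y = chord_map \<delta> r (tcls (Suc r) t)"
      by (simp add: chord_map_tcls t(1))
    then show "Y \<in> chord_map \<delta> r ` Tcar (r + 1)"
      using t(1) by (simp add: Tcar_def)
  qed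
qed

theorem theorem3p6:
  fixes \<delta> :: "'k::comm_ring_1" and r :: nat
  assumes "r \<ge> 1"
  shows "\<exists>\<Phi>. chord_alg_hom \<delta> r \<Phi> \<and> sends_generators \<delta> r \<Phi>
           \<and> (\<forall>\<Psi>. chord_alg_hom \<delta> r \<Psi> \<and> sends_generators \<delta> r \<Psi> \<longrightarrow>
                  (\<forall>X\<in>Tcar (r + 1). \<Psi> X = \<Phi> X))
           \<and> ((\<delta> - 2) dvd 1 \<longrightarrow> \<Phi> ` Tcar (r + 1) = ABr \<delta> r)"
  using chord_alg_hom_chord_map[of \<delta> r] sends_generators_chord_map[of \<delta> r]
    chord_alg_hom_unique[of \<delta> r _ "chord_map \<delta> r"] chord_map_surj[of \<delta> r]
  by blast

end
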